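(* Let $W=(W_t)_{0\le t\le 1}$ be a one-dimensional Brownian motion and let $(\mathcal{F}_t)_{0\le t\le 1}$ be the filtration generated by $W$. Let $X=(X_t)_{0\le t\le 1}$, $X_0=0$, be a real-valued $L^2$ martingale with respect to $(\mathcal{F}_t)_{0\le t\le 1}$. Then there exists a sequence of Gaussian martingales $Y^n=(Y^n_t)_{0\le t\le 1}$, $Y^n_0=0$, of the form $dY^n_t=\varphi_n(t)f_n(t)\,dW_t$, where each $\varphi_n$ is a predictable process with $|\varphi_n|=1$ and each $f_n\in L^2[0,1]$ is deterministic, such that $X=\sum_n Y^n$, where the sum converges in $L^2$. Furthermore $\Vert X_1\Vert^2=\sum_n\Vert Y^n_1\Vert^2$.
   Context: The Brownian filtration is taken with the usual augmentation. $\Vert\cdot\Vert$ is the $L^2(\mathbb{P})$ norm. A Gaussian martingale is a martingale that is a Gaussian process. Convergence in $L^2$ of the series of martingales means that $\sum_n Y^n_1$ converges to $X_1$ in $L^2(\mathbb{P})$ (equivalently, $X_t=\sum_n Y^n_t$ in $L^2(\mathbb{P})$ for every $t\in[0,1]$). *)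

theory Defs
  imports "HOL-Probability.Probability"
begin

text \<open>
  A process on the time interval [0,1] is a function \<open>X :: real \<Rightarrow> 'a \<Rightarrow> real\<close> (time first);
  only its values at times in \<open>{0..1}\<close> matter. A filtration is a function \<open>F :: real \<Rightarrow> 'a measure\<close>
  of which only the sigma-algebras \<open>sets (F t)\<close>, for t in \<open>{0..1}\<close>, matter.
\<close>

definition sq_integrable :: "'a measure \<Rightarrow> ('a \<Rightarrow> real) \<Rightarrow> bool" where
  "sq_integrable M Z \<longleftrightarrow> Z \<in> borel_measurable M \<and> integrable M (\<lambda>x. (Z x)\<^sup>2)"

definition L2_norm :: "'a measure \<Rightarrow> ('a \<Rightarrow> real) \<Rightarrow> real" where
  "L2_norm M Z = sqrt (\<integral>x. (Z x)\<^sup>2 \<partial>M)"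

definition L2_tendsto :: "'a measure \<Rightarrow> (nat \<Rightarrow> 'a \<Rightarrow> real) \<Rightarrow> ('a \<Rightarrow> real) \<Rightarrow> bool" where
  "L2_tendsto M Z Z' \<longleftrightarrow>
     (\<forall>n. sq_integrable M (Z n)) \<and> sq_integrable M Z' \<and>
     (\<lambda>n. L2_norm M (\<lambda>x. Z n x - Z' x)) \<longlonglongrightarrow> 0"

abbreviation unit_lborel :: "real measure" where
  "unit_lborel \<equiv> restrict_space lborel {0..1}"

definition brownian_motion :: "'a measure \<Rightarrow> (real \<Rightarrow> 'a \<Rightarrow> real) \<Rightarrow> bool" where
  "brownian_motion M W \<longleftrightarrow>
     (\<forall>t\<in>{0..1}. W t \<in> borel_measurable M) \<and>
     (AE \<omega> in M. W 0 \<omega> = 0) \<and>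
     (\<forall>s t. 0 \<le> s \<and> s < t \<and> t \<le> 1 \<longrightarrow>
        distributed M lborel (\<lambda>\<omega>. W t \<omega> - W s \<omega>) (normal_density 0 (sqrt (t - s)))) \<and>
     (\<forall>n (t :: nat \<Rightarrow> real). 0 \<le> t 0 \<and> (\<forall>i<n. t i < t (Suc i)) \<and> t n \<le> 1 \<longrightarrow>
        prob_space.indep_vars M (\<lambda>_. borel) (\<lambda>i \<omega>. W (t (Suc i)) \<omega> - W (t i) \<omega>) {..<n}) \<and>
     (AE \<omega> in M. continuous_on {0..1} (\<lambda>t. W t \<omega>))"

text \<open>
  Augmentation adds all null sets of the underlying space, including the subsets of measurable null
  sets. So the resulting sigma-algebras are contained in \<open>sets (completion M)\<close>, and the
  probability space used with this filtration is \<open>completion M\<close>, which has the same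
  sigma-algebra as M if M is already complete.
\<close>

definition brownian_filtration :: "'a measure \<Rightarrow> (real \<Rightarrow> 'a \<Rightarrow> real) \<Rightarrow> real \<Rightarrow> 'a measure" where
  "brownian_filtration M W t =
     sigma (space M)
       ({W s -` B \<inter> space M | s B. s \<in> {0..t} \<and> B \<in> sets borel} \<union> null_sets (completion M))"

definition martingale :: "'a measure \<Rightarrow> (real \<Rightarrow> 'a measure) \<Rightarrow> (real \<Rightarrow> 'a \<Rightarrow> real) \<Rightarrow> bool" where
  "martingale M F X \<longleftrightarrow>
     (\<forall>t\<in>{0..1}. X t \<in> borel_measurable (F t) \<and> integrable M (X t)) \<and>
     (\<forall>s\<in>{0..1}. \<forall>t\<in>{s..1}. AE \<omega> in M. real_cond_exp M (F s) (X t) \<omega> = X s \<omega>)"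

definition L2_martingale :: "'a measure \<Rightarrow> (real \<Rightarrow> 'a measure) \<Rightarrow> (real \<Rightarrow> 'a \<Rightarrow> real) \<Rightarrow> bool" where
  "L2_martingale M F X \<longleftrightarrow> martingale M F X \<and> (\<forall>t\<in>{0..1}. sq_integrable M (X t))"

text \<open>Constants count as Gaussian random variables (the case \<open>\<sigma> = 0\<close>).\<close>

definition gaussian_rv :: "'a measure \<Rightarrow> ('a \<Rightarrow> real) \<Rightarrow> bool" where
  "gaussian_rv M Z \<longleftrightarrow>
     Z \<in> borel_measurable M \<and>
     (\<exists>\<mu> \<sigma>. 0 \<le> \<sigma> \<and>
        distr M borel Z =
          (if \<sigma> = 0 then return borel \<mu> else density lborel (normal_density \<mu> \<sigma>)))"

definition gaussian_process :: "'a measure \<Rightarrow> (real \<Rightarrow> 'a \<Rightarrow> real) \<Rightarrow> bool" where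
  "gaussian_process M Y \<longleftrightarrow>
     (\<forall>T c. finite T \<and> T \<subseteq> {0..1} \<longrightarrow> gaussian_rv M (\<lambda>\<omega>. \<Sum>t\<in>T. c t * Y t \<omega>))"

definition gaussian_martingale ::
    "'a measure \<Rightarrow> (real \<Rightarrow> 'a measure) \<Rightarrow> (real \<Rightarrow> 'a \<Rightarrow> real) \<Rightarrow> bool" where
  "gaussian_martingale M F Y \<longleftrightarrow> martingale M F Y \<and> gaussian_process M Y"

definition predictable_sigma :: "'a set \<Rightarrow> (real \<Rightarrow> 'a measure) \<Rightarrow> (real \<times> 'a) measure" where
  "predictable_sigma \<Omega> F =
     sigma ({0..1} \<times> \<Omega>)
       ({{0} \<times> A | A. A \<in> sets (F 0)} \<union>
        {{s<..t} \<times> A | s t A. 0 \<le> s \<and> s \<le> t \<and> t \<le> 1 \<and> A \<in> sets (F s)})"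

definition predictable :: "'a measure \<Rightarrow> (real \<Rightarrow> 'a measure) \<Rightarrow> (real \<Rightarrow> 'a \<Rightarrow> real) \<Rightarrow> bool" where
  "predictable M F H \<longleftrightarrow>
     (\<lambda>(t, \<omega>). H t \<omega>) \<in> borel_measurable (predictable_sigma (space M) F)"

text \<open>
  Elementary integrands are \<open>\<Sum>i<n. \<xi> i * 1_{(t i, t (i+1)]}\<close> with each \<open>\<xi> i\<close> bounded and
  measurable at time \<open>t i\<close>.
\<close>

definition elementary_integrand ::
    "'a measure \<Rightarrow> (real \<Rightarrow> 'a measure) \<Rightarrow> nat \<Rightarrow> (nat \<Rightarrow> real) \<Rightarrow> (nat \<Rightarrow> 'a \<Rightarrow> real) \<Rightarrow> bool" where
  "elementary_integrand M F n t \<xi> \<longleftrightarrow>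
     0 \<le> t 0 \<and> (\<forall>i<n. t i \<le> t (Suc i)) \<and> t n \<le> 1 \<and>
     (\<forall>i<n. \<xi> i \<in> borel_measurable (F (t i)) \<and> (\<exists>C. \<forall>\<omega>\<in>space M. \<bar>\<xi> i \<omega>\<bar> \<le> C))"

definition elementary_process ::
    "nat \<Rightarrow> (nat \<Rightarrow> real) \<Rightarrow> (nat \<Rightarrow> 'a \<Rightarrow> real) \<Rightarrow> real \<Rightarrow> 'a \<Rightarrow> real" where
  "elementary_process n t \<xi> u \<omega> = (\<Sum>i<n. \<xi> i \<omega> * indicator {t i<..t (Suc i)} u)"

definition elementary_integral ::
    "(real \<Rightarrow> 'a \<Rightarrow> real) \<Rightarrow> nat \<Rightarrow> (nat \<Rightarrow> real) \<Rightarrow> (nat \<Rightarrow> 'a \<Rightarrow> real) \<Rightarrow> real \<Rightarrow> 'a \<Rightarrow> real" where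
  "elementary_integral W n t \<xi> u \<omega> =
     (\<Sum>i<n. \<xi> i \<omega> * (W (min u (t (Suc i))) \<omega> - W (min u (t i)) \<omega>))"

text \<open>
  \<open>is_ito_integral M F W H Y\<close> says that Y is the Ito integral process \<open>Y t = \<integral>\<^sub>0\<^sup>t H dW\<close>: the
  integrand is predictable and square integrable with respect to \<open>dt \<otimes> dP\<close>, Y is adapted with
  almost surely continuous paths, and \<open>Y u\<close> is the \<open>L\<^sup>2\<close>-limit of the elementary integrals
  along elementary processes converging to H in \<open>L\<^sup>2(dt \<otimes> dP)\<close>. By the Ito isometry the
  limit does not depend on the approximating sequence, so this determines Y up to
  indistinguishability.
\<close>

definition is_ito_integral ::
    "'a measure \<Rightarrow> (real \<Rightarrow> 'a measure) \<Rightarrow> (real \<Rightarrow> 'a \<Rightarrow> real) \<Rightarrow>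
     (real \<Rightarrow> 'a \<Rightarrow> real) \<Rightarrow> (real \<Rightarrow> 'a \<Rightarrow> real) \<Rightarrow> bool" where
  "is_ito_integral M F W H Y \<longleftrightarrow>
     predictable M F H \<and>
     (\<forall>u\<in>{0..1}. Y u \<in> borel_measurable (F u)) \<and>
     (AE \<omega> in M. continuous_on {0..1} (\<lambda>u. Y u \<omega>)) \<and>
     (\<exists>n t \<xi>.
        (\<forall>k. elementary_integrand M F (n k) (t k) (\<xi> k)) \<and>
        L2_tendsto (unit_lborel \<Otimes>\<^sub>M M)
          (\<lambda>k (u, \<omega>). elementary_process (n k) (t k) (\<xi> k) u \<omega>) (\<lambda>(u, \<omega>). H u \<omega>) \<and>
        (\<forall>u\<in>{0..1}. L2_tendsto M (\<lambda>k. elementary_integral W (n k) (t k) (\<xi> k) u) (Y u)))"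

end

theory Submission
  imports Defs
begin

text \<open>
  Neither the Ito integral of general integrands nor the representation theorem is needed: the
  \<open>Y n\<close> can be taken of the form \<open>c * e * (W (min u t) - W (min u s))\<close> with \<open>e\<close> a sign known
  at time \<open>s\<close>, that is, \<open>\<phi> = e\<close> on \<open>{s<..t}\<close>, \<open>\<phi> = 1\<close> elsewhere and \<open>f = c * indicator {s<..t}\<close>.
  Such an integral is Gaussian, since multiplying the later increments of \<open>W\<close> by the
  independent sign \<open>e\<close> does not change their law. A weak greedy algorithm subtracts from \<open>X 1\<close>
  in each step a nearly best orthogonal projection onto a line spanned by such a terminal value;
  each step lowers the squared norm of the residual by that of the subtracted term, and the
  residuals tend to 0 as soon as the terminal values are total in the centred square integrable
  functions. For totality, a closed subspace containing the constants and all
  \<open>indicator A * (W t - W s)\<close> with \<open>A\<close> known at time \<open>s\<close> contains the functions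
  \<open>cos (\<Sum>u\<in>J. c u * W u)\<close>, by expanding the exponential martingale along fine partitions, and from
  these one reaches, through polynomials in \<open>sin (W u / r)\<close>, all indicators of the filtration.
\<close>

text \<open>The obstacle is that the terminal values form a set closed under scaling but not under
  addition, and different ones need not be orthogonal. Small inner products of the residuals with
  all of them therefore give only weak convergence, and the norm identity does not come from an
  orthogonal family: it comes from telescoping the squared norms of the residuals. Weak convergence
  is handled without quotient spaces through sets of the form
  \<open>{T. \<langle>R n, T\<rangle> tends to 0}\<close> for a norm-bounded sequence
  \<open>R\<close>. Such a set is a closed subspace, so a claim about all its possible members
  reduces to a claim about generators. With the residuals for \<open>R\<close> this yields totality.
  With a constant sequence the set is an orthogonal complement, and the same argument shows that a
  later increment is independent of the augmented past, although the definition of Brownian motion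
  speaks only of finitely many increments and the filtration also contains null sets. Signs are rich
  enough to generate because \<open>indicator A\<close> is the average of the constant 1 and the
  sign \<open>2 * indicator A - 1\<close>.\<close>

section \<open>Square integrable functions\<close>

lemma sq_integrableD:
  assumes "sq_integrable M f"
  shows "f \<in> borel_measurable M" and "integrable M (\<lambda>x. (f x)\<^sup>2)"
  using assms by (auto simp: sq_integrable_def)

lemma sq_integrable_mult:
  assumes "sq_integrable M f" and "sq_integrable M g"
  shows "integrable M (\<lambda>x. f x * g x)"
proof (rule Bochner_Integration.integrable_bound)
  show "integrable M (\<lambda>x. (f x)\<^sup>2 + (g x)\<^sup>2)"
    using assms by (auto simp: sq_integrable_def)
  show "(\<lambda>x. f x * g x) \<in> borel_measurable M"
    using assms by (auto simp: sq_integrable_def)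
  have "\<bar>a * b\<bar> \<le> a\<^sup>2 + b\<^sup>2" for a b :: real
  proof -
    have "2 * (\<bar>a\<bar> * \<bar>b\<bar>) \<le> a\<^sup>2 + b\<^sup>2"
      using sum_squares_bound[of "\<bar>a\<bar>" "\<bar>b\<bar>"] by simp
    moreover have "0 \<le> \<bar>a\<bar> * \<bar>b\<bar>" by simp
    ultimately show ?thesis by (simp only: abs_mult)
  qed
  then show "AE x in M. norm (f x * g x) \<le> norm ((f x)\<^sup>2 + (g x)\<^sup>2)"
    by simp
qed

lemma sq_integrable_cmult: "sq_integrable M f \<Longrightarrow> sq_integrable M (\<lambda>x. c * f x)"
  by (auto simp: sq_integrable_def power_mult_distrib)

lemma sq_integrable_add:
  assumes "sq_integrable M f" and "sq_integrable M g"
  shows "sq_integrable M (\<lambda>x. f x + g x)"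
proof -
  have "(f x + g x)\<^sup>2 = (f x)\<^sup>2 + (g x)\<^sup>2 + 2 * (f x * g x)" for x
    by (simp add: power2_sum)
  then show ?thesis
    using assms sq_integrable_mult[OF assms] by (auto simp: sq_integrable_def)
qed

lemma sq_integrable_diff:
  assumes "sq_integrable M f" and "sq_integrable M g"
  shows "sq_integrable M (\<lambda>x. f x - g x)"
  using sq_integrable_add[OF assms(1) sq_integrable_cmult[OF assms(2), of "-1"]] by simp

lemma sq_integrable_zero: "sq_integrable M (\<lambda>x. 0)"
  by (simp add: sq_integrable_def)

lemma sq_integrable_sum:
  "(\<And>i. i \<in> I \<Longrightarrow> sq_integrable M (f i)) \<Longrightarrow> sq_integrable M (\<lambda>x. \<Sum>i\<in>I. f i x)"
  by (induction I rule: infinite_finite_induct) (auto intro: sq_integrable_zero sq_integrable_add)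

lemma sq_integrable_bound:
  assumes "sq_integrable M g" and "f \<in> borel_measurable M" and "AE x in M. \<bar>f x\<bar> \<le> \<bar>g x\<bar>"
  shows "sq_integrable M f"
  unfolding sq_integrable_def
proof
  show "integrable M (\<lambda>x. (f x)\<^sup>2)"
  proof (rule Bochner_Integration.integrable_bound)
    show "AE x in M. norm ((f x)\<^sup>2) \<le> norm ((g x)\<^sup>2)"
      using assms(3) by eventually_elim (simp add: abs_le_square_iff)
  qed (use assms in \<open>auto simp: sq_integrable_def\<close>)
qed (fact assms(2))

lemma sq_integrable_bounded_mult:
  assumes "sq_integrable M g" and "f \<in> borel_measurable M" and "\<And>x. x \<in> space M \<Longrightarrow> \<bar>f x\<bar> \<le> K"
  shows "sq_integrable M (\<lambda>x. f x * g x)"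
proof (rule sq_integrable_bound[OF sq_integrable_cmult[OF assms(1), of K]])
  show "AE x in M. \<bar>f x * g x\<bar> \<le> \<bar>K * g x\<bar>"
    using assms(3) by (intro AE_I2) (force simp: abs_mult intro!: mult_right_mono)
qed (use assms in \<open>auto simp: sq_integrable_def\<close>)

lemma (in finite_measure) sq_integrable_const: "sq_integrable M (\<lambda>x. c)"
  by (simp add: sq_integrable_def)

lemma (in finite_measure) sq_integrable_bounded:
  assumes "f \<in> borel_measurable M" and "\<And>x. x \<in> space M \<Longrightarrow> \<bar>f x\<bar> \<le> K"
  shows "sq_integrable M f"
  using sq_integrable_bounded_mult[OF sq_integrable_const[of 1] assms] by simp

lemma (in finite_measure) sq_integrable_integrable: "sq_integrable M f \<Longrightarrow> integrable M f"
  using sq_integrable_mult[OF _ sq_integrable_const[of 1], of f] by simp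

lemma L2_norm_nonneg: "0 \<le> L2_norm M f"
  by (simp add: L2_norm_def)

lemma L2_norm_square: "(L2_norm M f)\<^sup>2 = (\<integral>x. (f x)\<^sup>2 \<partial>M)"
  by (simp add: L2_norm_def)

lemma L2_norm_cmult: "L2_norm M (\<lambda>x. c * f x) = \<bar>c\<bar> * L2_norm M f"
  by (simp add: L2_norm_def power_mult_distrib real_sqrt_mult)

lemma integral_square_add:
  assumes "sq_integrable M f" and "sq_integrable M g"
  shows "(\<integral>x. (f x + g x)\<^sup>2 \<partial>M) = (\<integral>x. (f x)\<^sup>2 \<partial>M) + 2 * (\<integral>x. f x * g x \<partial>M) + (\<integral>x. (g x)\<^sup>2 \<partial>M)"
proof -
  have "(\<integral>x. (f x + g x)\<^sup>2 \<partial>M) = (\<integral>x. (f x)\<^sup>2 + 2 * (f x * g x) + (g x)\<^sup>2 \<partial>M)"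
    by (simp add: power2_sum algebra_simps)
  also have "\<dots> = (\<integral>x. (f x)\<^sup>2 \<partial>M) + 2 * (\<integral>x. f x * g x \<partial>M) + (\<integral>x. (g x)\<^sup>2 \<partial>M)"
    using sq_integrable_mult[OF assms] assms[THEN sq_integrableD(2)] by simp
  finally show ?thesis .
qed

lemma L2_Cauchy_Schwarz:
  assumes f: "sq_integrable M f" and g: "sq_integrable M g"
  shows "\<bar>\<integral>x. f x * g x \<partial>M\<bar> \<le> L2_norm M f * L2_norm M g"
proof -
  define a b c where "a = (\<integral>x. (f x)\<^sup>2 \<partial>M)" and "b = (\<integral>x. f x * g x \<partial>M)" and "c = (\<integral>x. (g x)\<^sup>2 \<partial>M)"
  have q: "0 \<le> a + 2 * t * b + t\<^sup>2 * c" for t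
  proof -
    have "0 \<le> (\<integral>x. (f x + t * g x)\<^sup>2 \<partial>M)" by simp
    also have "\<dots> = a + 2 * t * b + t\<^sup>2 * c"
      using integral_square_add[OF f sq_integrable_cmult[OF g, of t]]
      by (simp add: a_def b_def c_def power_mult_distrib mult.left_commute)
    finally show ?thesis .
  qed
  have nn: "0 \<le> a" "0 \<le> c" by (simp_all add: a_def c_def)
  have "b\<^sup>2 \<le> a * c"
  proof (cases "c = 0")
    case True
    have "b = 0"
    proof (rule ccontr)
      assume "b \<noteq> 0"
      \<comment> \<open>For \<open>c = 0\<close> the quadratic is affine in \<open>t\<close>, and
        this \<open>t\<close> gives it the value -1.\<close>
      then have "2 * (- (a + 1) / (2 * b)) * b = - (a + 1)" by simp
      then show False using q[of "- (a + 1) / (2 * b)"] True nn by simp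
    qed
    then show ?thesis using True by simp
  next
    case False
    then have "0 < c" using nn by simp
    \<comment> \<open>The minimiser of the quadratic in \<open>t\<close>.\<close>
    then show ?thesis using q[of "- b / c"] by (simp add: field_simps power2_eq_square)
  qed
  then have "sqrt (b\<^sup>2) \<le> sqrt (a * c)" by (rule real_sqrt_le_mono)
  then show ?thesis by (simp add: L2_norm_def a_def b_def c_def real_sqrt_mult)
qed

lemma L2_norm_triangle:
  assumes f: "sq_integrable M f" and g: "sq_integrable M g"
  shows "L2_norm M (\<lambda>x. f x + g x) \<le> L2_norm M f + L2_norm M g"
proof (rule power2_le_imp_le)
  have "(L2_norm M (\<lambda>x. f x + g x))\<^sup>2 = (L2_norm M f)\<^sup>2 + 2 * (\<integral>x. f x * g x \<partial>M) + (L2_norm M g)\<^sup>2"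
    by (simp only: L2_norm_square integral_square_add[OF assms])
  then show "(L2_norm M (\<lambda>x. f x + g x))\<^sup>2 \<le> (L2_norm M f + L2_norm M g)\<^sup>2"
    using L2_Cauchy_Schwarz[OF assms] by (simp add: power2_sum)
qed (simp add: L2_norm_nonneg)

lemma L2_tendstoI_dominated:
  assumes Z: "\<And>n. Z n \<in> borel_measurable M" and Z': "Z' \<in> borel_measurable M"
    and g: "sq_integrable M g"
    and lim: "AE x in M. (\<lambda>n. Z n x) \<longlonglongrightarrow> Z' x"
    and bound: "\<And>n. AE x in M. \<bar>Z n x\<bar> \<le> \<bar>g x\<bar>"
  shows "L2_tendsto M Z Z'"
proof -
  have Zs: "sq_integrable M (Z n)" for n
    by (rule sq_integrable_bound[OF g Z bound])
  have ball: "AE x in M. \<forall>n. \<bar>Z n x\<bar> \<le> \<bar>g x\<bar>"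
    using bound by (simp add: AE_all_countable)
  have bound': "AE x in M. \<bar>Z' x\<bar> \<le> \<bar>g x\<bar>"
    using lim ball
  proof eventually_elim
    case (elim x)
    then show ?case
      by (intro LIMSEQ_le_const2[OF tendsto_rabs[OF elim(1)]]) auto
  qed
  have Zs': "sq_integrable M Z'"
    by (rule sq_integrable_bound[OF g Z' bound'])
  have "(\<lambda>n. \<integral>x. (Z n x - Z' x)\<^sup>2 \<partial>M) \<longlonglongrightarrow> (\<integral>x. 0 \<partial>M)"
  proof (rule integral_dominated_convergence)
    show "integrable M (\<lambda>x. 4 * (g x)\<^sup>2)"
      using g by (simp add: sq_integrable_def)
    show "AE x in M. (\<lambda>n. (Z n x - Z' x)\<^sup>2) \<longlonglongrightarrow> 0"
      using lim
    proof eventually_elim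
      case (elim x)
      then have "(\<lambda>n. (Z n x - Z' x)\<^sup>2) \<longlonglongrightarrow> (Z' x - Z' x)\<^sup>2"
        by (intro tendsto_intros)
      then show ?case by simp
    qed
    fix n show "AE x in M. norm ((Z n x - Z' x)\<^sup>2) \<le> 4 * (g x)\<^sup>2"
      using ball bound'
    proof eventually_elim
      case (elim x)
      then have "\<bar>Z n x - Z' x\<bar> \<le> \<bar>2 * g x\<bar>"
        using elim(1)[rule_format, of n] by linarith
      then have "(Z n x - Z' x)\<^sup>2 \<le> (2 * g x)\<^sup>2"
        by (simp only: abs_le_square_iff)
      then show ?case by (simp add: power_mult_distrib)
    qed
  qed (use Z Z' in auto)
  then have "(\<lambda>n. L2_norm M (\<lambda>x. Z n x - Z' x)) \<longlonglongrightarrow> sqrt 0"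
    unfolding L2_norm_def by (intro tendsto_real_sqrt) simp
  then show ?thesis
    using Zs Zs' by (simp add: L2_tendsto_def)
qed

lemma L2_tendsto_const_AE:
  assumes "sq_integrable M Z" "Z' \<in> borel_measurable M" "AE x in M. Z x = Z' x"
  shows "L2_tendsto M (\<lambda>_. Z) Z'"
  using assms by (intro L2_tendstoI_dominated[where g=Z]) (auto simp: sq_integrable_def)

section \<open>Closed subspaces of L2\<close>

text \<open>Members are functions, not classes modulo null sets. Closure under
  \<open>L2_tendsto\<close>, applied to constant sequences, yields invariance under almost
  everywhere equality (\<open>cong_AE\<close>), so no quotient is formed.\<close>

definition closed_L2_subspace :: "'a measure \<Rightarrow> ('a \<Rightarrow> real) set \<Rightarrow> bool" where
  "closed_L2_subspace M S \<longleftrightarrow>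
     (\<forall>f\<in>S. sq_integrable M f) \<and> (\<lambda>x. 0) \<in> S \<and>
     (\<forall>f\<in>S. \<forall>g\<in>S. \<forall>a b. (\<lambda>x. a * f x + b * g x) \<in> S) \<and>
     (\<forall>Z Z'. (\<forall>n. Z n \<in> S) \<and> L2_tendsto M Z Z' \<longrightarrow> Z' \<in> S)"

locale L2_subspace =
  fixes M :: "'a measure" and S :: "('a \<Rightarrow> real) set"
  assumes closed_subspace: "closed_L2_subspace M S"
begin

lemma sq_int: "f \<in> S \<Longrightarrow> sq_integrable M f"
  and zero: "(\<lambda>x. 0) \<in> S"
  and lincomb: "f \<in> S \<Longrightarrow> g \<in> S \<Longrightarrow> (\<lambda>x. a * f x + b * g x) \<in> S"
  and limit: "(\<And>n. Z n \<in> S) \<Longrightarrow> L2_tendsto M Z Z' \<Longrightarrow> Z' \<in> S"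
  using closed_subspace unfolding closed_L2_subspace_def by blast+

lemma add: "f \<in> S \<Longrightarrow> g \<in> S \<Longrightarrow> (\<lambda>x. f x + g x) \<in> S"
  using lincomb[of f g 1 1] by simp

lemma diff: "f \<in> S \<Longrightarrow> g \<in> S \<Longrightarrow> (\<lambda>x. f x - g x) \<in> S"
  using lincomb[of f g 1 "-1"] by simp

lemma cmult: "f \<in> S \<Longrightarrow> (\<lambda>x. c * f x) \<in> S"
  using lincomb[of f f c 0] by simp

lemma sum: "(\<And>i. i \<in> I \<Longrightarrow> f i \<in> S) \<Longrightarrow> (\<lambda>x. \<Sum>i\<in>I. f i x) \<in> S"
  by (induction I rule: infinite_finite_induct) (auto intro: zero add)

lemma cong_AE:
  "f \<in> S \<Longrightarrow> g \<in> borel_measurable M \<Longrightarrow> (AE x in M. f x = g x) \<Longrightarrow> g \<in> S"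
  by (rule limit[of "\<lambda>_. f"]) (auto intro: L2_tendsto_const_AE sq_int)

lemma dominated_limit:
  assumes "\<And>n. Z n \<in> S" "Z' \<in> borel_measurable M" "sq_integrable M g"
    "AE x in M. (\<lambda>n. Z n x) \<longlonglongrightarrow> Z' x" "\<And>n. AE x in M. \<bar>Z n x\<bar> \<le> \<bar>g x\<bar>"
  shows "Z' \<in> S"
  using assms sq_int
  by (intro limit[OF assms(1) L2_tendstoI_dominated[of Z M Z' g]]) (auto simp: sq_integrable_def)

text \<open>The simple approximations \<open>F i\<close> satisfy
  \<open>\<bar>F i x\<bar> \<le> 2 * \<bar>Z x\<bar>\<close>, so \<open>2 * (Z x * h x)\<close>
  dominates even if neither factor is bounded. The factor \<open>h\<close> is general because both
  \<open>h = 1\<close> and \<open>h\<close> an increment of \<open>W\<close> occur later.\<close>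

lemma indicators_imp_measurable:
  assumes G: "subalgebra M G" and h: "h \<in> borel_measurable M"
    and ind: "\<And>A. A \<in> sets G \<Longrightarrow> (\<lambda>x. indicator A x * h x) \<in> S"
    and Z: "Z \<in> borel_measurable G" and Zh: "sq_integrable M (\<lambda>x. Z x * h x)"
  shows "(\<lambda>x. Z x * h x) \<in> S"
proof -
  have sp: "space G = space M" using G by (simp add: subalgebra_def)
  obtain F where F: "\<And>i. simple_function G (F i)" "\<And>x. x \<in> space G \<Longrightarrow> (\<lambda>i. F i x) \<longlonglongrightarrow> Z x"
    "\<And>i x. x \<in> space G \<Longrightarrow> dist (F i x) 0 \<le> 2 * dist (Z x) 0"
    using borel_measurable_implies_sequence_metric[OF Z, of 0] by blast
  have Fmeas: "F i \<in> borel_measurable M" for i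
    using measurable_from_subalg[OF G borel_measurable_simple_function[OF F(1)]] .
  have FS: "(\<lambda>x. F i x * h x) \<in> S" for i
  proof (rule cong_AE)
    show "(\<lambda>x. \<Sum>y\<in>F i ` space G. y * (indicator (F i -` {y} \<inter> space G) x * h x)) \<in> S"
      by (intro sum cmult ind simple_functionD[OF F(1)])
    show "AE x in M. (\<Sum>y\<in>F i ` space G. y * (indicator (F i -` {y} \<inter> space G) x * h x)) = F i x * h x"
    proof (rule AE_I2)
      fix x assume "x \<in> space M"
      then have x: "x \<in> space G" by (simp add: sp)
      have "(\<Sum>y\<in>F i ` space G. y * (indicator (F i -` {y} \<inter> space G) x * h x)) =
        (\<Sum>y\<in>F i ` space G. if F i x = y then y * h x else 0)"
        using x by (intro sum.cong) (auto simp: indicator_def)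
      also have "\<dots> = F i x * h x"
        using x simple_functionD(1)[OF F(1)] by simp
      finally show "(\<Sum>y\<in>F i ` space G. y * (indicator (F i -` {y} \<inter> space G) x * h x)) = F i x * h x" .
    qed
  qed (use Fmeas h in auto)
  show ?thesis
  proof (rule dominated_limit[OF FS])
    show "sq_integrable M (\<lambda>x. 2 * (Z x * h x))"
      by (rule sq_integrable_cmult[OF Zh])
    show "AE x in M. (\<lambda>i. F i x * h x) \<longlonglongrightarrow> Z x * h x"
      using F(2) by (auto simp: sp intro!: tendsto_intros)
    show "AE x in M. \<bar>F i x * h x\<bar> \<le> \<bar>2 * (Z x * h x)\<bar>" for i
      using F(3)[of _ i] by (intro AE_I2) (auto simp: sp abs_mult dist_real_def mult.assoc[symmetric] intro!: mult_right_mono)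
  qed (use sq_integrableD(1)[OF Zh] in simp)
qed

end

text \<open>Replacing the limit \<open>Z'\<close> by \<open>Z m\<close> changes the inner product
  with \<open>R n\<close> by at most \<open>K\<close> times the distance of \<open>Z m\<close> from
  \<open>Z'\<close>, whatever \<open>n\<close> is. So \<open>m\<close> can be fixed first and
  \<open>n\<close> sent to infinity afterwards.\<close>

lemma closed_L2_subspace_weakly_null:
  assumes R: "\<And>n. sq_integrable M (R n)" and K: "\<And>n. L2_norm M (R n) \<le> K"
  shows "closed_L2_subspace M {T. sq_integrable M T \<and> (\<lambda>n. \<integral>x. R n x * T x \<partial>M) \<longlonglongrightarrow> 0}"
  unfolding closed_L2_subspace_def
proof (intro conjI ballI allI impI; (elim conjE)?)
  show "sq_integrable M f" if "f \<in> {T. sq_integrable M T \<and> (\<lambda>n. \<integral>x. R n x * T x \<partial>M) \<longlonglongrightarrow> 0}" for f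
    using that by simp
  show "(\<lambda>x. 0) \<in> {T. sq_integrable M T \<and> (\<lambda>n. \<integral>x. R n x * T x \<partial>M) \<longlonglongrightarrow> 0}"
    by (simp add: sq_integrable_zero)
next
  fix f g a b
  assume "f \<in> {T. sq_integrable M T \<and> (\<lambda>n. \<integral>x. R n x * T x \<partial>M) \<longlonglongrightarrow> 0}"
    and "g \<in> {T. sq_integrable M T \<and> (\<lambda>n. \<integral>x. R n x * T x \<partial>M) \<longlonglongrightarrow> 0}"
  then have f: "sq_integrable M f" "(\<lambda>n. \<integral>x. R n x * f x \<partial>M) \<longlonglongrightarrow> 0"
    and g: "sq_integrable M g" "(\<lambda>n. \<integral>x. R n x * g x \<partial>M) \<longlonglongrightarrow> 0" by auto
  have "(\<integral>x. R n x * (a * f x + b * g x) \<partial>M) = a * (\<integral>x. R n x * f x \<partial>M) + b * (\<integral>x. R n x * g x \<partial>M)" for n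
  proof -
    have "(\<integral>x. R n x * (a * f x + b * g x) \<partial>M) = (\<integral>x. a * (R n x * f x) + b * (R n x * g x) \<partial>M)"
      by (simp add: algebra_simps)
    also have "\<dots> = a * (\<integral>x. R n x * f x \<partial>M) + b * (\<integral>x. R n x * g x \<partial>M)"
      using sq_integrable_mult[OF R f(1)] sq_integrable_mult[OF R g(1)] by simp
    finally show ?thesis .
  qed
  moreover have "(\<lambda>n. a * (\<integral>x. R n x * f x \<partial>M) + b * (\<integral>x. R n x * g x \<partial>M)) \<longlonglongrightarrow> a * 0 + b * 0"
    by (intro tendsto_intros f g)
  ultimately show "(\<lambda>x. a * f x + b * g x) \<in> {T. sq_integrable M T \<and> (\<lambda>n. \<integral>x. R n x * T x \<partial>M) \<longlonglongrightarrow> 0}"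
    by (auto intro!: sq_integrable_add sq_integrable_cmult f g)
next
  fix Z :: "nat \<Rightarrow> 'a \<Rightarrow> real" and Z'
  assume Z: "\<forall>m. Z m \<in> {T. sq_integrable M T \<and> (\<lambda>n. \<integral>x. R n x * T x \<partial>M) \<longlonglongrightarrow> 0}"
    and lim: "L2_tendsto M Z Z'"
  have sq: "sq_integrable M (Z m)" "sq_integrable M Z'" for m
    using lim by (auto simp: L2_tendsto_def)
  have K0: "0 \<le> K" using K[of 0] L2_norm_nonneg[of M "R 0"] by simp
  have diff: "\<bar>\<integral>x. R n x * Z' x \<partial>M\<bar> \<le> \<bar>\<integral>x. R n x * Z m x \<partial>M\<bar> + K * L2_norm M (\<lambda>x. Z m x - Z' x)" for n m
  proof -
    have "(\<integral>x. R n x * (Z m x - Z' x) \<partial>M) = (\<integral>x. R n x * Z m x - R n x * Z' x \<partial>M)"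
      by (simp add: algebra_simps)
    also have "\<dots> = (\<integral>x. R n x * Z m x \<partial>M) - (\<integral>x. R n x * Z' x \<partial>M)"
      by (intro Bochner_Integration.integral_diff sq_integrable_mult R sq)
    finally have "(\<integral>x. R n x * Z m x \<partial>M) - (\<integral>x. R n x * Z' x \<partial>M) = (\<integral>x. R n x * (Z m x - Z' x) \<partial>M)"
      by simp
    moreover have "\<bar>\<integral>x. R n x * (Z m x - Z' x) \<partial>M\<bar> \<le> K * L2_norm M (\<lambda>x. Z m x - Z' x)"
      by (rule order_trans[OF L2_Cauchy_Schwarz[OF R sq_integrable_diff[OF sq]]])
         (intro mult_right_mono K L2_norm_nonneg)
    ultimately show ?thesis by linarith
  qed
  have "(\<lambda>n. \<integral>x. R n x * Z' x \<partial>M) \<longlonglongrightarrow> 0"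
  proof (rule LIMSEQ_I)
    fix e :: real assume e: "0 < e"
    have "(\<lambda>m. K * L2_norm M (\<lambda>x. Z m x - Z' x)) \<longlonglongrightarrow> K * 0"
      using lim by (intro tendsto_intros) (simp add: L2_tendsto_def)
    then obtain m where m: "K * L2_norm M (\<lambda>x. Z m x - Z' x) < e / 2"
      using order_tendstoD(2)[of _ "K * 0" sequentially "e/2"] e
      by (auto simp: eventually_sequentially)
    have "(\<lambda>n. \<integral>x. R n x * Z m x \<partial>M) \<longlonglongrightarrow> 0" using Z by simp
    from LIMSEQ_D[OF this, of "e/2"] e obtain N where N: "\<And>n. n \<ge> N \<Longrightarrow> \<bar>\<integral>x. R n x * Z m x \<partial>M\<bar> < e/2"
      by auto
    show "\<exists>N. \<forall>n\<ge>N. norm ((\<integral>x. R n x * Z' x \<partial>M) - 0) < e"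
    proof (intro exI[of _ N] allI impI)
      fix n assume "n \<ge> N"
      with N[of n] m diff[of n m] show "norm ((\<integral>x. R n x * Z' x \<partial>M) - 0) < e" by simp
    qed
  qed
  then show "Z' \<in> {T. sq_integrable M T \<and> (\<lambda>n. \<integral>x. R n x * T x \<partial>M) \<longlonglongrightarrow> 0}"
    using sq by simp
qed

section \<open>The weak greedy algorithm\<close>

text \<open>If \<open>x n * s n \<ge> e\<close> from some index on, with \<open>s\<close> the
  partial sums, then the square of \<open>s\<close> grows by at least \<open>2 * e\<close> per step.
  Cauchy-Schwarz on late blocks, where the sum of the squares of \<open>x\<close> stays below
  \<open>e / 4\<close>, bounds its growth by a constant plus \<open>e\<close> per step. The two
  rates are incompatible.\<close>

lemma square_summable_liminf:
  fixes x :: "nat \<Rightarrow> real"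
  assumes nn: "\<And>n. 0 \<le> x n" and sm: "summable (\<lambda>n. (x n)\<^sup>2)" and e: "0 < e"
  shows "\<exists>n\<ge>N. x n * (\<Sum>j<n. x j) < e"
proof (rule ccontr)
  assume "\<not> ?thesis"
  then have big: "e \<le> x n * (\<Sum>j<n. x j)" if "n \<ge> N" for n using that by (auto simp: not_less)
  define s where "s n = (\<Sum>j<n. x j)" for n
  have s0: "0 \<le> s n" for n by (simp add: s_def nn sum_nonneg)
  have growth: "2 * e * real k \<le> (s (N + k))\<^sup>2" for k
  proof (induction k)
    case (Suc k)
    have "(s (N + Suc k))\<^sup>2 = (s (N + k))\<^sup>2 + 2 * (x (N + k) * s (N + k)) + (x (N + k))\<^sup>2"
      by (simp add: s_def power2_sum algebra_simps)
    moreover have "e \<le> x (N + k) * s (N + k)" using big[of "N + k"] by (simp add: s_def)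
    moreover have "0 \<le> (x (N + k))\<^sup>2" by simp
    moreover have "2 * e * real (Suc k) = 2 * e * real k + 2 * e" by (simp add: algebra_simps)
    ultimately show ?case using Suc by linarith
  qed simp
  obtain m0 where m0: "\<And>m n. m \<ge> m0 \<Longrightarrow> norm (\<Sum>i=m..<n. (x i)\<^sup>2) < e / 4"
    using sm e unfolding summable_Cauchy by (metis zero_less_divide_iff zero_less_numeral)
  define m where "m = max N m0"
  have upper: "(s (m + k))\<^sup>2 \<le> 2 * (s m)\<^sup>2 + real k * e" for k
  proof -
    define u where "u = (\<Sum>i=m..<m + k. x i)"
    have "s (m + k) = s m + u"
      unfolding s_def u_def by (metis atLeast0LessThan le0 le_add1 sum.atLeastLessThan_concat)
    moreover have "u\<^sup>2 \<le> real k * (\<Sum>i=m..<m + k. (x i)\<^sup>2)"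
    proof -
      have "(\<Sum>i=m..<m + k. 1 * x i)\<^sup>2 \<le> (\<Sum>i=m..<m + k. 1\<^sup>2) * (\<Sum>i=m..<m + k. (x i)\<^sup>2)"
        by (rule Cauchy_Schwarz_ineq_sum)
      then show ?thesis by (simp add: u_def)
    qed
    moreover have "real k * (\<Sum>i=m..<m + k. (x i)\<^sup>2) \<le> real k * (e / 4)"
      using m0[of m "m + k"] by (intro mult_left_mono) (auto simp: m_def)
    moreover have "(s m + u)\<^sup>2 \<le> 2 * (s m)\<^sup>2 + 2 * u\<^sup>2"
      using sum_squares_bound[of "s m" u] by (simp add: power2_sum)
    moreover have "0 \<le> real k * e" using e by simp
    ultimately show ?thesis by (simp; linarith)
  qed
  have lower: "2 * e * real k \<le> (s (m + k))\<^sup>2" for k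
  proof -
    have "2 * e * real k \<le> 2 * e * real (m - N + k)"
      using e by (intro mult_left_mono) auto
    also have "\<dots> \<le> (s (m + k))\<^sup>2"
      using growth[of "m - N + k"] by (simp add: m_def)
    finally show ?thesis .
  qed
  \<comment> \<open>For this \<open>k\<close> the gap \<open>k * e\<close> between the two rates
    exceeds the constant \<open>2 * (s m)\<^sup>2\<close>.\<close>
  obtain k where k: "2 * (s m)\<^sup>2 / e < real k" using reals_Archimedean2 by blast
  have "2 * (s m)\<^sup>2 < real k * e" using k e by (simp add: field_simps)
  with upper[of k] lower[of k] show False by (simp add: algebra_simps)
qed

text \<open>The supremum \<open>Q\<close> of the normalised inner products need not be attained,
  hence the factor 2: some \<open>d\<close> exceeds half of a positive \<open>Q\<close>, and
  \<open>Y\<close> is the orthogonal projection of \<open>R\<close> onto the line through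
  \<open>d\<close>, whose norm is \<open>q d\<close>.\<close>

lemma weak_greedy_step:
  assumes R: "sq_integrable M R" and D: "\<And>d. d \<in> D \<Longrightarrow> sq_integrable M d"
    and scale: "\<And>c d. d \<in> D \<Longrightarrow> (\<lambda>x. c * d x) \<in> D" and ne: "D \<noteq> {}"
  shows "\<exists>Y\<in>D. (\<integral>x. R x * Y x \<partial>M) = (\<integral>x. (Y x)\<^sup>2 \<partial>M) \<and>
    (\<forall>d\<in>D. \<bar>\<integral>x. R x * d x \<partial>M\<bar> \<le> 2 * L2_norm M Y * L2_norm M d)"
proof -
  \<comment> \<open>Division by zero gives \<open>q d = 0\<close> for \<open>d\<close> of norm zero.
    Cauchy-Schwarz makes the inner product vanish there too, so \<open>qeq\<close> below holds
    without exception.\<close>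
  define q where "q d = \<bar>\<integral>x. R x * d x \<partial>M\<bar> / L2_norm M d" for d
  have CS: "\<bar>\<integral>x. R x * d x \<partial>M\<bar> \<le> L2_norm M R * L2_norm M d" if "d \<in> D" for d
    by (rule L2_Cauchy_Schwarz[OF R D[OF that]])
  have qR: "q d \<le> L2_norm M R" if "d \<in> D" for d
    using CS[OF that] L2_norm_nonneg[of M R] L2_norm_nonneg[of M d]
    by (cases "L2_norm M d = 0") (auto simp: q_def divide_simps)
  have q0: "0 \<le> q d" for d by (simp add: q_def L2_norm_nonneg)
  have bdd: "bdd_above (q ` D)" using qR by (auto intro!: bdd_aboveI2)
  define Q where "Q = (SUP d\<in>D. q d)"
  have qQ: "q d \<le> Q" if "d \<in> D" for d unfolding Q_def by (rule cSUP_upper[OF that bdd])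
  have qeq: "\<bar>\<integral>x. R x * d x \<partial>M\<bar> = q d * L2_norm M d" if "d \<in> D" for d
    using CS[OF that] by (cases "L2_norm M d = 0") (auto simp: q_def)
  show ?thesis
  proof (cases "Q \<le> 0")
    case True
    obtain d0 where "d0 \<in> D" using ne by blast
    from scale[OF this, of 0] have "(\<lambda>x. 0) \<in> D" by simp
    moreover have "(\<integral>x. R x * d x \<partial>M) = 0" if "d \<in> D" for d
    proof -
      have "q d = 0" using qQ[OF that] True q0[of d] by linarith
      then show ?thesis using qeq[OF that] by simp
    qed
    ultimately show ?thesis
      by (intro bexI[of _ "\<lambda>x. 0"]) (auto simp: L2_norm_def)
  next
    case False
    then have "Q / 2 < Q" by simp
    then obtain d where d: "d \<in> D" "Q / 2 < q d"
      unfolding Q_def using less_cSUP_iff[OF ne bdd] by blast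
    define I where "I = (\<integral>x. R x * d x \<partial>M)"
    define c where "c = I / (L2_norm M d)\<^sup>2"
    have "q d > 0" using d False by linarith
    then have nd: "L2_norm M d \<noteq> 0" by (auto simp: q_def)
    have "(\<integral>x. R x * (c * d x) \<partial>M) = c * I"
      by (simp add: I_def mult.left_commute)
    moreover have "(\<integral>x. (c * d x)\<^sup>2 \<partial>M) = c\<^sup>2 * (L2_norm M d)\<^sup>2"
      by (simp add: power_mult_distrib L2_norm_square)
    moreover have "c * I = c\<^sup>2 * (L2_norm M d)\<^sup>2"
      using nd by (simp add: c_def power2_eq_square)
    moreover have "L2_norm M (\<lambda>x. c * d x) = q d"
      using nd L2_norm_nonneg[of M d] unfolding L2_norm_cmult
      by (simp add: c_def q_def I_def power2_eq_square)
    moreover have "\<bar>\<integral>x. R x * d' x \<partial>M\<bar> \<le> 2 * q d * L2_norm M d'" if "d' \<in> D" for d'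
      unfolding qeq[OF that] using qQ[OF that] d(2) by (intro mult_right_mono L2_norm_nonneg) simp
    ultimately show ?thesis
      using scale[OF d(1), of c] by (intro bexI[of _ "\<lambda>x. c * d x"]) auto
  qed
qed

text \<open>
  The last assumption says that \<open>X\<close> lies in the closed span of \<open>D\<close>. With \<open>x n = L2_norm M (Y n)\<close>
  and residuals \<open>R n\<close>, the square of \<open>L2_norm M (R n)\<close> equals
  \<open>\<langle>R n, X\<rangle> - (\<Sum>j<n. \<langle>R n, Y j\<rangle>)\<close>, and the last sum is at most
  \<open>2 * x n * (\<Sum>j<n. x j)\<close>, which is small infinitely often because \<open>\<Sum> (x n)\<^sup>2\<close> converges.
\<close>

theorem weak_greedy_expansion:
  assumes X: "sq_integrable M X" and D: "\<And>d. d \<in> D \<Longrightarrow> sq_integrable M d"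
    and scale: "\<And>c d. d \<in> D \<Longrightarrow> (\<lambda>x. c * d x) \<in> D" and ne: "D \<noteq> {}"
    and total: "\<And>R K. (\<And>n. sq_integrable M (R n)) \<Longrightarrow> (\<And>n. L2_norm M (R n) \<le> K) \<Longrightarrow>
      (\<And>d. d \<in> D \<Longrightarrow> (\<lambda>n. \<integral>x. R n x * d x \<partial>M) \<longlonglongrightarrow> 0) \<Longrightarrow> (\<lambda>n. \<integral>x. R n x * X x \<partial>M) \<longlonglongrightarrow> 0"
  shows "\<exists>Y. (\<forall>n::nat. Y n \<in> D) \<and>
    (\<lambda>N. L2_norm M (\<lambda>x. (\<Sum>n<N. Y n x) - X x)) \<longlonglongrightarrow> 0 \<and>
    (\<lambda>n. (L2_norm M (Y n))\<^sup>2) sums (L2_norm M X)\<^sup>2"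
proof -
  define P where "P R Y \<longleftrightarrow> Y \<in> D \<and> (\<integral>x. R x * Y x \<partial>M) = (\<integral>x. (Y x)\<^sup>2 \<partial>M) \<and>
    (\<forall>d\<in>D. \<bar>\<integral>x. R x * d x \<partial>M\<bar> \<le> 2 * L2_norm M Y * L2_norm M d)" for R Y
  \<comment> \<open>A total choice function, so that the residuals can be defined by
    \<open>rec_nat\<close>. Its property is available at square integrable arguments only, which the
    residuals are by induction.\<close>
  define pick where "pick R = (SOME Y. P R Y)" for R
  have pick: "P R (pick R)" if "sq_integrable M R" for R
  proof -
    have "\<exists>Y. P R Y"
      using weak_greedy_step[where M=M and R=R and D=D] that D scale ne unfolding P_def by blast
    then show ?thesis unfolding pick_def by (rule someI_ex)
  qed
  define R where "R = rec_nat X (\<lambda>n r x. r x - pick r x)"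
  define Y where "Y n = pick (R n)" for n
  have R_0: "R 0 = X" by (simp add: R_def)
  have R_Suc: "R (Suc n) = (\<lambda>x. R n x - Y n x)" for n
    by (simp add: R_def Y_def)
  have R: "sq_integrable M (R n)" for n
  proof (induction n)
    case (Suc n)
    have "sq_integrable M (pick (R n))"
      using pick[OF Suc] by (intro D) (simp add: P_def)
    with Suc show ?case unfolding R_Suc Y_def by (rule sq_integrable_diff)
  qed (simp add: R_0 X)
  have YD: "Y n \<in> D" and RY: "(\<integral>x. R n x * Y n x \<partial>M) = (L2_norm M (Y n))\<^sup>2"
    and Rd: "d \<in> D \<Longrightarrow> \<bar>\<integral>x. R n x * d x \<partial>M\<bar> \<le> 2 * L2_norm M (Y n) * L2_norm M d" for n d
    using pick[OF R[of n]] by (auto simp: P_def Y_def L2_norm_square)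
  have Y: "sq_integrable M (Y n)" for n using D[OF YD] .
  have R_eq: "R n x = X x - (\<Sum>j<n. Y j x)" for n x
    by (induction n) (simp_all add: R_0 R_Suc)
  \<comment> \<open>Pythagoras for a single step: \<open>RY\<close> says that \<open>Y n\<close> is
    orthogonal to the next residual.\<close>
  have step: "(L2_norm M (R (Suc n)))\<^sup>2 = (L2_norm M (R n))\<^sup>2 - (L2_norm M (Y n))\<^sup>2" for n
    using integral_square_add[OF R sq_integrable_cmult[OF Y, of "-1"], of n n] RY[of n]
    by (simp add: L2_norm_square R_Suc)
  have energy: "(\<Sum>j<n. (L2_norm M (Y j))\<^sup>2) = (L2_norm M X)\<^sup>2 - (L2_norm M (R n))\<^sup>2" for n
    by (induction n) (simp_all add: step R_0)
  have dec: "decseq (\<lambda>n. L2_norm M (R n))"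
    unfolding decseq_Suc_iff by (intro allI power2_le_imp_le[OF _ L2_norm_nonneg]) (simp add: step)
  have RX: "L2_norm M (R n) \<le> L2_norm M X" for n
    using dec[unfolded decseq_def, rule_format, of 0 n] by (simp add: R_0)
  have sm: "summable (\<lambda>n. (L2_norm M (Y n))\<^sup>2)"
    by (rule summableI_nonneg_bounded[of _ "(L2_norm M X)\<^sup>2"]) (simp_all add: energy)
  have Y0: "(\<lambda>n. L2_norm M (Y n)) \<longlonglongrightarrow> 0"
  proof -
    have "(\<lambda>n. sqrt ((L2_norm M (Y n))\<^sup>2)) \<longlonglongrightarrow> sqrt 0"
      by (intro tendsto_real_sqrt summable_LIMSEQ_zero[OF sm])
    then show ?thesis by (simp add: L2_norm_nonneg)
  qed
  \<comment> \<open>Near-optimality of \<open>Y n\<close> bounds the inner products with all of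
    \<open>D\<close> by the norm of \<open>Y n\<close>, which tends to 0.\<close>
  have Rd0: "(\<lambda>n. \<integral>x. R n x * d x \<partial>M) \<longlonglongrightarrow> 0" if "d \<in> D" for d
  proof (rule tendsto_rabs_zero_cancel, rule tendsto_sandwich[OF _ _ tendsto_const])
    show "(\<lambda>n. 2 * L2_norm M (Y n) * L2_norm M d) \<longlonglongrightarrow> 0"
      using tendsto_mult[OF tendsto_mult[OF tendsto_const Y0] tendsto_const, of 2 "L2_norm M d"] by simp
  qed (use Rd[OF that] in auto)
  have RX0: "(\<lambda>n. \<integral>x. R n x * X x \<partial>M) \<longlonglongrightarrow> 0"
    by (rule total[OF R RX Rd0])
  have R2: "(L2_norm M (R n))\<^sup>2 \<le>
    \<bar>\<integral>x. R n x * X x \<partial>M\<bar> + 2 * (L2_norm M (Y n) * (\<Sum>j<n. L2_norm M (Y j)))" for n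
  proof -
    have "(L2_norm M (R n))\<^sup>2 = (\<integral>x. R n x * X x - (\<Sum>j<n. R n x * Y j x) \<partial>M)"
    proof -
      have "(R n x)\<^sup>2 = R n x * X x - (\<Sum>j<n. R n x * Y j x)" for x
        using R_eq[of n x] by (simp add: power2_eq_square right_diff_distrib flip: sum_distrib_left)
      then show ?thesis by (simp add: L2_norm_square)
    qed
    also have "\<dots> = (\<integral>x. R n x * X x \<partial>M) - (\<Sum>j<n. \<integral>x. R n x * Y j x \<partial>M)"
      using sq_integrable_mult[OF R X] sq_integrable_mult[OF R Y] by simp
    also have "\<dots> \<le> \<bar>\<integral>x. R n x * X x \<partial>M\<bar> + (\<Sum>j<n. \<bar>\<integral>x. R n x * Y j x \<partial>M\<bar>)"
      using sum_abs[of "\<lambda>j. \<integral>x. R n x * Y j x \<partial>M" "{..<n}"] by linarith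
    also have "(\<Sum>j<n. \<bar>\<integral>x. R n x * Y j x \<partial>M\<bar>) \<le> (\<Sum>j<n. 2 * L2_norm M (Y n) * L2_norm M (Y j))"
      by (intro sum_mono Rd YD)
    finally show ?thesis by (simp add: sum_distrib_left mult.assoc)
  qed
  have R0: "(\<lambda>n. L2_norm M (R n)) \<longlonglongrightarrow> 0"
  proof (rule LIMSEQ_I)
    fix e :: real assume e: "0 < e"
    from LIMSEQ_D[OF RX0, of "e\<^sup>2 / 2"] e obtain N
      where N: "\<And>n. n \<ge> N \<Longrightarrow> \<bar>\<integral>x. R n x * X x \<partial>M\<bar> < e\<^sup>2 / 2" by auto
    \<comment> \<open>A single index with a small residual suffices, since the residual norms
      decrease.\<close>
    obtain n where n: "n \<ge> N" "L2_norm M (Y n) * (\<Sum>j<n. L2_norm M (Y j)) < e\<^sup>2 / 4"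
      using square_summable_liminf[OF L2_norm_nonneg sm, of "e\<^sup>2 / 4" N] e by auto
    have "(L2_norm M (R n))\<^sup>2 < e\<^sup>2"
      using R2[of n] N[OF n(1)] n(2) by linarith
    then have "L2_norm M (R n) < e" using e by (simp add: power2_less_imp_less)
    then show "\<exists>N. \<forall>n\<ge>N. norm (L2_norm M (R n) - 0) < e"
      using dec by (intro exI[of _ n]) (auto simp: decseq_def L2_norm_nonneg intro: le_less_trans)
  qed
  show ?thesis
  proof (intro exI[of _ Y] conjI allI YD)
    have "L2_norm M (\<lambda>x. (\<Sum>n<N. Y n x) - X x) = L2_norm M (R N)" for N
      by (simp add: L2_norm_def R_eq power2_commute)
    then show "(\<lambda>N. L2_norm M (\<lambda>x. (\<Sum>n<N. Y n x) - X x)) \<longlonglongrightarrow> 0"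
      using R0 by simp
    have "(\<lambda>n. (L2_norm M X)\<^sup>2 - (L2_norm M (R n))\<^sup>2) \<longlonglongrightarrow> (L2_norm M X)\<^sup>2 - 0\<^sup>2"
      by (intro tendsto_intros R0)
    then show "(\<lambda>n. (L2_norm M (Y n))\<^sup>2) sums (L2_norm M X)\<^sup>2"
      unfolding sums_def energy by simp
  qed
qed

section \<open>Trigonometric functions of a family of random variables\<close>

text \<open>Weierstrass approximation of \<open>g (r * arcsin y)\<close> on \<open>{-1..1}\<close>,
  followed by the substitution \<open>y = sin (x / r)\<close>. Within the window
  \<open>\<bar>x\<bar> \<le> r * (pi / 2)\<close> the arcsine undoes the sine. Outside it the values
  still lie close to values of \<open>g\<close>, which preserves the global bound.\<close>

lemma trigonometric_approx:
  fixes g :: "real \<Rightarrow> real"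
  assumes g: "continuous_on UNIV g" and r: "0 < r" and e: "0 < e"
  obtains p :: "real \<Rightarrow> real" where "real_polynomial_function p"
    and "\<And>x. \<bar>x\<bar> \<le> r * (pi / 2) \<Longrightarrow> \<bar>p (sin (x / r)) - g x\<bar> < e"
    and "\<And>x. (\<And>y. \<bar>g y\<bar> \<le> K) \<Longrightarrow> \<bar>p (sin (x / r))\<bar> \<le> K + e"
proof -
  have "continuous_on {-1..1} (\<lambda>y. g (r * arcsin y))"
    by (rule continuous_on_compose2[OF g]) (auto intro!: continuous_intros)
  then obtain p where p: "real_polynomial_function p"
    "\<And>y. y \<in> {-1..1} \<Longrightarrow> \<bar>g (r * arcsin y) - p y\<bar> < e"
    using Stone_Weierstrass_real_polynomial_function[OF compact_Icc _ e] by metis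
  show thesis
  proof (rule that[OF p(1)])
    fix x
    show "\<bar>p (sin (x / r)) - g x\<bar> < e" if "\<bar>x\<bar> \<le> r * (pi / 2)"
    proof -
      have "\<bar>x / r\<bar> \<le> pi / 2" using that r by (simp add: abs_divide field_simps)
      then have "arcsin (sin (x / r)) = x / r" by (intro arcsin_sin) linarith+
      then show ?thesis using p(2)[of "sin (x / r)"] r by (simp add: abs_minus_commute)
    qed
    show "\<bar>p (sin (x / r))\<bar> \<le> K + e" if "\<And>y. \<bar>g y\<bar> \<le> K"
      using p(2)[of "sin (x / r)"] that[of "r * arcsin (sin (x / r))"] by simp
  qed
qed

locale trigonometric_subspace = L2_subspace M S + finite_measure M
  for M :: "'a measure" and S +
  fixes I :: "'i set" and X :: "'i \<Rightarrow> 'a \<Rightarrow> real"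
  assumes X: "\<And>i. i \<in> I \<Longrightarrow> X i \<in> borel_measurable M"
    and cos_mem: "\<And>J c. finite J \<Longrightarrow> J \<subseteq> I \<Longrightarrow> (\<lambda>x. cos (\<Sum>i\<in>J. c i * X i x)) \<in> S"
    and sin_mem: "\<And>J c. finite J \<Longrightarrow> J \<subseteq> I \<Longrightarrow> (\<lambda>x. sin (\<Sum>i\<in>J. c i * X i x)) \<in> S"
begin

text \<open>
  Functions \<open>V\<close> all of whose products with the given trigonometric functions stay in \<open>S\<close>. By
  the product formulas this class is closed under multiplication by \<open>sin (c * X i)\<close>, hence by
  polynomials in it and, passing to limits, by continuous functions of \<open>X i\<close>.
\<close>

definition multipliers :: "('a \<Rightarrow> real) set" where
  "multipliers = {V. V \<in> borel_measurable M \<and> (\<exists>K. \<forall>x\<in>space M. \<bar>V x\<bar> \<le> K) \<and>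
     (\<forall>J c. finite J \<longrightarrow> J \<subseteq> I \<longrightarrow>
        (\<lambda>x. V x * cos (\<Sum>i\<in>J. c i * X i x)) \<in> S \<and> (\<lambda>x. V x * sin (\<Sum>i\<in>J. c i * X i x)) \<in> S)}"

lemma one_multiplier: "(\<lambda>x. 1) \<in> multipliers"
  using cos_mem sin_mem by (auto simp: multipliers_def intro: exI[of _ 1])

lemma multiplier_mem: "V \<in> multipliers \<Longrightarrow> V \<in> S"
proof -
  assume "V \<in> multipliers"
  then have "\<forall>J c. finite J \<longrightarrow> J \<subseteq> I \<longrightarrow> (\<lambda>x. V x * cos (\<Sum>i\<in>J. c i * X i x)) \<in> S"
    by (simp add: multipliers_def)
  from this[rule_format, of "{}"] show "V \<in> S" by simp
qed

lemma multiplier_lincomb: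
  assumes "V \<in> multipliers" "V' \<in> multipliers"
  shows "(\<lambda>x. a * V x + b * V' x) \<in> multipliers"
proof -
  obtain K where "\<And>x. x \<in> space M \<Longrightarrow> \<bar>V x\<bar> \<le> K"
    using assms(1) unfolding multipliers_def by blast
  moreover obtain K' where "\<And>x. x \<in> space M \<Longrightarrow> \<bar>V' x\<bar> \<le> K'"
    using assms(2) unfolding multipliers_def by blast
  ultimately have K: "\<bar>V x\<bar> \<le> K" "\<bar>V' x\<bar> \<le> K'" if "x \<in> space M" for x
    using that by blast+
  have "\<bar>a * V x + b * V' x\<bar> \<le> \<bar>a\<bar> * K + \<bar>b\<bar> * K'" if "x \<in> space M" for x
    using K[OF that]
    by (intro order_trans[OF abs_triangle_ineq]) (auto simp: abs_mult intro!: add_mono mult_left_mono)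
  moreover have "(\<lambda>x. (a * V x + b * V' x) * cos (\<Sum>i\<in>J. c i * X i x)) \<in> S \<and>
      (\<lambda>x. (a * V x + b * V' x) * sin (\<Sum>i\<in>J. c i * X i x)) \<in> S" if "finite J" "J \<subseteq> I" for J c
    using assms that lincomb[of "\<lambda>x. V x * cos (\<Sum>i\<in>J. c i * X i x)" "\<lambda>x. V' x * cos (\<Sum>i\<in>J. c i * X i x)" a b]
      lincomb[of "\<lambda>x. V x * sin (\<Sum>i\<in>J. c i * X i x)" "\<lambda>x. V' x * sin (\<Sum>i\<in>J. c i * X i x)" a b]
    by (simp add: multipliers_def distrib_right mult.assoc)
  ultimately show ?thesis
    using assms by (auto simp: multipliers_def)
qed

lemma multiplier_sum:
  assumes "\<And>k. k \<in> A \<Longrightarrow> V k \<in> multipliers"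
  shows "(\<lambda>x. \<Sum>k\<in>A. V k x) \<in> multipliers"
  using assms
proof (induction A rule: infinite_finite_induct)
  case (insert k A)
  then show ?case using multiplier_lincomb[of "V k" "\<lambda>x. \<Sum>k\<in>A. V k x" 1 1] by simp
qed (use multiplier_lincomb[OF one_multiplier one_multiplier, of 0 0] in simp_all)

lemma multiplier_sin:
  assumes V: "V \<in> multipliers" and i: "i \<in> I"
  shows "(\<lambda>x. V x * sin (b * X i x)) \<in> multipliers"
proof -
  obtain K where K: "\<And>x. x \<in> space M \<Longrightarrow> \<bar>V x\<bar> \<le> K"
    using V by (auto simp: multipliers_def)
  have "\<bar>V x * sin (b * X i x)\<bar> \<le> K" if "x \<in> space M" for x
  proof -
    have "\<bar>V x * sin (b * X i x)\<bar> \<le> \<bar>V x\<bar> * 1"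
      unfolding abs_mult by (intro mult_left_mono) auto
    then show ?thesis using K[OF that] by simp
  qed
  moreover have "(\<lambda>x. V x * sin (b * X i x) * cos (\<Sum>i\<in>J. c i * X i x)) \<in> S \<and>
      (\<lambda>x. V x * sin (b * X i x) * sin (\<Sum>i\<in>J. c i * X i x)) \<in> S" if J: "finite J" "J \<subseteq> I" for J c
  proof -
    \<comment> \<open>\<open>c' s\<close> is the frequency vector \<open>c\<close> shifted by
      \<open>s * b\<close> in coordinate \<open>i\<close>, which may or may not belong to
      \<open>J\<close> already. The values \<open>s = 1\<close> and \<open>s = -1\<close> are the
      two terms of the product formulas.\<close>
    define c' where "c' s j = (if j \<in> J then c j else 0) + (if j = i then s * b else 0)" for s j
    have sum: "(\<Sum>j\<in>insert i J. c' s j * X j x) = (\<Sum>j\<in>J. c j * X j x) + s * b * X i x" for s x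
    proof -
      have "(\<Sum>j\<in>insert i J. c' s j * X j x) =
        (\<Sum>j\<in>insert i J. (if j \<in> J then c j * X j x else 0)) + (\<Sum>j\<in>insert i J. if j = i then s * b * X j x else 0)"
        unfolding sum.distrib[symmetric] by (intro sum.cong) (auto simp: c'_def algebra_simps)
      moreover have "(\<Sum>j\<in>insert i J. if j \<in> J then c j * X j x else 0) = (\<Sum>j\<in>J. c j * X j x)"
        using J by (intro sum.mono_neutral_cong_right) auto
      ultimately show ?thesis using J by simp
    qed
    have fin: "finite (insert i J)" "insert i J \<subseteq> I" using J i by auto
    have m: "(\<lambda>x. V x * cos (\<Sum>j\<in>insert i J. c' s j * X j x)) \<in> S"
      "(\<lambda>x. V x * sin (\<Sum>j\<in>insert i J. c' s j * X j x)) \<in> S" for s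
      using V fin by (auto simp: multipliers_def simp del: sum.insert)
    have "(\<lambda>x. 1/2 * (V x * sin (\<Sum>j\<in>insert i J. c' 1 j * X j x)) +
        (-1/2) * (V x * sin (\<Sum>j\<in>insert i J. c' (-1) j * X j x))) \<in> S"
      by (intro lincomb m)
    moreover have "(\<lambda>x. 1/2 * (V x * cos (\<Sum>j\<in>insert i J. c' (-1) j * X j x)) +
        (-1/2) * (V x * cos (\<Sum>j\<in>insert i J. c' 1 j * X j x))) \<in> S"
      by (intro lincomb m)
    ultimately show ?thesis
      unfolding sum by (simp add: sin_add cos_add sin_diff cos_diff algebra_simps)
  qed
  ultimately show ?thesis
    using V X[OF i] by (auto simp: multipliers_def)
qed

lemma multiplier_polynomial_sin:
  assumes V: "V \<in> multipliers" and i: "i \<in> I" and p: "real_polynomial_function p"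
  shows "(\<lambda>x. V x * p (sin (b * X i x))) \<in> multipliers"
proof -
  have pow: "(\<lambda>x. V x * sin (b * X i x) ^ k) \<in> multipliers" for k
  proof (induction k)
    case (Suc k)
    from multiplier_sin[OF this i, of b] show ?case by (simp add: algebra_simps)
  qed (use V in simp)
  obtain a n where p_eq: "p = (\<lambda>y. \<Sum>k\<le>n. a k * y ^ k)"
    using p unfolding real_polynomial_function_iff_sum by blast
  \<comment> \<open>The summand with coefficient 0 gives each term the shape of
    \<open>multiplier_lincomb\<close>.\<close>
  have "(\<lambda>x. \<Sum>k\<le>n. a k * (V x * sin (b * X i x) ^ k) + 0 * (V x * sin (b * X i x) ^ k)) \<in> multipliers"
    by (intro multiplier_sum multiplier_lincomb pow)
  then show ?thesis by (simp add: p_eq sum_distrib_left mult.left_commute)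
qed

lemma multiplier_limit:
  assumes Z: "\<And>n. Z n \<in> multipliers" and Z': "Z' \<in> borel_measurable M"
    and lim: "\<And>x. x \<in> space M \<Longrightarrow> (\<lambda>n. Z n x) \<longlonglongrightarrow> Z' x"
    and K: "\<And>n x. x \<in> space M \<Longrightarrow> \<bar>Z n x\<bar> \<le> K"
  shows "Z' \<in> multipliers"
proof -
  have bound': "\<bar>Z' x\<bar> \<le> K" if "x \<in> space M" for x
    using tendsto_rabs[OF lim[OF that]] K[OF that] by (intro LIMSEQ_le_const2) auto
  have mem: "(\<lambda>x. Z' x * T x) \<in> S"
    if T: "T \<in> borel_measurable M" "\<And>x. \<bar>T x\<bar> \<le> 1" "\<And>n. (\<lambda>x. Z n x * T x) \<in> S" for T
  proof (rule dominated_limit[OF T(3)])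
    show "sq_integrable M (\<lambda>x. K)" by (rule sq_integrable_const)
    show "AE x in M. (\<lambda>n. Z n x * T x) \<longlonglongrightarrow> Z' x * T x"
      using lim by (intro AE_I2 tendsto_intros)
    show "AE x in M. \<bar>Z n x * T x\<bar> \<le> \<bar>K\<bar>" for n
    proof (rule AE_I2)
      fix x assume "x \<in> space M"
      have "\<bar>Z n x * T x\<bar> \<le> \<bar>Z n x\<bar> * 1" unfolding abs_mult by (intro mult_left_mono T) auto
      then show "\<bar>Z n x * T x\<bar> \<le> \<bar>K\<bar>" using K[OF \<open>x \<in> space M\<close>, of n] by simp
    qed
  qed (use T Z' in auto)
  have "(\<lambda>x. Z' x * cos (\<Sum>i\<in>J. c i * X i x)) \<in> S \<and> (\<lambda>x. Z' x * sin (\<Sum>i\<in>J. c i * X i x)) \<in> S"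
    if J: "finite J" "J \<subseteq> I" for J c
  proof -
    have "X i \<in> borel_measurable M" if "i \<in> J" for i using X J that by auto
    then have "(\<lambda>x. \<Sum>i\<in>J. c i * X i x) \<in> borel_measurable M" by simp
    moreover have "(\<lambda>x. Z n x * cos (\<Sum>i\<in>J. c i * X i x)) \<in> S"
      "(\<lambda>x. Z n x * sin (\<Sum>i\<in>J. c i * X i x)) \<in> S" for n
      using Z[of n] J by (auto simp: multipliers_def)
    ultimately show ?thesis by (intro conjI mem) auto
  qed
  then show ?thesis using Z' bound' by (auto simp: multipliers_def)
qed

text \<open>Taking \<open>r = Suc n\<close> and error \<open>inverse (Suc n)\<close>, the windows
  eventually contain any given value of \<open>X i\<close>, which gives pointwise convergence, while
  the bound \<open>K + 1\<close> outside the windows is uniform in \<open>n\<close> and allows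
  dominated convergence.\<close>

lemma multiplier_continuous:
  assumes V: "V \<in> multipliers" and i: "i \<in> I" and g: "continuous_on UNIV g" and K: "\<And>y. \<bar>g y\<bar> \<le> K"
  shows "(\<lambda>x. V x * g (X i x)) \<in> multipliers"
proof -
  have "\<exists>p. real_polynomial_function p \<and>
      (\<forall>x. \<bar>x\<bar> \<le> real (Suc n) * (pi / 2) \<longrightarrow> \<bar>p (sin (x / real (Suc n))) - g x\<bar> < inverse (real (Suc n))) \<and>
      (\<forall>x. \<bar>p (sin (x / real (Suc n)))\<bar> \<le> K + inverse (real (Suc n)))" for n
    using K by (rule_tac trigonometric_approx[OF g, of "real (Suc n)" "inverse (real (Suc n))" K]) auto
  then obtain p where p: "\<And>n. real_polynomial_function (p n)"
    and approx: "\<And>n x. \<bar>x\<bar> \<le> real (Suc n) * (pi / 2) \<Longrightarrow>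
      \<bar>p n (sin (x / real (Suc n))) - g x\<bar> < inverse (real (Suc n))"
    and bound: "\<And>n x. \<bar>p n (sin (x / real (Suc n)))\<bar> \<le> K + inverse (real (Suc n))"
    by metis
  obtain L where L: "\<And>x. x \<in> space M \<Longrightarrow> \<bar>V x\<bar> \<le> L"
    using V by (auto simp: multipliers_def)
  have V': "V \<in> borel_measurable M" using V by (simp add: multipliers_def)
  show ?thesis
  proof (rule multiplier_limit)
    show "(\<lambda>x. V x * p n (sin (inverse (real (Suc n)) * X i x))) \<in> multipliers" for n
      by (rule multiplier_polynomial_sin[OF V i p])
    show "(\<lambda>x. V x * g (X i x)) \<in> borel_measurable M"
      using V' X[OF i] borel_measurable_continuous_onI[OF g] by auto
    show "(\<lambda>n. V x * p n (sin (inverse (real (Suc n)) * X i x))) \<longlonglongrightarrow> V x * g (X i x)" for x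
    proof (intro tendsto_mult tendsto_const)
      obtain N where N: "\<bar>X i x\<bar> < real N * (pi / 2)"
        using reals_Archimedean3[of "pi/2" ] by auto
      have "eventually (\<lambda>n. norm (p n (sin (inverse (real (Suc n)) * X i x)) - g (X i x)) \<le> inverse (real (Suc n))) sequentially"
        unfolding eventually_sequentially
      proof (intro exI allI impI)
        fix n assume "N \<le> n"
        then have "real N * (pi / 2) \<le> real (Suc n) * (pi / 2)" by (intro mult_right_mono) auto
        then have "\<bar>X i x\<bar> \<le> real (Suc n) * (pi / 2)" using N by linarith
        from approx[OF this]
        show "norm (p n (sin (inverse (real (Suc n)) * X i x)) - g (X i x)) \<le> inverse (real (Suc n))"
          unfolding divide_inverse mult.commute[of "X i x"] real_norm_def by (rule less_imp_le)
      qed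
      then have "(\<lambda>n. p n (sin (inverse (real (Suc n)) * X i x)) - g (X i x)) \<longlonglongrightarrow> 0"
        by (rule Lim_null_comparison[OF _ LIMSEQ_inverse_real_of_nat])
      then show "(\<lambda>n. p n (sin (inverse (real (Suc n)) * X i x))) \<longlonglongrightarrow> g (X i x)"
        by (rule LIM_zero_cancel)
    qed
    show "\<bar>V x * p n (sin (inverse (real (Suc n)) * X i x))\<bar> \<le> L * (K + 1)" if "x \<in> space M" for n x
    proof -
      have "inverse (real (Suc n)) \<le> 1" by (simp add: inverse_eq_divide)
      then have "\<bar>p n (sin (inverse (real (Suc n)) * X i x))\<bar> \<le> K + 1"
        using bound[of n "X i x"] unfolding divide_inverse mult.commute[of "X i x"] by linarith
      then show ?thesis
        unfolding abs_mult using L[OF that] by (intro mult_mono) auto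
    qed
  qed
qed

lemma multiplier_halfline:
  assumes V: "V \<in> multipliers" and i: "i \<in> I"
  shows "(\<lambda>x. V x * indicator {..b} (X i x)) \<in> multipliers"
proof -
  \<comment> \<open>For \<open>n > 0\<close> this is 1 on \<open>{..b}\<close> and falls linearly to
    0 at \<open>b + 1 / n\<close>. It decreases to the indicator of the closed half-line.\<close>
  define g where "g n y = min 1 (max 0 (1 - real n * (y - b)))" for n y
  obtain L where L: "\<And>x. x \<in> space M \<Longrightarrow> \<bar>V x\<bar> \<le> L"
    using V by (auto simp: multipliers_def)
  show ?thesis
  proof (rule multiplier_limit)
    show "(\<lambda>x. V x * g n (X i x)) \<in> multipliers" for n
      by (rule multiplier_continuous[OF V i, where K=1])
        (auto simp: g_def intro!: continuous_intros)
    show "(\<lambda>x. V x * indicator {..b} (X i x)) \<in> borel_measurable M"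
      using V X[OF i] by (auto simp: multipliers_def)
    show "(\<lambda>n. V x * g n (X i x)) \<longlonglongrightarrow> V x * indicator {..b} (X i x)" for x
    proof (intro tendsto_mult tendsto_const)
      show "(\<lambda>n. g n (X i x)) \<longlonglongrightarrow> indicator {..b} (X i x)"
      proof (cases "X i x \<le> b")
        case True
        have "real n * (X i x - b) \<le> 0" for n using True by (intro mult_nonneg_nonpos) auto
        then have "g n (X i x) = 1" for n
          unfolding g_def by (smt (verit))
        then show ?thesis using True by simp
      next
        case False
        obtain N where N: "1 < real N * (X i x - b)"
          using reals_Archimedean3[of "X i x - b"] False by auto
        have "eventually (\<lambda>n. g n (X i x) = 0) sequentially"
          unfolding eventually_sequentially
        proof (intro exI allI impI)
          fix n assume "N \<le> n"
          then have "real N * (X i x - b) \<le> real n * (X i x - b)"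
            using False by (intro mult_right_mono) auto
          then show "g n (X i x) = 0" using N by (simp add: g_def)
        qed
        then have "(\<lambda>n. g n (X i x)) \<longlonglongrightarrow> 0" by (rule tendsto_eventually)
        then show ?thesis using False by simp
      qed
    qed
    show "\<bar>V x * g n (X i x)\<bar> \<le> L" if "x \<in> space M" for n x
    proof -
      have "\<bar>V x * g n (X i x)\<bar> \<le> \<bar>V x\<bar> * 1"
        unfolding abs_mult by (intro mult_left_mono) (auto simp: g_def)
      then show ?thesis using L[OF that] by simp
    qed
  qed
qed

lemma indicator_cylinder:
  assumes "finite J" "J \<subseteq> I"
  shows "(\<lambda>x. \<Prod>i\<in>J. indicator {..b i} (X i x)) \<in> multipliers"
  using assms
proof (induction J rule: finite_induct)
  case (insert i J)
  then have "(\<lambda>x. \<Prod>i\<in>J. indicator {..b i} (X i x)) \<in> multipliers" and "i \<in> I" by auto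
  from multiplier_halfline[OF this, of "b i"] insert(1,2) show ?case by (simp add: mult.commute)
qed (simp add: one_multiplier)

section \<open>From cylinders to the augmented sigma-algebra\<close>

abbreviation "augmented_sigma \<equiv> sigma (space M) ({X i -` B \<inter> space M | i B. i \<in> I \<and> B \<in> sets borel} \<union> null_sets M)"

lemma subalgebra_augmented_sigma: "subalgebra M augmented_sigma"
proof -
  have gen: "{X i -` B \<inter> space M | i B. i \<in> I \<and> B \<in> sets borel} \<union> null_sets M \<subseteq> sets M"
    using X by (auto intro: measurable_sets)
  have "{X i -` B \<inter> space M | i B. i \<in> I \<and> B \<in> sets borel} \<union> null_sets M \<subseteq> Pow (space M)"
    using gen sets.space_closed by (rule order_trans)
  then show ?thesis
    unfolding subalgebra_def using gen by (simp only: sigma_le_sets space_measure_of_conv sets.top simp_thms)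
qed

text \<open>Dynkin's pi-lambda argument. The generator \<open>P\<close> consists of the cylinders
  over closed half-lines and the null sets; it is stable under intersection because a null set
  absorbs whatever it meets. The members of \<open>S\<close> pass to complements by subtraction from
  1 and to disjoint unions by dominated convergence.\<close>

lemma indicator_mem:
  assumes "A \<in> sets augmented_sigma"
  shows "indicator A \<in> S"
proof -
  define cyl where "cyl J b = {x \<in> space M. \<forall>i\<in>J. X i x \<le> b i}" for J b
  define P where "P = {cyl J b | J b. finite J \<and> J \<subseteq> I} \<union> null_sets M"
  have cyl_sets: "cyl J b \<in> sets M" if "finite J" "J \<subseteq> I" for J b
  proof -
    have [measurable]: "\<And>i. i \<in> J \<Longrightarrow> X i \<in> borel_measurable M" using X that by auto
    show ?thesis unfolding cyl_def using that by measurable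
  qed
  have P_sets: "P \<subseteq> sets M" by (auto simp: P_def cyl_sets)
  have P_Pow: "P \<subseteq> Pow (space M)" using P_sets sets.sets_into_space by blast
  have stable: "Int_stable P"
  proof (rule Int_stableI)
    fix A B assume A: "A \<in> P" and B: "B \<in> P"
    show "A \<inter> B \<in> P"
    proof (cases "A \<in> null_sets M \<or> B \<in> null_sets M")
      case True
      have "A \<in> sets M" "B \<in> sets M" using A B P_sets by auto
      with True have "A \<inter> B \<in> null_sets M" by (auto simp: null_set_Int1 null_set_Int2)
      then show ?thesis by (simp add: P_def)
    next
      case False
      then obtain J b J' b' where J: "finite J" "J \<subseteq> I" "A = cyl J b" "finite J'" "J' \<subseteq> I" "B = cyl J' b'"
        using A B by (auto simp: P_def)
      \<comment> \<open>A coordinate constrained by both cylinders receives the smaller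
        bound.\<close>
      define c where "c i = (if i \<in> J then if i \<in> J' then min (b i) (b' i) else b i else b' i)" for i
      have "A \<inter> B = cyl (J \<union> J') c"
        using J by (auto simp: cyl_def c_def)
      then show ?thesis using J by (auto simp: P_def)
    qed
  qed
  have "A \<in> sigma_sets (space M) P"
  proof -
    have "X i -` B \<inter> space M \<in> sets (sigma (space M) P)" if i: "i \<in> I" and B: "B \<in> sets borel" for i B
    proof -
      have "{x \<in> space M. X i x \<le> a} \<in> sets (sigma (space M) P)" for a
      proof -
        have "{x \<in> space M. X i x \<le> a} = cyl {i} (\<lambda>_. a)" by (simp add: cyl_def)
        then have "{x \<in> space M. X i x \<le> a} \<in> P" using i unfolding P_def by blast
        then show ?thesis using P_Pow by auto
      qed
      then have "X i \<in> borel_measurable (sigma (space M) P)"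
        by (intro borel_measurableI_le) (simp add: space_measure_of_conv)
      from measurable_sets[OF this B] show ?thesis by (simp add: space_measure_of_conv)
    qed
    moreover have "null_sets M \<subseteq> sets (sigma (space M) P)"
      using P_Pow by (auto simp: P_def)
    ultimately have "{X i -` B \<inter> space M | i B. i \<in> I \<and> B \<in> sets borel} \<union> null_sets M \<subseteq> sets (sigma (space M) P)"
      by blast
    moreover have "space M \<in> sets (sigma (space M) P)"
      using sets.top[of "sigma (space M) P"] by (simp add: space_measure_of_conv)
    moreover have "{X i -` B \<inter> space M | i B. i \<in> I \<and> B \<in> sets borel} \<union> null_sets M \<subseteq> Pow (space M)"
      using sets.sets_into_space[OF null_setsD2] by blast
    ultimately have "sets augmented_sigma \<subseteq> sets (sigma (space M) P)"
      by (simp only: sigma_le_sets simp_thms)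
    then show ?thesis using assms P_Pow by auto
  qed
  with stable P_Pow show ?thesis
  proof (induction rule: sigma_sets_induct_disjoint)
    case (basic A)
    show ?case
    proof (cases "A \<in> null_sets M")
      case True
      have "AE x in M. 0 = (indicator A x :: real)"
        using AE_not_in[OF True] by eventually_elim simp
      then show ?thesis using True by (intro cong_AE[OF zero]) auto
    next
      case False
      then obtain J b where J: "finite J" "J \<subseteq> I" "A = cyl J b" using basic by (auto simp: P_def)
      show ?thesis
      proof (rule cong_AE[OF multiplier_mem[OF indicator_cylinder[OF J(1,2), of b]]])
        show "AE x in M. (\<Prod>i\<in>J. indicator {..b i} (X i x)) = (indicator A x :: real)"
        proof (rule AE_I2)
          fix x assume "x \<in> space M"
          then show "(\<Prod>i\<in>J. indicator {..b i} (X i x)) = (indicator A x :: real)"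
            using J(1) by (auto simp: J(3) cyl_def indicator_def prod_zero_iff intro!: prod.neutral)
        qed
      qed (use J cyl_sets in auto)
    qed
  next
    case empty
    have "indicator {} = (\<lambda>x::'a. 0::real)" by auto
    then show ?case using zero by simp
  next
    case (compl A)
    have "A \<in> sets M" using compl P_sets sets.sigma_sets_subset by blast
    have "(\<lambda>x. 1 - indicator A x) \<in> S"
      by (rule diff[OF multiplier_mem[OF one_multiplier] compl(2)])
    then show ?case
      by (rule cong_AE) (use \<open>A \<in> sets M\<close> in \<open>auto simp: indicator_def\<close>)
  next
    case (union A)
    have A: "A i \<in> sets M" for i using union P_sets sets.sigma_sets_subset by blast
    show ?case
    proof (rule dominated_limit)
      show "(\<lambda>x. \<Sum>i<n. indicator (A i) x) \<in> S" for n
        by (intro sum union)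
      show "sq_integrable M (\<lambda>x. 1)" by (rule sq_integrable_const)
      have eq: "(\<Sum>i<n. indicator (A i) x) = (indicator (\<Union>i<n. A i) x :: real)" for n x
        using union(1) by (subst indicator_UN_disjoint) (auto intro: disjoint_family_on_mono)
      have "(\<lambda>n. indicator (\<Union>i<n. A i) x :: real) \<longlonglongrightarrow> indicator (\<Union>i. A i) x" for x
        by (rule LIMSEQ_indicator_UN)
      then show "AE x in M. (\<lambda>n. \<Sum>i<n. indicator (A i) x) \<longlonglongrightarrow> (indicator (\<Union>i. A i) x :: real)"
        by (simp add: eq)
      show "AE x in M. \<bar>\<Sum>i<n. indicator (A i) x\<bar> \<le> \<bar>1::real\<bar>" for n
        unfolding eq by (simp add: indicator_def)
    qed (use A in auto)
  qed
qed

theorem measurable_mem: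
  assumes "Z \<in> borel_measurable augmented_sigma" and "sq_integrable M Z"
  shows "Z \<in> S"
proof -
  have "(\<lambda>x. Z x * 1) \<in> S"
  proof (rule indicators_imp_measurable[OF subalgebra_augmented_sigma])
    show "(\<lambda>x. indicator A x * 1) \<in> S" if "A \<in> sets augmented_sigma" for A
      using indicator_mem[OF that] unfolding mult_1_right .
    show "sq_integrable M (\<lambda>x. Z x * 1)"
      using assms(2) unfolding mult_1_right .
  qed (fact borel_measurable_const assms(1))+
  then show ?thesis unfolding mult_1_right .
qed

end

section \<open>Centred normal variables and independence\<close>

lemma (in prob_space) expectation_trig_centred_normal:
  assumes D: "distributed M lborel X (normal_density 0 \<sigma>)" and \<sigma>: "0 < \<sigma>"
  shows "expectation (\<lambda>x. cos (c * X x)) = exp (- (c\<^sup>2 * \<sigma>\<^sup>2 / 2))"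
    and "expectation (\<lambda>x. sin (c * X x)) = 0"
proof -
  have X: "X \<in> borel_measurable M" using distributed_measurable[OF D] by simp
  have "distributed M lborel (\<lambda>x. X x / \<sigma>) std_normal_density"
    using D normal_standard_normal_convert[OF \<sigma>, of X 0] by simp
  from distributed_distr_eq_density[OF this]
  have "distr M borel (\<lambda>x. X x / \<sigma>) = std_normal_distribution"
    by (metis distr_cong sets_lborel)
  then have "char (distr M borel (\<lambda>x. X x / \<sigma>)) (c * \<sigma>) = complex_of_real (exp (- ((c * \<sigma>)\<^sup>2) / 2))"
    by (simp add: char_std_normal_distribution)
  moreover have "char (distr M borel (\<lambda>x. X x / \<sigma>)) (c * \<sigma>) = (CLINT x|M. iexp (c * X x))"
    unfolding char_def using X \<sigma> by (subst integral_distr) (auto simp: mult.assoc)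
  moreover have "integrable M (\<lambda>x. iexp (c * X x))"
    using X by (intro integrable_iexp) auto
  ultimately have *: "(CLINT x|M. iexp (c * X x)) = complex_of_real (exp (- (c\<^sup>2 * \<sigma>\<^sup>2 / 2)))"
    and int: "integrable M (\<lambda>x. iexp (c * X x))"
    by (simp_all add: power_mult_distrib)
  have Re: "Re (iexp (c * X x)) = cos (c * X x)" "Im (iexp (c * X x)) = sin (c * X x)" for x
    by (simp_all add: Re_exp Im_exp)
  show "expectation (\<lambda>x. cos (c * X x)) = exp (- (c\<^sup>2 * \<sigma>\<^sup>2 / 2))"
    using arg_cong[OF *, of Re] unfolding integral_Re[OF int, symmetric] Re Re_complex_of_real .
  show "expectation (\<lambda>x. sin (c * X x)) = 0"
    using arg_cong[OF *, of Im] unfolding integral_Im[OF int, symmetric] Re Im_complex_of_real .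
qed

text \<open>The fourth moment is for the remainders of the exponential martingale: their pointwise
  size is quadratic in the increment, so their second moment involves its fourth power.\<close>

lemma (in prob_space) centred_normal_moments:
  assumes D: "distributed M lborel X (normal_density 0 \<sigma>)" and \<sigma>: "0 < \<sigma>"
  shows "integrable M X" and "expectation X = 0"
    and "integrable M (\<lambda>x. (X x)\<^sup>2)" and "expectation (\<lambda>x. (X x)\<^sup>2) = \<sigma>\<^sup>2"
    and "integrable M (\<lambda>x. X x ^ 4)" and "expectation (\<lambda>x. X x ^ 4) = 3 * (\<sigma>\<^sup>2)\<^sup>2"
proof -
  have int: "integrable M (\<lambda>x. X x ^ k)" for k
    using distributed_integrable[OF D, of "\<lambda>x. x ^ k"] integrable_normal_moment[OF \<sigma>, of 0 k]
    by (simp add: normal_density_nonneg)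
  from int[of 1] int[of 2] int[of 4]
  show "integrable M X" "integrable M (\<lambda>x. (X x)\<^sup>2)" "integrable M (\<lambda>x. X x ^ 4)" by simp_all
  show "expectation X = 0" using normal_distributed_expectation[OF \<sigma> D] .
  have "expectation (\<lambda>x. X x ^ (2 * k)) = fact (2 * k) / ((2 / \<sigma>\<^sup>2) ^ k * fact k)" for k
    using distributed_integral[OF D, of "\<lambda>x. x ^ (2 * k)"] integral_normal_moment_even[OF \<sigma>, of 0 k]
    by (simp add: normal_density_nonneg)
  from this[of 1] this[of 2]
  show "expectation (\<lambda>x. (X x)\<^sup>2) = \<sigma>\<^sup>2" "expectation (\<lambda>x. X x ^ 4) = 3 * (\<sigma>\<^sup>2)\<^sup>2"
    using \<sigma> by (simp_all add: eval_nat_numeral)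
qed

lemma (in prob_space) indep_varI_measure:
  assumes X: "random_variable S X" and Y: "random_variable T Y"
    and prod: "\<And>A B. A \<in> sets S \<Longrightarrow> B \<in> sets T \<Longrightarrow>
      prob ((X -` A \<inter> space M) \<inter> (Y -` B \<inter> space M)) = prob (X -` A \<inter> space M) * prob (Y -` B \<inter> space M)"
  shows "indep_var S X T Y"
proof -
  have stable: "Int_stable {X -` A \<inter> space M |A. A \<in> sets S}" for X :: "'a \<Rightarrow> 'd" and S
  proof (safe intro!: Int_stableI)
    fix A B assume "A \<in> sets S" "B \<in> sets S"
    then show "\<exists>C. (X -` A \<inter> space M) \<inter> (X -` B \<inter> space M) = (X -` C \<inter> space M) \<and> C \<in> sets S"
      by (intro exI[of _ "A \<inter> B"]) auto
  qed
  have "indep_set {X -` A \<inter> space M |A. A \<in> sets S} {Y -` A \<inter> space M |A. A \<in> sets T}"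
    using measurable_sets[OF X] measurable_sets[OF Y] prod by (intro indep_setI) auto
  then show ?thesis
    unfolding indep_var_eq using X Y by (intro conjI indep_set_sigma_sets stable) auto
qed

text \<open>Both end points are inserted before sorting, so that the grid spans the interval. For
  \<open>a = b\<close> it is the single point \<open>a\<close> with \<open>n = 0\<close>, which
  covers the past at time 0.\<close>

lemma time_grid:
  fixes J :: "real set"
  assumes "finite J" and "J \<subseteq> {a..b}" and "a \<le> b"
  obtains n t where "t 0 = a" and "t n = b" and "\<And>i. i < n \<Longrightarrow> t i < t (Suc i)" and "J \<subseteq> t ` {..n::nat}"
proof -
  define xs where "xs = sorted_list_of_set (insert a (insert b J))"
  have set_xs: "set xs = insert a (insert b J)" unfolding xs_def using assms(1) by (intro set_sorted_list_of_set) simp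
  have sorted: "sorted_wrt (<) xs" unfolding xs_def by (rule strict_sorted_list_of_set)
  have pos: "0 < length xs" using set_xs by (cases xs) auto
  have mono: "xs ! i \<le> xs ! j" if "i \<le> j" "j < length xs" for i j
    using sorted_wrt_nth_less[OF sorted, of i j] that by (cases "i = j") auto
  obtain i where i: "i < length xs" "xs ! i = a" using set_xs by (metis in_set_conv_nth insertI1)
  obtain j where j: "j < length xs" "xs ! j = b" using set_xs by (metis in_set_conv_nth insertI1 insertI2)
  have range: "xs ! k \<in> {a..b}" if "k < length xs" for k
    using nth_mem[OF that] set_xs assms by auto
  show thesis
  proof (rule that[of "\<lambda>i. xs ! i" "length xs - 1"])
    show "xs ! 0 = a" using mono[of 0 i] i range[of 0] pos by auto
    show "xs ! (length xs - 1) = b" using mono[of j "length xs - 1"] j range[of "length xs - 1"] pos by auto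
    show "xs ! i < xs ! Suc i" if "i < length xs - 1" for i
      using sorted_wrt_nth_less[OF sorted, of i "Suc i"] that by auto
    show "J \<subseteq> (!) xs ` {..length xs - 1}"
    proof
      fix x assume "x \<in> J"
      then have "x \<in> set xs" by (simp add: set_xs)
      then obtain k where "k < length xs" "xs ! k = x" by (auto simp: in_set_conv_nth)
      then show "x \<in> (!) xs ` {..length xs - 1}" by (intro image_eqI[of _ _ k]) auto
    qed
  qed
qed

text \<open>Each difference from the first grid point telescopes, so \<open>\<mu> j\<close> collects
  the \<open>c i\<close> whose point lies beyond index \<open>j\<close>. The coefficients do not
  depend on \<open>w\<close>: one choice serves all paths.\<close>

lemma lincomb_increments:
  fixes t :: "nat \<Rightarrow> real"
  assumes "finite J" and "\<tau> ` J \<subseteq> t ` {..n}"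
  obtains \<mu> :: "nat \<Rightarrow> real" where "\<And>w :: real \<Rightarrow> real.
    (\<Sum>i\<in>J. c i * (w (\<tau> i) - w (t 0))) = (\<Sum>j<n. \<mu> j * (w (t (Suc j)) - w (t j)))"
proof -
  have "\<forall>i\<in>J. \<exists>k\<le>n. \<tau> i = t k" using assms(2) by auto
  then obtain k where k: "\<And>i. i \<in> J \<Longrightarrow> k i \<le> n" "\<And>i. i \<in> J \<Longrightarrow> \<tau> i = t (k i)" by metis
  have tel: "w (\<tau> i) - w (t 0) = (\<Sum>j<n. of_bool (j < k i) * (w (t (Suc j)) - w (t j)))" if "i \<in> J" for i and w :: "real \<Rightarrow> real"
  proof -
    have "(\<Sum>j<n. of_bool (j < k i) * (w (t (Suc j)) - w (t j))) = (\<Sum>j<k i. w (t (Suc j)) - w (t j))"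
      using k(1)[OF that] by (intro sum.mono_neutral_cong_right) auto
    also have "\<dots> = w (t (k i)) - w (t 0)"
      using sum_lessThan_telescope[of "\<lambda>j. w (t j)" "k i"] by simp
    finally show ?thesis using k(2)[OF that] by simp
  qed
  show thesis
  proof (rule that[of "\<lambda>j. \<Sum>i\<in>J. c i * of_bool (j < k i)"])
    fix w :: "real \<Rightarrow> real"
    have "(\<Sum>i\<in>J. c i * (w (\<tau> i) - w (t 0))) =
      (\<Sum>i\<in>J. \<Sum>j<n. c i * of_bool (j < k i) * (w (t (Suc j)) - w (t j)))"
      by (intro sum.cong refl) (simp only: tel sum_distrib_left mult.assoc)
    also have "\<dots> = (\<Sum>j<n. (\<Sum>i\<in>J. c i * of_bool (j < k i)) * (w (t (Suc j)) - w (t j)))"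
      by (subst sum.swap) (simp add: sum_distrib_right)
    finally show "(\<Sum>i\<in>J. c i * (w (\<tau> i) - w (t 0))) =
      (\<Sum>j<n. (\<Sum>i\<in>J. c i * of_bool (j < k i)) * (w (t (Suc j)) - w (t j)))" .
  qed
qed

section \<open>The augmented Brownian filtration\<close>

locale brownian = prob_space M for M :: "'a measure" +
  fixes W :: "real \<Rightarrow> 'a \<Rightarrow> real"
  assumes brownian_motion: "brownian_motion M W"
begin

abbreviation "N \<equiv> completion M"
abbreviation "F \<equiv> brownian_filtration M W"

sublocale N: prob_space N
  by (rule prob_space_completion)

lemma W_measurable: "t \<in> {0..1} \<Longrightarrow> W t \<in> borel_measurable M"
  and W_0: "AE \<omega> in M. W 0 \<omega> = 0"
  and increment_normal: "0 \<le> s \<Longrightarrow> s < t \<Longrightarrow> t \<le> 1 \<Longrightarrow>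
    distributed M lborel (\<lambda>\<omega>. W t \<omega> - W s \<omega>) (normal_density 0 (sqrt (t - s)))"
  and W_continuous: "AE \<omega> in M. continuous_on {0..1} (\<lambda>t. W t \<omega>)"
  using brownian_motion by (auto simp: brownian_motion_def)

lemma indep_increments:
  "0 \<le> t 0 \<Longrightarrow> (\<And>i. i < n \<Longrightarrow> t i < t (Suc i)) \<Longrightarrow> t n \<le> 1 \<Longrightarrow>
    indep_vars (\<lambda>_. borel) (\<lambda>i \<omega>. W (t (Suc i)) \<omega> - W (t i) \<omega>) {..<n}"
  using brownian_motion by (auto simp: brownian_motion_def)

lemma W_measurable_N: "t \<in> {0..1} \<Longrightarrow> W t \<in> borel_measurable N"
  by (intro measurable_completion W_measurable)

lemma increment_normal_N:
  assumes "0 \<le> s" "s < t" "t \<le> 1"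
  shows "distributed N lborel (\<lambda>\<omega>. W t \<omega> - W s \<omega>) (normal_density 0 (sqrt (t - s)))"
  using increment_normal[OF assms] unfolding distributed_def
  by (auto simp: distr_completion measurable_completion)

lemma filtration_gen_Pow:
  "{W s -` B \<inter> space M | s B. s \<in> {0..t} \<and> B \<in> sets borel} \<union> null_sets N \<subseteq> Pow (space M)"
  using sets.sets_into_space[OF null_setsD2, of _ N] by auto

lemma space_F: "space (F t) = space M"
  by (simp add: brownian_filtration_def space_measure_of_conv)

lemma subalgebra_F: "t \<le> 1 \<Longrightarrow> subalgebra N (F t)"
proof -
  assume t: "t \<le> 1"
  have "{W s -` B \<inter> space M | s B. s \<in> {0..t} \<and> B \<in> sets borel} \<union> null_sets N \<subseteq> sets N"
    using t measurable_sets[OF W_measurable_N] by fastforce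
  moreover have "space M \<in> sets N" using sets.top[of N] by simp
  ultimately have "sets (F t) \<subseteq> sets N"
    unfolding brownian_filtration_def by (simp only: sigma_le_sets[OF filtration_gen_Pow] simp_thms)
  then show ?thesis by (simp add: subalgebra_def space_F)
qed

lemma F_mono: "s \<le> t \<Longrightarrow> subalgebra (F t) (F s)"
proof -
  assume "s \<le> t"
  then have "{W u -` B \<inter> space M | u B. u \<in> {0..s} \<and> B \<in> sets borel} \<union> null_sets N \<subseteq>
    {W u -` B \<inter> space M | u B. u \<in> {0..t} \<and> B \<in> sets borel} \<union> null_sets N" by fastforce
  then have "sigma_sets (space M) ({W u -` B \<inter> space M | u B. u \<in> {0..s} \<and> B \<in> sets borel} \<union> null_sets N) \<subseteq>
    sigma_sets (space M) ({W u -` B \<inter> space M | u B. u \<in> {0..t} \<and> B \<in> sets borel} \<union> null_sets N)"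
    by (rule sigma_sets_mono')
  then show ?thesis
    unfolding subalgebra_def brownian_filtration_def space_measure_of_conv sets_measure_of[OF filtration_gen_Pow]
    by simp
qed

lemma measurable_F_mono: "s \<le> t \<Longrightarrow> Z \<in> borel_measurable (F s) \<Longrightarrow> Z \<in> borel_measurable (F t)"
  using measurable_from_subalg[OF F_mono] .

lemma measurable_F_N: "t \<le> 1 \<Longrightarrow> Z \<in> borel_measurable (F t) \<Longrightarrow> Z \<in> borel_measurable N"
  using measurable_from_subalg[OF subalgebra_F] .

lemma W_adapted: "0 \<le> s \<Longrightarrow> s \<le> t \<Longrightarrow> W s \<in> borel_measurable (F t)"
proof (rule measurableI)
  fix B :: "real set" assume s: "0 \<le> s" "s \<le> t" and B: "B \<in> sets borel"
  then have "W s -` B \<inter> space M \<in> {W s -` B \<inter> space M | s B. s \<in> {0..t} \<and> B \<in> sets borel} \<union> null_sets N"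
    by fastforce
  then show "W s -` B \<inter> space (F t) \<in> sets (F t)"
    using filtration_gen_Pow by (simp add: space_F) (simp add: brownian_filtration_def sigma_sets.Basic)
qed simp

text \<open>Matches the filtration with \<open>augmented_sigma\<close> of the trigonometric locale
  taken over \<open>N\<close>.\<close>

lemma F_eq_augmented_sigma:
  "F t = sigma (space N) ({W i -` B \<inter> space N | i B. i \<in> {0..t} \<and> B \<in> sets borel} \<union> null_sets N)"
  by (simp add: brownian_filtration_def)

lemma increment_moments:
  assumes "0 \<le> s" "s < t" "t \<le> 1"
  shows "integrable N (\<lambda>\<omega>. W t \<omega> - W s \<omega>)" "(\<integral>\<omega>. W t \<omega> - W s \<omega> \<partial>N) = 0"
    "integrable N (\<lambda>\<omega>. (W t \<omega> - W s \<omega>)\<^sup>2)" "(\<integral>\<omega>. (W t \<omega> - W s \<omega>)\<^sup>2 \<partial>N) = t - s"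
    "integrable N (\<lambda>\<omega>. (W t \<omega> - W s \<omega>) ^ 4)" "(\<integral>\<omega>. (W t \<omega> - W s \<omega>) ^ 4 \<partial>N) = 3 * (t - s)\<^sup>2"
  using N.centred_normal_moments[OF increment_normal_N[OF assms]] assms by simp_all

lemma increment_trig:
  assumes "0 \<le> s" "s < t" "t \<le> 1"
  shows "(\<integral>\<omega>. cos (c * (W t \<omega> - W s \<omega>)) \<partial>N) = exp (- (c\<^sup>2 * (t - s) / 2))"
    "(\<integral>\<omega>. sin (c * (W t \<omega> - W s \<omega>)) \<partial>N) = 0"
  using N.expectation_trig_centred_normal[OF increment_normal_N[OF assms]] assms by simp_all

lemma sq_integrable_increment:
  assumes "0 \<le> s" "s \<le> t" "t \<le> 1"
  shows "sq_integrable N (\<lambda>\<omega>. W t \<omega> - W s \<omega>)"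
proof (cases "s = t")
  case False
  with assms show ?thesis
    using increment_moments(3)[of s t] W_measurable_N[of s] W_measurable_N[of t]
    by (auto simp: sq_integrable_def)
qed (simp add: sq_integrable_zero)

lemma lincomb_W_increments:
  assumes J: "finite J" "J \<subseteq> {0..s}" and s: "0 \<le> s"
  obtains n t \<mu> where "t 0 = 0" "t n = s" "\<And>i. i < n \<Longrightarrow> t i < t (Suc i)"
    "AE \<omega> in M. (\<Sum>u\<in>J. c u * W u \<omega>) = (\<Sum>j<n::nat. \<mu> j * (W (t (Suc j)) \<omega> - W (t j) \<omega>))"
proof -
  obtain n t where t: "t 0 = 0" "t n = s" "\<And>i. i < n \<Longrightarrow> t i < t (Suc i)" "J \<subseteq> t ` {..n::nat}"
    using time_grid[OF J s] by metis
  then have "(\<lambda>u. u) ` J \<subseteq> t ` {..n}" by simp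
  then obtain \<mu> where \<mu>: "\<And>w :: real \<Rightarrow> real.
    (\<Sum>u\<in>J. c u * (w u - w (t 0))) = (\<Sum>j<n. \<mu> j * (w (t (Suc j)) - w (t j)))"
    by (rule lincomb_increments[OF J(1), where c=c]) (rule that)
  have "AE \<omega> in M. (\<Sum>u\<in>J. c u * W u \<omega>) = (\<Sum>j<n. \<mu> j * (W (t (Suc j)) \<omega> - W (t j) \<omega>))"
    using W_0
  proof eventually_elim
    case (elim \<omega>)
    then show ?case using \<mu>[of "\<lambda>u. W u \<omega>"] by (simp add: t(1))
  qed
  with t show thesis by (intro that[of t n \<mu>]) auto
qed

text \<open>Let \<open>k\<close> be the centred indicator of the event about the increment. The
  functions orthogonal to \<open>k\<close> form a closed subspace. Independence of finitely many
  increments puts the trigonometric functions of finitely many past values into it, and hence every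
  indicator of the augmented past.\<close>

lemma prob_past_increment:
  assumes st: "0 \<le> s" "s < t" "t \<le> 1" and A: "A \<in> sets (F s)" and B: "B \<in> sets borel"
  shows "N.prob (A \<inter> ((\<lambda>\<omega>. W t \<omega> - W s \<omega>) -` B \<inter> space N)) =
    N.prob A * N.prob ((\<lambda>\<omega>. W t \<omega> - W s \<omega>) -` B \<inter> space N)"
proof -
  let ?\<Delta> = "\<lambda>\<omega>. W t \<omega> - W s \<omega>"
  have \<Delta>[measurable]: "?\<Delta> \<in> borel_measurable M"
    using W_measurable[of s] W_measurable[of t] st by auto
  have \<Delta>N[measurable]: "?\<Delta> \<in> borel_measurable N" by (intro measurable_completion \<Delta>)
  note B[measurable]
  define p :: real where "p = expectation (\<lambda>\<omega>. indicator B (?\<Delta> \<omega>))"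
  define k :: "'a \<Rightarrow> real" where "k \<omega> = indicator B (?\<Delta> \<omega>) - p" for \<omega>
  have k[measurable]: "k \<in> borel_measurable M" unfolding k_def[abs_def] by measurable
  have kN: "k \<in> borel_measurable N" by (intro measurable_completion k)
  have k_bound: "\<bar>k \<omega>\<bar> \<le> 1 + \<bar>p\<bar>" for \<omega>
    by (auto simp: k_def indicator_def)
  have sq_k: "sq_integrable N k"
    by (rule N.sq_integrable_bounded[OF kN k_bound])
  have Ek: "expectation k = 0"
  proof -
    have "integrable M (\<lambda>\<omega>. indicator B (?\<Delta> \<omega>) :: real)"
      by (rule integrable_const_bound[of _ 1]) auto
    then show ?thesis by (simp add: k_def[abs_def] p_def prob_space)
  qed
  \<comment> \<open>The sequence is constant in \<open>n\<close>, so this is the orthogonal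
    complement of \<open>k\<close>.\<close>
  define S where "S = {T. sq_integrable N T \<and> (\<lambda>n::nat. \<integral>\<omega>. k \<omega> * T \<omega> \<partial>N) \<longlonglongrightarrow> 0}"
  have trig: "(\<lambda>\<omega>. h (\<Sum>u\<in>J. c u * W u \<omega>)) \<in> S"
    if J: "finite J" "J \<subseteq> {0..s}" and h[measurable]: "h \<in> borel_measurable borel" and h1: "\<And>x. \<bar>h x\<bar> \<le> 1"
    for h :: "real \<Rightarrow> real" and J c
  proof -
    obtain n \<tau> \<mu> where \<tau>: "\<tau> 0 = 0" "\<tau> n = s" "\<And>i. i < n \<Longrightarrow> \<tau> i < \<tau> (Suc i)"
      and eq: "AE \<omega> in M. (\<Sum>u\<in>J. c u * W u \<omega>) = (\<Sum>j<n::nat. \<mu> j * (W (\<tau> (Suc j)) \<omega> - W (\<tau> j) \<omega>))"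
      by (rule lincomb_W_increments[OF J st(1), where c=c]) (rule that)
    have Jmeas: "(\<lambda>\<omega>. \<Sum>u\<in>J. c u * W u \<omega>) \<in> borel_measurable M"
      using W_measurable J st by (intro borel_measurable_sum borel_measurable_times) auto
    \<comment> \<open>Prolonging the partition of \<open>{0..s}\<close> by the point
      \<open>t\<close> makes \<open>W t - W s\<close> the increment of index \<open>n\<close>,
      independent of the others; it gets coefficient 1 below.\<close>
    define \<tau>' where "\<tau>' = \<tau>(Suc n := t)"
    have "indep_vars (\<lambda>_. borel) (\<lambda>i \<omega>. W (\<tau>' (Suc i)) \<omega> - W (\<tau>' i) \<omega>) {..<Suc n}"
      using \<tau> st by (intro indep_increments) (auto simp: \<tau>'_def less_Suc_eq)
    from indep_vars_compose2[OF this, of "\<lambda>i x. (if i < n then \<mu> i else 1) * x" "\<lambda>_. borel"]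
    have "indep_vars (\<lambda>_. borel) (\<lambda>i \<omega>. (if i < n then \<mu> i else 1) * (W (\<tau>' (Suc i)) \<omega> - W (\<tau>' i) \<omega>)) (insert n {..<n})"
      by (simp add: lessThan_Suc)
    from indep_vars_sum[OF _ _ this]
    have "indep_var borel ?\<Delta> borel (\<lambda>\<omega>. \<Sum>j<n. (if j < n then \<mu> j else 1) * (W (\<tau>' (Suc j)) \<omega> - W (\<tau>' j) \<omega>))"
      using \<tau> by (simp add: \<tau>'_def)
    also have "(\<lambda>\<omega>. \<Sum>j<n. (if j < n then \<mu> j else 1) * (W (\<tau>' (Suc j)) \<omega> - W (\<tau>' j) \<omega>)) =
      (\<lambda>\<omega>. \<Sum>j<n. \<mu> j * (W (\<tau> (Suc j)) \<omega> - W (\<tau> j) \<omega>))" (is "_ = ?G")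
      by (intro ext sum.cong) (auto simp: \<tau>'_def)
    finally have ind: "indep_var borel ?\<Delta> borel ?G" .
    then have G[measurable]: "?G \<in> borel_measurable M" by (rule indep_var_rv2)
    have "indep_var borel ((\<lambda>x. indicator B x - p) \<circ> ?\<Delta>) borel (h \<circ> ?G)"
      by (rule indep_var_compose[OF ind]) auto
    then have "indep_var borel k borel (\<lambda>\<omega>. h (?G \<omega>))"
      by (simp add: comp_def k_def[abs_def])
    then have "expectation (\<lambda>\<omega>. k \<omega> * h (?G \<omega>)) = expectation k * expectation (\<lambda>\<omega>. h (?G \<omega>))"
    proof (rule indep_var_lebesgue_integral)
      show "integrable M k"
        by (rule integrable_const_bound[of _ "1 + \<bar>p\<bar>"]) (use k_bound in auto)
      show "integrable M (\<lambda>\<omega>. h (?G \<omega>))"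
        by (rule integrable_const_bound[of _ 1]) (use h1 in auto)
    qed
    then have "expectation (\<lambda>\<omega>. k \<omega> * h (?G \<omega>)) = 0" by (simp add: Ek)
    moreover have "expectation (\<lambda>\<omega>. k \<omega> * h (\<Sum>u\<in>J. c u * W u \<omega>)) = expectation (\<lambda>\<omega>. k \<omega> * h (?G \<omega>))"
      using eq Jmeas by (intro integral_cong_AE) auto
    moreover have "(\<integral>\<omega>. k \<omega> * h (\<Sum>u\<in>J. c u * W u \<omega>) \<partial>N) = expectation (\<lambda>\<omega>. k \<omega> * h (\<Sum>u\<in>J. c u * W u \<omega>))"
      using Jmeas by (intro integral_completion) auto
    moreover have "sq_integrable N (\<lambda>\<omega>. h (\<Sum>u\<in>J. c u * W u \<omega>))"
      using h1 measurable_completion[OF Jmeas] by (intro N.sq_integrable_bounded[of _ 1]) auto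
    ultimately show ?thesis by (simp add: S_def)
  qed
  interpret T: trigonometric_subspace N S "{0..s}" W
  proof unfold_locales
    show "closed_L2_subspace N S"
      unfolding S_def by (rule closed_L2_subspace_weakly_null[OF sq_k order_refl])
  qed (use trig st in \<open>auto intro!: W_measurable_N\<close>)
  have "indicator A \<in> S"
    using A unfolding F_eq_augmented_sigma by (rule T.indicator_mem)
  then have 0: "(\<integral>\<omega>. k \<omega> * indicator A \<omega> \<partial>N) = 0"
    by (simp add: S_def LIMSEQ_const_iff)
  have AN: "A \<in> sets N" using A subalgebra_F[of s] st by (auto simp: subalgebra_def)
  have BN: "?\<Delta> -` B \<inter> space N \<in> sets N" by measurable
  have "(\<integral>\<omega>. k \<omega> * indicator A \<omega> \<partial>N) =
    (\<integral>\<omega>. indicator (A \<inter> (?\<Delta> -` B \<inter> space N)) \<omega> - p * indicator A \<omega> \<partial>N)"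
    by (intro Bochner_Integration.integral_cong) (auto simp: k_def indicator_def)
  also have "\<dots> = N.prob (A \<inter> (?\<Delta> -` B \<inter> space N)) - p * N.prob A"
  proof -
    have "integrable N (indicat_real C)" "(\<integral>\<omega>. indicator C \<omega> \<partial>N) = N.prob C"
      if "C \<in> sets N" for C
    proof -
      show "integrable N (indicat_real C)"
        by (rule N.integrable_const_bound[of _ 1]) (use that in \<open>auto simp: indicator_def\<close>)
      show "(\<integral>\<omega>. indicator C \<omega> \<partial>N) = N.prob C"
        using sets.sets_into_space[OF that] by (simp add: Int_absorb2)
    qed
    note this[OF AN] this[OF sets.Int[OF AN BN]]
    then show ?thesis
      by (simp only: Bochner_Integration.integral_diff integrable_mult_right integral_mult_right_zero)
  qed
  finally have 1: "N.prob (A \<inter> (?\<Delta> -` B \<inter> space N)) = p * N.prob A" using 0 by simp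
  have "p = (\<integral>\<omega>. indicator B (?\<Delta> \<omega>) \<partial>N)"
    unfolding p_def by (intro integral_completion[symmetric]) measurable
  also have "\<dots> = (\<integral>\<omega>. indicator (?\<Delta> -` B \<inter> space N) \<omega> \<partial>N)"
    by (intro Bochner_Integration.integral_cong) (auto simp: indicator_def)
  also have "\<dots> = N.prob (?\<Delta> -` B \<inter> space N)" using BN by simp
  finally show ?thesis using 1 by simp
qed

lemma indep_past_increment:
  assumes st: "0 \<le> s" "s < t" "t \<le> 1" and Z: "Z \<in> borel_measurable (F s)"
  shows "N.indep_var borel Z borel (\<lambda>\<omega>. W t \<omega> - W s \<omega>)"
proof (rule N.indep_varI_measure)
  show "N.random_variable borel Z" using Z st by (intro measurable_F_N[of s]) auto
  show "N.random_variable borel (\<lambda>\<omega>. W t \<omega> - W s \<omega>)"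
    using W_measurable_N[of s] W_measurable_N[of t] st by auto
  fix A B :: "real set" assume "A \<in> sets borel" "B \<in> sets borel"
  then show "N.prob ((Z -` A \<inter> space N) \<inter> ((\<lambda>\<omega>. W t \<omega> - W s \<omega>) -` B \<inter> space N)) =
    N.prob (Z -` A \<inter> space N) * N.prob ((\<lambda>\<omega>. W t \<omega> - W s \<omega>) -` B \<inter> space N)"
    using measurable_sets[OF Z, of A] by (intro prob_past_increment st) (auto simp: space_F)
qed

lemma integral_past_increment:
  assumes st: "0 \<le> s" "s < t" "t \<le> 1" and Z: "Z \<in> borel_measurable (F s)" "integrable N Z"
    and g: "g \<in> borel_measurable borel" "integrable N (\<lambda>\<omega>. g (W t \<omega> - W s \<omega>))"
  shows "(\<integral>\<omega>. Z \<omega> * g (W t \<omega> - W s \<omega>) \<partial>N) = (\<integral>\<omega>. Z \<omega> \<partial>N) * (\<integral>\<omega>. g (W t \<omega> - W s \<omega>) \<partial>N)"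
    and "integrable N (\<lambda>\<omega>. Z \<omega> * g (W t \<omega> - W s \<omega>) :: real)"
proof -
  have "N.indep_var borel ((\<lambda>x. x) \<circ> Z) borel (g \<circ> (\<lambda>\<omega>. W t \<omega> - W s \<omega>))"
    by (rule N.indep_var_compose[OF indep_past_increment[OF st Z(1)]]) (use g in auto)
  then have ind: "N.indep_var borel Z borel (\<lambda>\<omega>. g (W t \<omega> - W s \<omega>))" by (simp add: comp_def)
  show "(\<integral>\<omega>. Z \<omega> * g (W t \<omega> - W s \<omega>) \<partial>N) = (\<integral>\<omega>. Z \<omega> \<partial>N) * (\<integral>\<omega>. g (W t \<omega> - W s \<omega>) \<partial>N)"
    by (rule N.indep_var_lebesgue_integral[OF ind Z(2) g(2)])
  show "integrable N (\<lambda>\<omega>. Z \<omega> * g (W t \<omega> - W s \<omega>))"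
    by (rule N.indep_var_integrable[OF ind Z(2) g(2)])
qed

end

section \<open>Totality of the elementary integrals\<close>

text \<open>Write \<open>exp \<alpha> * cos x - 1\<close> as
  \<open>exp \<alpha> * (cos x - 1) + (exp \<alpha> - 1)\<close>, and the sine term likewise with
  \<open>x\<close> in place of 1. Taylor bounds the trigonometric errors by
  \<open>x\<^sup>2 / 2\<close>, and \<open>exp \<alpha> - 1 \<le> \<alpha> * exp \<alpha>\<close>.
  Squaring a sum of two terms costs a factor 2.\<close>

lemma trig_remainder_bound:
  fixes x :: real
  assumes \<alpha>: "0 \<le> \<alpha>"
  shows "(exp \<alpha> * cos x - 1)\<^sup>2 + (exp \<alpha> * sin x - x)\<^sup>2 \<le> exp (2 * \<alpha>) * (x ^ 4 + 2 * \<alpha>\<^sup>2 * (1 + x\<^sup>2))"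
proof -
  have "cmod (iexp x - (\<Sum>k\<le>1. (\<i> * x) ^ k / fact k)) \<le> \<bar>x\<bar> ^ Suc 1 / fact (Suc 1)"
    by (rule iexp_approx1)
  then have approx: "cmod (iexp x - (1 + \<i> * x)) \<le> x\<^sup>2 / 2" by (simp add: power2_eq_square)
  have "\<bar>Re (iexp x - (1 + \<i> * x))\<bar> \<le> x\<^sup>2 / 2" "\<bar>Im (iexp x - (1 + \<i> * x))\<bar> \<le> x\<^sup>2 / 2"
    using order_trans[OF abs_Re_le_cmod approx] order_trans[OF abs_Im_le_cmod approx] by auto
  then have trig: "\<bar>cos x - 1\<bar> \<le> x\<^sup>2 / 2" "\<bar>sin x - x\<bar> \<le> x\<^sup>2 / 2"
    by (simp_all add: Re_exp Im_exp)
  \<comment> \<open>The second inequality is \<open>1 - \<alpha> \<le> exp (- \<alpha>)\<close>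
    multiplied by \<open>exp \<alpha>\<close>.\<close>
  have e: "0 \<le> exp \<alpha> - 1" "exp \<alpha> - 1 \<le> \<alpha> * exp \<alpha>"
    using \<alpha> exp_ge_add_one_self[of "- \<alpha>"] mult_left_mono[OF exp_ge_add_one_self[of "- \<alpha>"], of "exp \<alpha>"]
    by (auto simp: algebra_simps simp flip: exp_add)
  have sq: "(exp \<alpha> * u + v)\<^sup>2 \<le> exp (2 * \<alpha>) * (x ^ 4 / 2 + 2 * \<alpha>\<^sup>2 * w\<^sup>2)"
    if u: "\<bar>u\<bar> \<le> x\<^sup>2 / 2" and v: "v = (exp \<alpha> - 1) * w" for u v w
  proof -
    have "(exp \<alpha> * u + v)\<^sup>2 \<le> 2 * (exp \<alpha> * u)\<^sup>2 + 2 * v\<^sup>2"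
      using sum_squares_bound[of "exp \<alpha> * u" v] by (simp add: power2_sum)
    moreover have "(exp \<alpha> * u)\<^sup>2 \<le> exp (2 * \<alpha>) * (x ^ 4 / 4)"
    proof -
      have "u\<^sup>2 \<le> (x\<^sup>2 / 2)\<^sup>2" using u by (simp add: abs_le_square_iff[symmetric])
      then show ?thesis by (simp add: power_mult_distrib exp_double power_divide flip: power_mult)
    qed
    moreover have "v\<^sup>2 \<le> exp (2 * \<alpha>) * (\<alpha>\<^sup>2 * w\<^sup>2)"
    proof -
      have "(exp \<alpha> - 1)\<^sup>2 \<le> (\<alpha> * exp \<alpha>)\<^sup>2" using e by (intro power_mono) auto
      then have "(exp \<alpha> - 1)\<^sup>2 * w\<^sup>2 \<le> (\<alpha> * exp \<alpha>)\<^sup>2 * w\<^sup>2" by (rule mult_right_mono) simp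
      then show ?thesis unfolding v exp_double power_mult_distrib by (simp only: mult_ac)
    qed
    ultimately show ?thesis by (simp add: algebra_simps)
  qed
  have "(exp \<alpha> * cos x - 1)\<^sup>2 \<le> exp (2 * \<alpha>) * (x ^ 4 / 2 + 2 * \<alpha>\<^sup>2 * 1\<^sup>2)"
    using sq[OF trig(1) refl, of 1] by (simp add: algebra_simps)
  moreover have "(exp \<alpha> * sin x - x)\<^sup>2 \<le> exp (2 * \<alpha>) * (x ^ 4 / 2 + 2 * \<alpha>\<^sup>2 * x\<^sup>2)"
    using sq[OF trig(2) refl, of x] by (simp add: algebra_simps)
  ultimately show ?thesis by (simp add: algebra_simps)
qed

context brownian
begin

text \<open>Obtained from \<open>trig_remainder_bound\<close> at \<open>x = c * D\<close> with
  \<open>\<alpha> = c\<^sup>2 * (t - s) / 2\<close>: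
  \<open>exp (2 * \<alpha>) \<le> exp (c\<^sup>2)\<close>, the fourth moment contributes
  \<open>3 * c ^ 4\<close>, and \<open>2 * \<alpha>\<^sup>2\<close> contributes
  \<open>c ^ 4 / 2\<close>, each times \<open>(t - s)\<^sup>2\<close>.\<close>

definition remainder_const :: "real \<Rightarrow> real" where
  "remainder_const c = exp (c\<^sup>2) * (3 * c ^ 4 + c ^ 4 / 2 * (1 + c\<^sup>2))"

text \<open>The exponential factor is the reciprocal of the expectation of the cosine, so
  \<open>a\<close> is centred; \<open>b\<close> is centred by symmetry. Both are of second order in
  the increment, which makes their second moments of order \<open>(t - s)\<^sup>2\<close>.\<close>

lemma increment_trig_remainder:
  fixes c :: real
  assumes st: "0 \<le> s" "s < t" "t \<le> 1"
  defines "a \<equiv> \<lambda>x. exp (c\<^sup>2 * (t - s) / 2) * cos (c * x) - 1"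
    and "b \<equiv> \<lambda>x. exp (c\<^sup>2 * (t - s) / 2) * sin (c * x) - c * x"
  shows "sq_integrable N (\<lambda>\<omega>. a (W t \<omega> - W s \<omega>))" and "sq_integrable N (\<lambda>\<omega>. b (W t \<omega> - W s \<omega>))"
    and "(\<integral>\<omega>. a (W t \<omega> - W s \<omega>) \<partial>N) = 0" and "(\<integral>\<omega>. b (W t \<omega> - W s \<omega>) \<partial>N) = 0"
    and "(\<integral>\<omega>. (a (W t \<omega> - W s \<omega>))\<^sup>2 + (b (W t \<omega> - W s \<omega>))\<^sup>2 \<partial>N) \<le> remainder_const c * (t - s)\<^sup>2"
proof -
  define \<alpha> where "\<alpha> = c\<^sup>2 * (t - s) / 2"
  define D where "D \<omega> = W t \<omega> - W s \<omega>" for \<omega>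
  have D[measurable]: "D \<in> borel_measurable N"
    unfolding D_def[abs_def] using W_measurable_N[of s] W_measurable_N[of t] st by auto
  note mom = increment_moments[OF st, folded D_def]
  note trig = increment_trig[OF st, folded D_def]
  have sqD: "sq_integrable N D" using sq_integrable_increment[of s t] st by (simp add: D_def[abs_def])
  have sqc: "sq_integrable N (\<lambda>\<omega>. cos (c * D \<omega>))" "sq_integrable N (\<lambda>\<omega>. sin (c * D \<omega>))"
    by (auto intro!: N.sq_integrable_bounded[of _ 1])
  show sq: "sq_integrable N (\<lambda>\<omega>. a (W t \<omega> - W s \<omega>))" "sq_integrable N (\<lambda>\<omega>. b (W t \<omega> - W s \<omega>))"
    unfolding a_def b_def D_def[symmetric]
    by (intro sq_integrable_diff sq_integrable_cmult sqc sqD N.sq_integrable_const)+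
  note intc = N.sq_integrable_integrable[OF sqc(1)] N.sq_integrable_integrable[OF sqc(2)]
  show "(\<integral>\<omega>. a (W t \<omega> - W s \<omega>) \<partial>N) = 0"
    unfolding a_def D_def[symmetric] using intc trig N.prob_space
    by (simp add: exp_minus)
  show "(\<integral>\<omega>. b (W t \<omega> - W s \<omega>) \<partial>N) = 0"
    unfolding b_def D_def[symmetric] using intc trig mom by simp
  have "(\<integral>\<omega>. (a (W t \<omega> - W s \<omega>))\<^sup>2 + (b (W t \<omega> - W s \<omega>))\<^sup>2 \<partial>N) \<le>
    (\<integral>\<omega>. exp (2 * \<alpha>) * (c ^ 4 * D \<omega> ^ 4 + 2 * \<alpha>\<^sup>2 * (1 + c\<^sup>2 * (D \<omega>)\<^sup>2)) \<partial>N)"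
  proof (rule integral_mono)
    show "integrable N (\<lambda>\<omega>. (a (W t \<omega> - W s \<omega>))\<^sup>2 + (b (W t \<omega> - W s \<omega>))\<^sup>2)"
      using sq by (auto simp: sq_integrable_def)
    show "integrable N (\<lambda>\<omega>. exp (2 * \<alpha>) * (c ^ 4 * D \<omega> ^ 4 + 2 * \<alpha>\<^sup>2 * (1 + c\<^sup>2 * (D \<omega>)\<^sup>2)))"
      using mom by simp
    show "(a (W t \<omega> - W s \<omega>))\<^sup>2 + (b (W t \<omega> - W s \<omega>))\<^sup>2 \<le>
      exp (2 * \<alpha>) * (c ^ 4 * D \<omega> ^ 4 + 2 * \<alpha>\<^sup>2 * (1 + c\<^sup>2 * (D \<omega>)\<^sup>2))" for \<omega>
      using trig_remainder_bound[of \<alpha> "c * D \<omega>"] st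
      by (simp add: a_def b_def D_def \<alpha>_def power_mult_distrib)
  qed
  also have "\<dots> = exp (2 * \<alpha>) * (c ^ 4 * (3 * (t - s)\<^sup>2) + 2 * \<alpha>\<^sup>2 * (1 + c\<^sup>2 * (t - s)))"
    using mom N.prob_space by simp
  also have "\<dots> = exp (2 * \<alpha>) * (3 * c ^ 4 + c ^ 4 / 2 * (1 + c\<^sup>2 * (t - s))) * (t - s)\<^sup>2"
    by (simp add: \<alpha>_def power2_eq_square field_simps eval_nat_numeral)
  also have "\<dots> \<le> remainder_const c * (t - s)\<^sup>2"
    unfolding remainder_const_def using st
    by (intro mult_right_mono mult_mono add_left_mono mult_left_mono)
       (auto simp: \<alpha>_def mult_left_le intro!: add_nonneg_nonneg mult_nonneg_nonneg)
  finally show "(\<integral>\<omega>. (a (W t \<omega> - W s \<omega>))\<^sup>2 + (b (W t \<omega> - W s \<omega>))\<^sup>2 \<partial>N) \<le> remainder_const c * (t - s)\<^sup>2" .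
qed

end

text \<open>Abstracts from the residuals of the greedy algorithm: totality is proved for an
  arbitrary closed subspace containing the constants and the one-step integrals with indicator
  coefficients.\<close>

locale integral_subspace = brownian M W + L2_subspace "completion M" S
  for M :: "'a measure" and W S +
  assumes one_mem: "(\<lambda>\<omega>. 1) \<in> S"
    and increment_mem: "0 \<le> s \<Longrightarrow> s < t \<Longrightarrow> t \<le> 1 \<Longrightarrow> A \<in> sets (F s) \<Longrightarrow>
      (\<lambda>\<omega>. indicator A \<omega> * (W t \<omega> - W s \<omega>)) \<in> S"
begin

lemma bounded_increment_mem:
  assumes st: "0 \<le> s" "s < t" "t \<le> 1" and Z: "Z \<in> borel_measurable (F s)"
    and K: "\<And>\<omega>. \<omega> \<in> space M \<Longrightarrow> \<bar>Z \<omega>\<bar> \<le> K"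
  shows "(\<lambda>\<omega>. Z \<omega> * (W t \<omega> - W s \<omega>)) \<in> S"
proof (rule indicators_imp_measurable[OF subalgebra_F[of s] _ increment_mem[OF st] Z])
  have "Z \<in> borel_measurable N" using Z st by (intro measurable_F_N[of s]) auto
  then show "sq_integrable N (\<lambda>\<omega>. Z \<omega> * (W t \<omega> - W s \<omega>))"
    using st K by (intro sq_integrable_bounded_mult[of _ _ _ K] sq_integrable_increment) auto
qed (use st W_measurable_N[of s] W_measurable_N[of t] in auto)

text \<open>
  With \<open>U i = exp (c\<^sup>2 * (\<tau> i - s) / 2) * cos (c * (W (\<tau> i) - W s) + \<theta>)\<close> and \<open>U'\<close> the
  same with the sine, each step of \<open>U\<close> along a partition is \<open>- U' i * c * (W (\<tau> (Suc i)) - W (\<tau> i))\<close>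
  plus a remainder with conditional mean zero and second moment of order \<open>\<delta>\<^sup>2\<close>. These
  remainders are orthogonal, so their sum \<open>E m\<close> over \<open>m\<close> steps has squared norm of order \<open>1 / m\<close>.
\<close>

lemma trig_increment_approx:
  fixes c \<theta> :: real
  assumes st: "0 \<le> s" "s < t" "t \<le> 1" and V: "V \<in> borel_measurable (F s)"
    and K: "\<And>\<omega>. \<omega> \<in> space M \<Longrightarrow> \<bar>V \<omega>\<bar> \<le> K" and m: "0 < m"
  shows "\<exists>Z\<in>S. sq_integrable N Z \<and>
    (\<integral>\<omega>. (Z \<omega> - V \<omega> * (exp (c\<^sup>2 * (t - s) / 2) * cos (c * (W t \<omega> - W s \<omega>) + \<theta>) - cos \<theta>))\<^sup>2 \<partial>N)
      \<le> 2 * K\<^sup>2 * exp (c\<^sup>2) * remainder_const c / real m"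
proof -
  define \<delta> where "\<delta> = (t - s) / real m"
  define \<tau> where "\<tau> i = s + real i * \<delta>" for i :: nat
  have \<delta>: "0 < \<delta>" using st m by (simp add: \<delta>_def)
  have \<tau>_0: "\<tau> 0 = s" and \<tau>_m: "\<tau> m = t" using m by (simp_all add: \<tau>_def \<delta>_def)
  have \<tau>_Suc: "\<tau> (Suc i) = \<tau> i + \<delta>" for i by (simp add: \<tau>_def algebra_simps)
  have \<tau>_le: "\<tau> i \<le> \<tau> j" if "i \<le> j" for i j
    using that \<delta> by (simp add: \<tau>_def)
  have \<tau>_range: "0 \<le> \<tau> i" "s \<le> \<tau> i" "\<tau> i \<le> 1" if "i \<le> m" for i
    using \<tau>_le[of 0 i] \<tau>_le[of i m] that st by (auto simp: \<tau>_0 \<tau>_m)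
  have step: "0 \<le> \<tau> i" "\<tau> i < \<tau> (Suc i)" "\<tau> (Suc i) \<le> 1" if "i < m" for i
    using \<tau>_range[of i] \<tau>_range[of "Suc i"] that \<delta> by (auto simp: \<tau>_Suc)
  define D where "D i \<omega> = W (\<tau> (Suc i)) \<omega> - W (\<tau> i) \<omega>" for i \<omega>
  define U where "U i \<omega> = exp (c\<^sup>2 * (\<tau> i - s) / 2) * cos (c * (W (\<tau> i) \<omega> - W s \<omega>) + \<theta>)" for i \<omega>
  define U' where "U' i \<omega> = exp (c\<^sup>2 * (\<tau> i - s) / 2) * sin (c * (W (\<tau> i) \<omega> - W s \<omega>) + \<theta>)" for i \<omega>
  define a where "a x = exp (c\<^sup>2 * \<delta> / 2) * cos (c * x) - 1" for x
  define b where "b x = exp (c\<^sup>2 * \<delta> / 2) * sin (c * x) - c * x" for x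
  have [measurable]: "a \<in> borel_measurable borel" "b \<in> borel_measurable borel"
    unfolding a_def[abs_def] b_def[abs_def] by auto
  have rem: "sq_integrable N (\<lambda>\<omega>. a (D i \<omega>))" "sq_integrable N (\<lambda>\<omega>. b (D i \<omega>))"
    "(\<integral>\<omega>. a (D i \<omega>) \<partial>N) = 0" "(\<integral>\<omega>. b (D i \<omega>) \<partial>N) = 0"
    "(\<integral>\<omega>. (a (D i \<omega>))\<^sup>2 + (b (D i \<omega>))\<^sup>2 \<partial>N) \<le> remainder_const c * \<delta>\<^sup>2" if "i < m" for i
  proof -
    have "\<tau> (Suc i) - \<tau> i = \<delta>" by (simp add: \<tau>_Suc)
    then show "sq_integrable N (\<lambda>\<omega>. a (D i \<omega>))" "sq_integrable N (\<lambda>\<omega>. b (D i \<omega>))"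
      "(\<integral>\<omega>. a (D i \<omega>) \<partial>N) = 0" "(\<integral>\<omega>. b (D i \<omega>) \<partial>N) = 0"
      "(\<integral>\<omega>. (a (D i \<omega>))\<^sup>2 + (b (D i \<omega>))\<^sup>2 \<partial>N) \<le> remainder_const c * \<delta>\<^sup>2"
      using increment_trig_remainder[OF step[OF that], of c] unfolding a_def b_def D_def by simp_all
  qed
  have U_Suc: "U (Suc i) \<omega> = U i \<omega> * (a (D i \<omega>) + 1) - U' i \<omega> * (b (D i \<omega>) + c * D i \<omega>)" for i \<omega>
  proof -
    have 1: "c\<^sup>2 * (\<tau> (Suc i) - s) / 2 = c\<^sup>2 * (\<tau> i - s) / 2 + c\<^sup>2 * \<delta> / 2"
      by (simp add: \<tau>_Suc field_simps)
    have 2: "c * (W (\<tau> (Suc i)) \<omega> - W s \<omega>) + \<theta> = (c * (W (\<tau> i) \<omega> - W s \<omega>) + \<theta>) + c * D i \<omega>"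
      by (simp add: D_def algebra_simps)
    have "exp (x + y) * cos (p + q) =
      exp x * cos p * (exp y * cos q - 1 + 1) - exp x * sin p * (exp y * sin q - q + q)" for x y p q :: real
      by (simp add: exp_add cos_add algebra_simps)
    then show ?thesis unfolding U_def U'_def a_def b_def 1 2 .
  qed
  have U_bound: "\<bar>U i \<omega>\<bar> \<le> exp (c\<^sup>2 / 2)" "\<bar>U' i \<omega>\<bar> \<le> exp (c\<^sup>2 / 2)" if "i \<le> m" for i \<omega>
  proof -
    have "c\<^sup>2 * (\<tau> i - s) \<le> c\<^sup>2 * 1" using \<tau>_range[OF that] st by (intro mult_left_mono) auto
    then have "exp (c\<^sup>2 * (\<tau> i - s) / 2) \<le> exp (c\<^sup>2 / 2)" by simp
    then have h: "exp (c\<^sup>2 * (\<tau> i - s) / 2) * \<bar>h\<bar> \<le> exp (c\<^sup>2 / 2)" if "\<bar>h\<bar> \<le> 1" for h :: real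
      using mult_mono[OF _ that, of _ "exp (c\<^sup>2 / 2)"] by auto
    show "\<bar>U i \<omega>\<bar> \<le> exp (c\<^sup>2 / 2)" "\<bar>U' i \<omega>\<bar> \<le> exp (c\<^sup>2 / 2)"
      unfolding U_def U'_def abs_mult abs_exp_cancel by (rule h, simp)+
  qed
  have U_meas: "U i \<in> borel_measurable (F (\<tau> i))" "U' i \<in> borel_measurable (F (\<tau> i))"
    and V_meas: "V \<in> borel_measurable (F (\<tau> i))" if "i \<le> m" for i
  proof -
    have [measurable]: "W (\<tau> i) \<in> borel_measurable (F (\<tau> i))" "W s \<in> borel_measurable (F (\<tau> i))"
      using \<tau>_range[OF that] st by (auto intro!: W_adapted)
    show "U i \<in> borel_measurable (F (\<tau> i))" "U' i \<in> borel_measurable (F (\<tau> i))"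
      unfolding U_def[abs_def] U'_def[abs_def] by measurable
    show "V \<in> borel_measurable (F (\<tau> i))"
      by (rule measurable_F_mono[OF \<tau>_range(2)[OF that] V])
  qed
  have K0: "0 \<le> K"
  proof -
    obtain \<omega> where "\<omega> \<in> space M" using not_empty by blast
    then show ?thesis using K[of \<omega>] by simp
  qed
  have VU_bound: "\<bar>V \<omega> * U i \<omega>\<bar> \<le> K * exp (c\<^sup>2 / 2)" "\<bar>V \<omega> * U' i \<omega>\<bar> \<le> K * exp (c\<^sup>2 / 2)"
    if "i \<le> m" "\<omega> \<in> space M" for i \<omega>
    unfolding abs_mult using K[OF that(2)] U_bound[OF that(1)] K0 by (auto intro!: mult_mono)
  \<comment> \<open>The change of \<open>V * U\<close> up to step \<open>i\<close> minus its
    discrete stochastic integral. Since \<open>U 0\<close> is the constant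
    \<open>cos \<theta>\<close>, it starts at 0.\<close>
  define E where "E i \<omega> = V \<omega> * (U i \<omega> - cos \<theta>) + (\<Sum>j<i. (c * V \<omega> * U' j \<omega>) * D j \<omega>)" for i \<omega>
  have E_Suc: "E (Suc i) \<omega> = E i \<omega> + (V \<omega> * U i \<omega> * a (D i \<omega>) - V \<omega> * U' i \<omega> * b (D i \<omega>))" for i \<omega>
    by (simp add: E_def U_Suc algebra_simps)
  have E_0: "E 0 \<omega> = 0" for \<omega> by (simp add: E_def U_def \<tau>_0)
  have D_meas: "D i \<in> borel_measurable (F (\<tau> (Suc i)))" if "i < m" for i
    unfolding D_def[abs_def] using step[OF that] \<tau>_range[of i] that
    by (auto intro!: borel_measurable_diff W_adapted)
  have E_bound: "E i \<in> borel_measurable (F (\<tau> i)) \<and> sq_integrable N (E i) \<and>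
    (\<integral>\<omega>. (E i \<omega>)\<^sup>2 \<partial>N) \<le> real i * (2 * K\<^sup>2 * exp (c\<^sup>2) * remainder_const c * \<delta>\<^sup>2)" if "i \<le> m" for i
    using that
  proof (induction i)
    case 0
    have "E 0 = (\<lambda>\<omega>. 0)" using E_0 by auto
    then show ?case by (simp add: sq_integrable_zero)
  next
    case (Suc i)
    then have i: "i < m" "i \<le> m" by auto
    from Suc i have E: "E i \<in> borel_measurable (F (\<tau> i))" "sq_integrable N (E i)"
      "(\<integral>\<omega>. (E i \<omega>)\<^sup>2 \<partial>N) \<le> real i * (2 * K\<^sup>2 * exp (c\<^sup>2) * remainder_const c * \<delta>\<^sup>2)" by auto
    define P where "P \<omega> = V \<omega> * U i \<omega>" for \<omega>
    define P' where "P' \<omega> = V \<omega> * U' i \<omega>" for \<omega>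
    have P_meas: "P \<in> borel_measurable (F (\<tau> i))" "P' \<in> borel_measurable (F (\<tau> i))"
      unfolding P_def[abs_def] P'_def[abs_def] using U_meas[OF i(2)] V_meas[OF i(2)] by auto
    then have P_N: "P \<in> borel_measurable N" "P' \<in> borel_measurable N"
      using \<tau>_range[OF i(2)] by (auto intro: measurable_F_N)
    have P_bound: "\<bar>P \<omega>\<bar> \<le> K * exp (c\<^sup>2 / 2)" "\<bar>P' \<omega>\<bar> \<le> K * exp (c\<^sup>2 / 2)" if "\<omega> \<in> space N" for \<omega>
      using VU_bound[OF i(2), of \<omega>] that by (auto simp: P_def P'_def)
    define Q where "Q \<omega> = P \<omega> * a (D i \<omega>) - P' \<omega> * b (D i \<omega>)" for \<omega>
    have sqPa: "sq_integrable N (\<lambda>\<omega>. P \<omega> * a (D i \<omega>))" "sq_integrable N (\<lambda>\<omega>. P' \<omega> * b (D i \<omega>))"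
      using P_bound by (auto intro!: sq_integrable_bounded_mult rem[OF i(1)] P_N)
    have sqQ: "sq_integrable N Q"
      unfolding Q_def[abs_def] by (intro sq_integrable_diff sqPa)
    have E_eq: "E (Suc i) = (\<lambda>\<omega>. E i \<omega> + Q \<omega>)"
      by (rule ext) (simp add: E_Suc Q_def P_def P'_def)
    have meas: "E (Suc i) \<in> borel_measurable (F (\<tau> (Suc i)))"
    proof -
      have le: "\<tau> i \<le> \<tau> (Suc i)" using step[OF i(1)] by simp
      show ?thesis
        unfolding E_eq Q_def using D_meas[OF i(1)] measurable_F_mono[OF le P_meas(1)]
          measurable_F_mono[OF le P_meas(2)] measurable_F_mono[OF le E(1)] by measurable
    qed
    \<comment> \<open>\<open>E i * R\<close> is known at time \<open>\<tau> i\<close>, whereas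
      \<open>g (D i)\<close> is centred and depends on the next increment only. This is the
      orthogonality of a new remainder to the accumulated one.\<close>
    have zero: "(\<integral>\<omega>. (E i \<omega> * R \<omega>) * g (D i \<omega>) \<partial>N) = 0" "integrable N (\<lambda>\<omega>. (E i \<omega> * R \<omega>) * g (D i \<omega>))"
      if R: "R \<in> borel_measurable (F (\<tau> i))" "\<And>\<omega>. \<omega> \<in> space N \<Longrightarrow> \<bar>R \<omega>\<bar> \<le> K * exp (c\<^sup>2 / 2)"
        and g: "g \<in> borel_measurable borel" "sq_integrable N (\<lambda>\<omega>. g (D i \<omega>))" "(\<integral>\<omega>. g (D i \<omega>) \<partial>N) = 0"
      for R :: "'a \<Rightarrow> real" and g :: "real \<Rightarrow> real"
    proof -
      have ER: "(\<lambda>\<omega>. E i \<omega> * R \<omega>) \<in> borel_measurable (F (\<tau> i))" using E(1) R(1) by measurable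
      have "sq_integrable N (\<lambda>\<omega>. R \<omega> * E i \<omega>)"
        using R(2) measurable_F_N[OF _ R(1)] \<tau>_range[OF i(2)]
        by (intro sq_integrable_bounded_mult[OF E(2)]) auto
      then have int: "integrable N (\<lambda>\<omega>. E i \<omega> * R \<omega>)"
        by (subst mult.commute) (rule N.sq_integrable_integrable)
      note * = integral_past_increment[OF step[OF i(1)] ER int g(1), folded D_def,
          OF N.sq_integrable_integrable[OF g(2)]]
      show "(\<integral>\<omega>. (E i \<omega> * R \<omega>) * g (D i \<omega>) \<partial>N) = 0" using *(1) g(3) by simp
      show "integrable N (\<lambda>\<omega>. (E i \<omega> * R \<omega>) * g (D i \<omega>))" by (rule *(2))
    qed
    note za = zero[OF P_meas(1) P_bound(1) _ rem(1)[OF i(1)] rem(3)[OF i(1)]]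
      and zb = zero[OF P_meas(2) P_bound(2) _ rem(2)[OF i(1)] rem(4)[OF i(1)]]
    have "(\<integral>\<omega>. E i \<omega> * Q \<omega> \<partial>N) = (\<integral>\<omega>. (E i \<omega> * P \<omega>) * a (D i \<omega>) - (E i \<omega> * P' \<omega>) * b (D i \<omega>) \<partial>N)"
      by (simp add: Q_def algebra_simps)
    also have "\<dots> = 0" using za zb by simp
    finally have EQ: "(\<integral>\<omega>. E i \<omega> * Q \<omega> \<partial>N) = 0" .
    have "(\<integral>\<omega>. (Q \<omega>)\<^sup>2 \<partial>N) \<le>
      (\<integral>\<omega>. 2 * K\<^sup>2 * exp (c\<^sup>2) * ((a (D i \<omega>))\<^sup>2 + (b (D i \<omega>))\<^sup>2) \<partial>N)"
    proof (rule integral_mono)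
      show "integrable N (\<lambda>\<omega>. (Q \<omega>)\<^sup>2)" using sqQ by (simp add: sq_integrable_def)
      show "integrable N (\<lambda>\<omega>. 2 * K\<^sup>2 * exp (c\<^sup>2) * ((a (D i \<omega>))\<^sup>2 + (b (D i \<omega>))\<^sup>2))"
        using rem(1,2)[OF i(1)] by (auto simp: sq_integrable_def)
      fix \<omega> assume \<omega>: "\<omega> \<in> space N"
      have ex: "(K * exp (c\<^sup>2 / 2))\<^sup>2 = K\<^sup>2 * exp (c\<^sup>2)"
        by (simp add: power_mult_distrib exp_double[symmetric])
      have "(P \<omega>)\<^sup>2 \<le> K\<^sup>2 * exp (c\<^sup>2)" "(P' \<omega>)\<^sup>2 \<le> K\<^sup>2 * exp (c\<^sup>2)"
        using power_mono[OF P_bound(1)[OF \<omega>], of 2] power_mono[OF P_bound(2)[OF \<omega>], of 2]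
        by (simp_all add: ex)
      then have "(P \<omega>)\<^sup>2 * (a (D i \<omega>))\<^sup>2 \<le> K\<^sup>2 * exp (c\<^sup>2) * (a (D i \<omega>))\<^sup>2"
        "(P' \<omega>)\<^sup>2 * (b (D i \<omega>))\<^sup>2 \<le> K\<^sup>2 * exp (c\<^sup>2) * (b (D i \<omega>))\<^sup>2"
        by (auto intro!: mult_right_mono)
      moreover have "(Q \<omega>)\<^sup>2 \<le> 2 * ((P \<omega>)\<^sup>2 * (a (D i \<omega>))\<^sup>2) + 2 * ((P' \<omega>)\<^sup>2 * (b (D i \<omega>))\<^sup>2)"
        using sum_squares_bound[of "P \<omega> * a (D i \<omega>)" "- (P' \<omega> * b (D i \<omega>))"]
        by (simp add: Q_def power2_diff power_mult_distrib)
      ultimately show "(Q \<omega>)\<^sup>2 \<le> 2 * K\<^sup>2 * exp (c\<^sup>2) * ((a (D i \<omega>))\<^sup>2 + (b (D i \<omega>))\<^sup>2)"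
        by (simp add: algebra_simps)
    qed
    also have "\<dots> \<le> 2 * K\<^sup>2 * exp (c\<^sup>2) * (remainder_const c * \<delta>\<^sup>2)"
      unfolding integral_mult_right_zero by (intro mult_left_mono rem[OF i(1)]) simp
    finally have QQ: "(\<integral>\<omega>. (Q \<omega>)\<^sup>2 \<partial>N) \<le> 2 * K\<^sup>2 * exp (c\<^sup>2) * remainder_const c * \<delta>\<^sup>2" by simp
    have "(\<integral>\<omega>. (E (Suc i) \<omega>)\<^sup>2 \<partial>N) = (\<integral>\<omega>. (E i \<omega>)\<^sup>2 \<partial>N) + (\<integral>\<omega>. (Q \<omega>)\<^sup>2 \<partial>N)"
      unfolding E_eq integral_square_add[OF E(2) sqQ] EQ by simp
    with E(3) QQ have "(\<integral>\<omega>. (E (Suc i) \<omega>)\<^sup>2 \<partial>N) \<le> real (Suc i) * (2 * K\<^sup>2 * exp (c\<^sup>2) * remainder_const c * \<delta>\<^sup>2)"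
      by (simp add: algebra_simps)
    then show ?case using meas sqQ E(2) by (auto simp: E_eq intro: sq_integrable_add)
  qed
  \<comment> \<open>The sign is chosen so that \<open>Z\<close> minus the function to be
    approximated is \<open>- E m\<close>.\<close>
  define Z where "Z \<omega> = (\<Sum>j<m. (- c * (V \<omega> * U' j \<omega>)) * D j \<omega>)" for \<omega>
  have "(\<lambda>\<omega>. (- c * (V \<omega> * U' j \<omega>)) * D j \<omega>) \<in> S" if j: "j < m" for j
    unfolding D_def
  proof (rule bounded_increment_mem[OF step[OF j]])
    show "(\<lambda>\<omega>. - c * (V \<omega> * U' j \<omega>)) \<in> borel_measurable (F (\<tau> j))"
      using U_meas(2)[of j] V_meas[of j] j by auto
    show "\<bar>- c * (V \<omega> * U' j \<omega>)\<bar> \<le> \<bar>c\<bar> * (K * exp (c\<^sup>2 / 2))" if "\<omega> \<in> space M" for \<omega>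
      using VU_bound(2)[OF _ that, of j] j unfolding abs_mult[of "- c"] abs_minus_cancel by (intro mult_left_mono) auto
  qed
  then have ZS: "Z \<in> S" unfolding Z_def[abs_def] by (intro sum) auto
  have "Z \<omega> - V \<omega> * (exp (c\<^sup>2 * (t - s) / 2) * cos (c * (W t \<omega> - W s \<omega>) + \<theta>) - cos \<theta>) = - E m \<omega>" for \<omega>
    by (simp add: Z_def E_def U_def \<tau>_m sum_negf mult.assoc)
  then have "(\<integral>\<omega>. (Z \<omega> - V \<omega> * (exp (c\<^sup>2 * (t - s) / 2) * cos (c * (W t \<omega> - W s \<omega>) + \<theta>) - cos \<theta>))\<^sup>2 \<partial>N)
    \<le> real m * (2 * K\<^sup>2 * exp (c\<^sup>2) * remainder_const c * \<delta>\<^sup>2)"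
    using E_bound[of m] by simp
  also have "\<dots> \<le> 2 * K\<^sup>2 * exp (c\<^sup>2) * remainder_const c / real m"
  proof -
    \<comment> \<open>There are \<open>m\<close> remainders of order
      \<open>\<delta>\<^sup>2\<close>, and
      \<open>m * \<delta>\<^sup>2 = (t - s)\<^sup>2 / m\<close>.\<close>
    have "real m * \<delta>\<^sup>2 \<le> 1 / real m"
    proof -
      have "(t - s)\<^sup>2 \<le> 1" using st by (intro power_le_one) auto
      then show ?thesis using m by (simp add: \<delta>_def power2_eq_square divide_simps)
    qed
    moreover have "0 \<le> 2 * K\<^sup>2 * exp (c\<^sup>2) * remainder_const c"
      by (simp add: remainder_const_def)
    ultimately have "(2 * K\<^sup>2 * exp (c\<^sup>2) * remainder_const c) * (real m * \<delta>\<^sup>2) \<le>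
      (2 * K\<^sup>2 * exp (c\<^sup>2) * remainder_const c) * (1 / real m)" by (intro mult_left_mono)
    then show ?thesis by (simp add: mult.commute mult.left_commute)
  qed
  finally show ?thesis using ZS sq_int[OF ZS] by auto
qed

text \<open>Refining the partition puts \<open>T\<close> into \<open>S\<close>. Undoing the
  exponential factor leaves a multiple of \<open>V\<close> to be added back, and this is where
  \<open>V \<in> S\<close> enters; the lemma thus adjoins one increment to a function already known
  to be in \<open>S\<close>.\<close>

lemma trig_increment_mem:
  assumes st: "0 \<le> s" "s < t" "t \<le> 1" and V: "V \<in> borel_measurable (F s)" "V \<in> S"
    and K: "\<And>\<omega>. \<omega> \<in> space M \<Longrightarrow> \<bar>V \<omega>\<bar> \<le> K"
  shows "(\<lambda>\<omega>. V \<omega> * cos (c * (W t \<omega> - W s \<omega>) + \<theta>)) \<in> S"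
proof -
  define T where "T \<omega> = V \<omega> * (exp (c\<^sup>2 * (t - s) / 2) * cos (c * (W t \<omega> - W s \<omega>) + \<theta>) - cos \<theta>)" for \<omega>
  have "\<forall>m. \<exists>Z. Z \<in> S \<and>
    (\<integral>\<omega>. (Z \<omega> - T \<omega>)\<^sup>2 \<partial>N) \<le> 2 * K\<^sup>2 * exp (c\<^sup>2) * remainder_const c / real (Suc m)"
    unfolding T_def using trig_increment_approx[OF st V(1) K zero_less_Suc, where c=c and \<theta>=\<theta>] by blast
  from choice[OF this] obtain Z where Z: "\<And>m. Z m \<in> S"
    "\<And>m. (\<integral>\<omega>. (Z m \<omega> - T \<omega>)\<^sup>2 \<partial>N) \<le> 2 * K\<^sup>2 * exp (c\<^sup>2) * remainder_const c / real (Suc m)"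
    by blast
  have [measurable]: "V \<in> borel_measurable N" "W t \<in> borel_measurable N" "W s \<in> borel_measurable N"
    using measurable_F_N[OF _ V(1)] W_measurable_N st by auto
  have sqT: "sq_integrable N T"
  proof (rule N.sq_integrable_bounded)
    show "T \<in> borel_measurable N" unfolding T_def[abs_def] by measurable
    fix \<omega> assume \<omega>: "\<omega> \<in> space N"
    have "\<bar>exp (c\<^sup>2 * (t - s) / 2) * cos (c * (W t \<omega> - W s \<omega>) + \<theta>) - cos \<theta>\<bar> \<le> exp (c\<^sup>2 * (t - s) / 2) * 1 + 1"
      by (intro order_trans[OF abs_triangle_ineq4] add_mono) (auto simp: abs_mult)
    then show "\<bar>T \<omega>\<bar> \<le> K * (exp (c\<^sup>2 * (t - s) / 2) * 1 + 1)"
      unfolding T_def abs_mult[of "V \<omega>"] using K[of \<omega>] \<omega> by (intro mult_mono) auto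
  qed
  have "(\<lambda>m. \<integral>\<omega>. (Z m \<omega> - T \<omega>)\<^sup>2 \<partial>N) \<longlonglongrightarrow> 0"
  proof (rule tendsto_sandwich[OF _ _ tendsto_const])
    show "(\<lambda>m. 2 * K\<^sup>2 * exp (c\<^sup>2) * remainder_const c / real (Suc m)) \<longlonglongrightarrow> 0"
      using tendsto_mult[OF tendsto_const LIMSEQ_inverse_real_of_nat, of "2 * K\<^sup>2 * exp (c\<^sup>2) * remainder_const c"]
      unfolding divide_inverse by simp
    show "\<forall>\<^sub>F m in sequentially. 0 \<le> (\<integral>\<omega>. (Z m \<omega> - T \<omega>)\<^sup>2 \<partial>N)"
      by (intro always_eventually allI integral_nonneg_AE AE_I2 zero_le_power2)
    show "\<forall>\<^sub>F m in sequentially. (\<integral>\<omega>. (Z m \<omega> - T \<omega>)\<^sup>2 \<partial>N) \<le> 2 * K\<^sup>2 * exp (c\<^sup>2) * remainder_const c / real (Suc m)"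
      by (intro always_eventually allI Z(2))
  qed
  then have "(\<lambda>m. L2_norm N (\<lambda>\<omega>. Z m \<omega> - T \<omega>)) \<longlonglongrightarrow> sqrt 0"
    unfolding L2_norm_def by (intro tendsto_real_sqrt)
  then have "L2_tendsto N Z T"
    using sq_int[OF Z(1)] sqT by (simp add: L2_tendsto_def)
  then have "T \<in> S" using limit Z(1) by blast
  then have "(\<lambda>\<omega>. exp (- (c\<^sup>2 * (t - s) / 2)) * T \<omega> + exp (- (c\<^sup>2 * (t - s) / 2)) * cos \<theta> * V \<omega>) \<in> S"
    using V(2) by (rule lincomb)
  moreover have "exp (- (c\<^sup>2 * (t - s) / 2)) * T \<omega> + exp (- (c\<^sup>2 * (t - s) / 2)) * cos \<theta> * V \<omega> =
    V \<omega> * cos (c * (W t \<omega> - W s \<omega>) + \<theta>)" for \<omega>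
    by (simp add: T_def exp_minus field_simps)
  ultimately show ?thesis by simp
qed

text \<open>Induction over the increments with the phase left free. The addition formula splits off
  the last increment, and both sines in it are cosines with phase shifted by \<open>pi / 2\<close>,
  so the induction hypothesis and \<open>trig_increment_mem\<close> apply to both products.\<close>

lemma cos_increments_mem:
  assumes t: "t 0 = 0" "t n \<le> 1" "\<And>i. i < n \<Longrightarrow> t i < t (Suc i)" and "i \<le> n"
  shows "(\<lambda>\<omega>. cos ((\<Sum>j<i. \<mu> j * (W (t (Suc j)) \<omega> - W (t j) \<omega>)) + \<theta>)) \<in> S"
  using \<open>i \<le> n\<close>
proof (induction i arbitrary: \<theta>)
  case 0
  show ?case using cmult[OF one_mem, of "cos \<theta>"] by simp
next
  case (Suc i)
  define A where "A \<omega> = (\<Sum>j<i. \<mu> j * (W (t (Suc j)) \<omega> - W (t j) \<omega>))" for \<omega>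
  have mono: "t j \<le> t k" if "j \<le> k" "k \<le> n" for j k
    using that
  proof (induction k rule: dec_induct)
    case (step k)
    then show ?case using t(3)[of k] by fastforce
  qed simp
  have t_range: "0 \<le> t j" "t j \<le> 1" if "j \<le> n" for j
    using mono[of 0 j] mono[of j n] that t by auto
  have [measurable]: "A \<in> borel_measurable (F (t i))"
  proof -
    have "W (t j) \<in> borel_measurable (F (t i))" if "j \<le> i" for j
      using Suc.prems that by (intro W_adapted t_range mono) auto
    then show ?thesis unfolding A_def[abs_def] by (intro borel_measurable_sum) auto
  qed
  have inc: "0 \<le> t i" "t i < t (Suc i)" "t (Suc i) \<le> 1" using t_range[of i] t_range[of "Suc i"] t(3)[of i] Suc.prems by auto
  have mem: "(\<lambda>\<omega>. cos (A \<omega> + \<eta>) * cos (\<mu> i * (W (t (Suc i)) \<omega> - W (t i) \<omega>) + \<zeta>)) \<in> S" for \<eta> \<zeta>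
    using Suc.IH[of \<eta>] Suc.prems
    by (intro trig_increment_mem[OF inc, where K=1]) (auto simp: A_def[symmetric])
  have "(\<lambda>\<omega>. cos (A \<omega> + 0) * cos (\<mu> i * (W (t (Suc i)) \<omega> - W (t i) \<omega>) + \<theta>)
     - cos (A \<omega> + - (pi / 2)) * cos (\<mu> i * (W (t (Suc i)) \<omega> - W (t i) \<omega>) + (\<theta> - pi / 2))) \<in> S"
    by (intro diff mem)
  moreover have "cos (A \<omega> + 0) * cos (y + \<theta>) - cos (A \<omega> + - (pi / 2)) * cos (y + (\<theta> - pi / 2)) = cos (A \<omega> + y + \<theta>)" for \<omega> y
  proof -
    have "cos (A \<omega> + - (pi / 2)) = sin (A \<omega>)" "cos (y + (\<theta> - pi / 2)) = sin (y + \<theta>)"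
      using cos_diff[of "A \<omega>" "pi / 2"] cos_diff[of "y + \<theta>" "pi / 2"] by (simp_all add: add_diff_eq)
    then show ?thesis by (simp add: cos_add[of "A \<omega>" "y + \<theta>"] add.assoc)
  qed
  ultimately show ?case by (simp add: A_def)
qed

sublocale trigonometric_subspace "completion M" S "{0..1}" W
proof unfold_locales
  have mem: "(\<lambda>\<omega>. cos ((\<Sum>u\<in>J. c u * W u \<omega>) + \<theta>)) \<in> S" if J: "finite J" "J \<subseteq> {0..1}" for J c \<theta>
  proof -
    obtain n t \<mu> where t: "t 0 = 0" "t n = 1" "\<And>i. i < n \<Longrightarrow> t i < t (Suc i)"
      and eq: "AE \<omega> in M. (\<Sum>u\<in>J. c u * W u \<omega>) = (\<Sum>j<n::nat. \<mu> j * (W (t (Suc j)) \<omega> - W (t j) \<omega>))"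
      by (rule lincomb_W_increments[OF J, where c=c]) (simp, rule that)
    show ?thesis
    proof (rule cong_AE[OF cos_increments_mem[of t n n \<mu> \<theta>]])
      show "(\<lambda>\<omega>. cos ((\<Sum>u\<in>J. c u * W u \<omega>) + \<theta>)) \<in> borel_measurable N"
      proof -
        have "(\<lambda>\<omega>. \<Sum>u\<in>J. c u * W u \<omega>) \<in> borel_measurable N"
          using J W_measurable_N by (intro borel_measurable_sum borel_measurable_times) auto
        then show ?thesis by measurable
      qed
      show "AE \<omega> in N. cos ((\<Sum>j<n. \<mu> j * (W (t (Suc j)) \<omega> - W (t j) \<omega>)) + \<theta>) = cos ((\<Sum>u\<in>J. c u * W u \<omega>) + \<theta>)"
        using AE_completion[OF eq] by eventually_elim simp
    qed (use t in auto)
  qed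
  show "(\<lambda>\<omega>. cos (\<Sum>u\<in>J. c u * W u \<omega>)) \<in> S" if "finite J" "J \<subseteq> {0..1}" for J c
    using mem[OF that, of c 0] by simp
  show "(\<lambda>\<omega>. sin (\<Sum>u\<in>J. c u * W u \<omega>)) \<in> S" if "finite J" "J \<subseteq> {0..1}" for J c
    using mem[OF that, of c "- (pi / 2)"] by (simp add: cos_diff flip: diff_conv_add_uminus)
qed (use W_measurable_N in auto)

theorem F_measurable_mem: "Z \<in> borel_measurable (F 1) \<Longrightarrow> sq_integrable N Z \<Longrightarrow> Z \<in> S"
  using measurable_mem[of Z] unfolding F_eq_augmented_sigma .

end

section \<open>Integrals of signed deterministic step functions\<close>

lemma (in real_distribution) char_eq_Complex:
  "char M c = Complex (\<integral>x. cos (c * x) \<partial>M) (\<integral>x. sin (c * x) \<partial>M)"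
proof -
  have int: "integrable M (\<lambda>x. iexp (c * x))" by (intro integrable_iexp) auto
  have "Re (iexp (c * x)) = cos (c * x)" "Im (iexp (c * x)) = sin (c * x)" for x
    by (simp_all add: Re_exp Im_exp)
  then show ?thesis
    unfolding char_def
    using integral_Re[OF int] integral_Im[OF int] by (intro complex_eqI) simp_all
qed

lemma (in prob_space) distr_eq_centred_normal:
  assumes X: "X \<in> borel_measurable M" and \<sigma>: "0 < \<sigma>"
    and cos: "\<And>c. expectation (\<lambda>x. cos (c * X x)) = exp (- (c\<^sup>2 * \<sigma>\<^sup>2 / 2))"
    and sin: "\<And>c. expectation (\<lambda>x. sin (c * X x)) = 0"
  shows "distr M borel X = density lborel (normal_density 0 \<sigma>)"
proof (rule Levy_uniqueness)
  interpret P: prob_space "density lborel (normal_density 0 \<sigma>)" by (rule prob_space_normal_density[OF \<sigma>])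
  show R: "real_distribution (distr M borel X)" using X by simp
  show R': "real_distribution (density lborel (normal_density 0 \<sigma>))" by unfold_locales simp
  interpret D: real_distribution "distr M borel X" by (rule R)
  interpret D': real_distribution "density lborel (normal_density 0 \<sigma>)" by (rule R')
  \<comment> \<open>The identity is a normal variable under the normal law itself, so the earlier
    formulas also evaluate the second characteristic function.\<close>
  have id: "distributed (density lborel (normal_density 0 \<sigma>)) lborel (\<lambda>x. x) (normal_density 0 \<sigma>)"
    unfolding distributed_def using distr_id2[of lborel "density lborel (normal_density 0 \<sigma>)"] by simp
  note normal = P.expectation_trig_centred_normal[OF id \<sigma>]
  show "char (distr M borel X) = char (density lborel (normal_density 0 \<sigma>))"
  proof
    fix c
    have "(\<integral>x. cos (c * x) \<partial>distr M borel X) = exp (- (c\<^sup>2 * \<sigma>\<^sup>2 / 2))"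
      "(\<integral>x. sin (c * x) \<partial>distr M borel X) = 0"
      using X cos[of c] sin[of c] by (simp_all add: integral_distr)
    then show "char (distr M borel X) c = char (density lborel (normal_density 0 \<sigma>)) c"
      unfolding D.char_eq_Complex D'.char_eq_Complex normal by simp
  qed
qed

text \<open>As \<open>U\<close> is measurable for the subalgebra, its square norm equals its inner
  product with \<open>Z\<close>, and Cauchy-Schwarz finishes. This contraction carries convergence
  at time 1 back to earlier times.\<close>

lemma (in finite_measure_subalgebra) L2_norm_cond_exp_le:
  assumes Z: "sq_integrable M Z" and U: "sq_integrable M U" "U \<in> borel_measurable F"
    and eq: "AE x in M. real_cond_exp M F Z x = U x"
  shows "L2_norm M U \<le> L2_norm M Z"
proof -
  have "(L2_norm M U)\<^sup>2 = (\<integral>x. U x * real_cond_exp M F Z x \<partial>M)"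
    unfolding L2_norm_square using eq U(1)
    by (intro integral_cong_AE) (auto simp: sq_integrable_def power2_eq_square)
  also have "\<dots> = (\<integral>x. U x * Z x \<partial>M)"
    using Z U by (intro real_cond_exp_intg(2) sq_integrable_mult) (auto simp: sq_integrable_def)
  also have "\<dots> \<le> L2_norm M U * L2_norm M Z"
    using L2_Cauchy_Schwarz[OF U(1) Z] by simp
  finally have "L2_norm M U * L2_norm M U \<le> L2_norm M U * L2_norm M Z"
    by (simp add: power2_eq_square)
  then show ?thesis
    using L2_norm_nonneg[of M U] L2_norm_nonneg[of M Z] by (cases "L2_norm M U = 0") auto
qed

context brownian
begin

lemma finite_measure_subalgebra_F: "t \<le> 1 \<Longrightarrow> finite_measure_subalgebra N (F t)"
  using subalgebra_F by (simp add: finite_measure_subalgebra_def finite_measure_subalgebra_axioms_def N.finite_measure_axioms)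

definition sign_integral :: "real \<Rightarrow> ('a \<Rightarrow> real) \<Rightarrow> real \<Rightarrow> real \<Rightarrow> real \<Rightarrow> 'a \<Rightarrow> real" where
  "sign_integral c e s t u \<omega> = c * e \<omega> * (W (min u t) \<omega> - W (min u s) \<omega>)"

text \<open>The sign is 1 or -1 at every point of the space, not merely almost everywhere, because
  \<open>\<bar>\<phi>\<bar> = 1\<close> is claimed pointwise.\<close>

definition admissible :: "('a \<Rightarrow> real) \<Rightarrow> real \<Rightarrow> real \<Rightarrow> bool" where
  "admissible e s t \<longleftrightarrow> 0 \<le> s \<and> s < t \<and> t \<le> 1 \<and> e \<in> borel_measurable (F s) \<and>
     (\<forall>\<omega>\<in>space M. e \<omega> = 1 \<or> e \<omega> = -1)"

lemma admissibleD:
  assumes "admissible e s t"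
  shows "0 \<le> s" "s < t" "t \<le> 1" "e \<in> borel_measurable (F s)" "e \<in> borel_measurable N"
    and "\<And>\<omega>. \<omega> \<in> space M \<Longrightarrow> e \<omega> = 1 \<or> e \<omega> = -1" and "\<And>\<omega>. \<omega> \<in> space M \<Longrightarrow> \<bar>e \<omega>\<bar> = 1"
  using assms measurable_F_N[of s e] by (auto simp: admissible_def)

text \<open>Clamping the time to \<open>{s..t}\<close> gives one formula for all times, an increment
  starting at \<open>s\<close>. Integrability, the martingale property and the Gaussian law are all
  read off from it.\<close>

lemma sign_integral_clamp:
  "s < t \<Longrightarrow> sign_integral c e s t u \<omega> = c * e \<omega> * (W (max s (min u t)) \<omega> - W s \<omega>)"
  by (auto simp: sign_integral_def min_def max_def)

lemma sign_integral_0: "0 \<le> s \<Longrightarrow> s < t \<Longrightarrow> sign_integral c e s t 0 \<omega> = 0"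
  by (simp add: sign_integral_def)

lemma sq_integrable_sign_integral:
  assumes e: "admissible e s t"
  shows "sq_integrable N (sign_integral c e s t u)"
proof -
  note e = admissibleD[OF e]
  have "sq_integrable N (\<lambda>\<omega>. (c * e \<omega>) * (W (max s (min u t)) \<omega> - W s \<omega>))"
    using e(1,2,3,5,7)
    by (intro sq_integrable_bounded_mult[where K="\<bar>c\<bar>"] sq_integrable_increment) (auto simp: abs_mult)
  moreover have "sign_integral c e s t u = (\<lambda>\<omega>. (c * e \<omega>) * (W (max s (min u t)) \<omega> - W s \<omega>))"
    by (rule ext) (simp add: sign_integral_clamp e(2))
  ultimately show ?thesis by simp
qed

lemma sign_integral_adapted:
  assumes e: "admissible e s t" and u: "u \<in> {0..1}"
  shows "sign_integral c e s t u \<in> borel_measurable (F u)"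
proof (cases "u \<le> s")
  case True
  \<comment> \<open>The sign \<open>e\<close> need not be known before \<open>s\<close>, but up to
    then the increment is identically 0.\<close>
  then have "sign_integral c e s t u = (\<lambda>\<omega>. 0)"
    using admissibleD(2)[OF e] by (auto simp: sign_integral_def)
  then show ?thesis by simp
next
  case False
  note e = admissibleD[OF e]
  have "e \<in> borel_measurable (F u)"
    using False by (intro measurable_F_mono[OF _ e(4)]) simp
  moreover have "W (min u t) \<in> borel_measurable (F u)" "W (min u s) \<in> borel_measurable (F u)"
    using u e(1-3) by (auto intro!: W_adapted)
  ultimately show ?thesis unfolding sign_integral_def[abs_def] by measurable
qed

text \<open>The case \<open>s = t\<close> is included because clamped times may coincide.\<close>

lemma integral_past_times_increment:
  assumes st: "0 \<le> s" "s \<le> t" "t \<le> 1" and Z: "Z \<in> borel_measurable (F s)"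
    and K: "\<And>\<omega>. \<omega> \<in> space M \<Longrightarrow> \<bar>Z \<omega>\<bar> \<le> K"
  shows "(\<integral>\<omega>. Z \<omega> * (W t \<omega> - W s \<omega>) \<partial>N) = 0"
proof (cases "s = t")
  case False
  with st have st': "s < t" by simp
  have "integrable N Z"
    using measurable_F_N[OF _ Z] K st by (intro N.integrable_const_bound[of _ K]) auto
  from integral_past_increment(1)[OF st(1) st' st(3) Z this, of "\<lambda>x. x"] increment_moments(1,2)[OF st(1) st' st(3)]
  show ?thesis by simp
qed simp

lemma martingale_sign_integral:
  assumes e: "admissible e s t"
  shows "martingale N F (sign_integral c e s t)"
  unfolding martingale_def
proof (intro conjI ballI)
  note ad = admissibleD[OF e]
  fix v :: real assume v: "v \<in> {0..1}"
  show meas: "sign_integral c e s t v \<in> borel_measurable (F v)" by (rule sign_integral_adapted[OF e v])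
  show int: "integrable N (sign_integral c e s t v)" for v
    by (rule N.sq_integrable_integrable[OF sq_integrable_sign_integral[OF e]])
  fix u assume u: "u \<in> {v..1}"
  interpret finite_measure_subalgebra N "F v" using v by (intro finite_measure_subalgebra_F) simp
  show "AE \<omega> in N. real_cond_exp N (F v) (sign_integral c e s t u) \<omega> = sign_integral c e s t v \<omega>"
  proof (rule real_cond_exp_charact[OF _ int int meas])
    fix A assume A: "A \<in> sets (F v)"
    have AN: "A \<in> sets N" using A subalg by (auto simp: subalgebra_def)
    \<comment> \<open>If \<open>v < t\<close>, then \<open>a\<close> is at least \<open>s\<close>
      and at least \<open>v\<close>, so both the sign and \<open>A\<close> are known at
      \<open>a\<close>. Otherwise \<open>a\<close> and \<open>b\<close> both equal \<open>t\<close>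
      and the increment vanishes.\<close>
    define a b where "a = max s (min v t)" and "b = max s (min u t)"
    have ab: "0 \<le> a" "a \<le> b" "b \<le> 1" using u v ad(1-3) by (auto simp: a_def b_def)
    have "(\<integral>\<omega>. (indicator A \<omega> * (c * e \<omega>)) * (W b \<omega> - W a \<omega>) \<partial>N) = 0"
    proof (cases "v < t")
      case True
      have "s \<le> a" "v \<le> a" using True by (auto simp: a_def)
      then have "e \<in> borel_measurable (F a)" "A \<in> sets (F a)"
        using measurable_F_mono[OF _ ad(4)] A F_mono[of v a] by (auto simp: subalgebra_def)
      then have "(\<lambda>\<omega>. indicator A \<omega> * (c * e \<omega>)) \<in> borel_measurable (F a)" by measurable
      then show ?thesis
      proof (rule integral_past_times_increment[OF ab])
        show "\<bar>indicator A \<omega> * (c * e \<omega>)\<bar> \<le> \<bar>c\<bar>" if "\<omega> \<in> space M" for \<omega>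
          using ad(7)[OF that] by (auto simp: abs_mult indicator_def)
      qed
    next
      case False
      then have "a = b" using u by (auto simp: a_def b_def)
      then show ?thesis by simp
    qed
    moreover have "(indicator A \<omega> * (c * e \<omega>)) * (W b \<omega> - W a \<omega>) =
      indicator A \<omega> * sign_integral c e s t u \<omega> - indicator A \<omega> * sign_integral c e s t v \<omega>" for \<omega>
      unfolding sign_integral_clamp[OF ad(2)] a_def b_def by (simp add: algebra_simps)
    moreover have "integrable N (\<lambda>\<omega>. indicator A \<omega> * sign_integral c e s t w \<omega>)" for w
      using integrable_mult_indicator[OF AN int[of w]] by simp
    ultimately have "(\<integral>\<omega>. indicator A \<omega> * sign_integral c e s t u \<omega> \<partial>N) = (\<integral>\<omega>. indicator A \<omega> * sign_integral c e s t v \<omega> \<partial>N)"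
      by simp
    then show "(\<integral>\<omega>\<in>A. sign_integral c e s t u \<omega> \<partial>N) = (\<integral>\<omega>\<in>A. sign_integral c e s t v \<omega> \<partial>N)"
      by (simp add: set_lebesgue_integral_def)
  qed
qed

text \<open>The sign \<open>e\<close> disappears because each increment is symmetric and independent of the past.\<close>

lemma integral_trig_signed_sum:
  fixes t :: "nat \<Rightarrow> real" and \<mu> :: "nat \<Rightarrow> real"
  assumes t: "0 \<le> t 0" "t n \<le> 1" "\<And>i. i < n \<Longrightarrow> t i < t (Suc i)"
    and e: "e \<in> borel_measurable (F (t 0))" "\<And>\<omega>. \<omega> \<in> space M \<Longrightarrow> e \<omega> = 1 \<or> e \<omega> = -1"
    and "i \<le> n"
  shows "(\<lambda>\<omega>. e \<omega> * (\<Sum>j<i. \<mu> j * (W (t (Suc j)) \<omega> - W (t j) \<omega>))) \<in> borel_measurable (F (t i)) \<and>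
    (\<integral>\<omega>. cos (c * (e \<omega> * (\<Sum>j<i. \<mu> j * (W (t (Suc j)) \<omega> - W (t j) \<omega>))) + \<theta>) \<partial>N) =
      exp (- (c\<^sup>2 * (\<Sum>j<i. (\<mu> j)\<^sup>2 * (t (Suc j) - t j)) / 2)) * cos \<theta>"
  using \<open>i \<le> n\<close>
proof (induction i arbitrary: \<theta>)
  case 0
  show ?case using N.prob_space by simp
next
  case (Suc i)
  define G where "G \<omega> = e \<omega> * (\<Sum>j<i. \<mu> j * (W (t (Suc j)) \<omega> - W (t j) \<omega>))" for \<omega>
  define v where "v = (\<Sum>j<i. (\<mu> j)\<^sup>2 * (t (Suc j) - t j))"
  define D where "D \<omega> = W (t (Suc i)) \<omega> - W (t i) \<omega>" for \<omega>
  have mono: "t j \<le> t k" if "j \<le> k" "k \<le> n" for j k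
    using that
  proof (induction k rule: dec_induct)
    case (step k)
    then show ?case using t(3)[of k] by fastforce
  qed simp
  have t_range: "0 \<le> t j" "t j \<le> 1" if "j \<le> n" for j
    using mono[of 0 j] mono[of j n] that t by auto
  have inc: "0 \<le> t i" "t i < t (Suc i)" "t (Suc i) \<le> 1"
    using t_range[of i] t_range[of "Suc i"] t(3)[of i] Suc.prems by auto
  have G: "G \<in> borel_measurable (F (t i))"
    and IH: "\<And>\<theta>. (\<integral>\<omega>. cos (c * G \<omega> + \<theta>) \<partial>N) = exp (- (c\<^sup>2 * v / 2)) * cos \<theta>"
    using Suc by (auto simp: G_def[abs_def] v_def)
  have ei: "e \<in> borel_measurable (F (t i))"
    using Suc.prems by (intro measurable_F_mono[OF mono e(1)]) auto
  have W_meas: "W (t (Suc i)) \<in> borel_measurable (F (t (Suc i)))" "W (t i) \<in> borel_measurable (F (t (Suc i)))"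
    using inc by (auto intro!: W_adapted)
  have le: "t i \<le> t (Suc i)" using inc by simp
  have G_Suc: "e \<omega> * (\<Sum>j<Suc i. \<mu> j * (W (t (Suc j)) \<omega> - W (t j) \<omega>)) = G \<omega> + \<mu> i * e \<omega> * D \<omega>" for \<omega>
    by (simp add: G_def D_def algebra_simps)
  have meas: "(\<lambda>\<omega>. G \<omega> + \<mu> i * e \<omega> * D \<omega>) \<in> borel_measurable (F (t (Suc i)))"
    unfolding D_def using W_meas measurable_F_mono[OF le ei] measurable_F_mono[OF le G] by measurable
  \<comment> \<open>Cosine is even and sine is odd, so the sign inside the argument survives only as
    a factor of the sine term, whose expectation is 0.\<close>
  have split: "cos (c * (G \<omega> + \<mu> i * e \<omega> * D \<omega>) + \<theta>) =
    cos (c * G \<omega> + \<theta>) * cos (c * \<mu> i * D \<omega>) - (sin (c * G \<omega> + \<theta>) * e \<omega>) * sin (c * \<mu> i * D \<omega>)"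
    if "\<omega> \<in> space N" for \<omega>
  proof -
    have "cos (c * (G \<omega> + \<mu> i * e \<omega> * D \<omega>) + \<theta>) = cos ((c * G \<omega> + \<theta>) + e \<omega> * (c * \<mu> i * D \<omega>))"
      by (simp add: algebra_simps)
    also have "\<dots> = cos (c * G \<omega> + \<theta>) * cos (c * \<mu> i * D \<omega>) - (sin (c * G \<omega> + \<theta>) * e \<omega>) * sin (c * \<mu> i * D \<omega>)"
      using e(2)[of \<omega>] that by (auto simp: cos_add)
    finally show ?thesis .
  qed
  have abs_e: "\<bar>e \<omega>\<bar> \<le> 1" if "\<omega> \<in> space N" for \<omega> using e(2)[of \<omega>] that by auto
  have eN: "e \<in> borel_measurable N" "G \<in> borel_measurable N"
    using ei G inc by (auto intro: measurable_F_N[of "t i"])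
  have D_N: "D \<in> borel_measurable N"
    unfolding D_def[abs_def] using inc W_measurable_N[of "t i"] W_measurable_N[of "t (Suc i)"] by auto
  have int: "integrable N (\<lambda>\<omega>. cos (c * G \<omega> + \<theta>))" "integrable N (\<lambda>\<omega>. sin (c * G \<omega> + \<theta>) * e \<omega>)"
    "integrable N (\<lambda>\<omega>. cos (c * \<mu> i * D \<omega>))" "integrable N (\<lambda>\<omega>. sin (c * \<mu> i * D \<omega>))"
    using eN D_N abs_e
    by (auto intro!: N.integrable_const_bound[of _ 1] AE_I2 simp: abs_mult mult_le_one)
  have pm: "(\<lambda>\<omega>. cos (c * G \<omega> + \<theta>)) \<in> borel_measurable (F (t i))"
    "(\<lambda>\<omega>. sin (c * G \<omega> + \<theta>) * e \<omega>) \<in> borel_measurable (F (t i))"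
    using G ei by measurable
  note p1 = integral_past_increment[OF inc pm(1) int(1), of "\<lambda>x. cos (c * \<mu> i * x)", folded D_def, OF _ int(3)]
  note p2 = integral_past_increment[OF inc pm(2) int(2), of "\<lambda>x. sin (c * \<mu> i * x)", folded D_def, OF _ int(4)]
  have "(\<integral>\<omega>. cos (c * (G \<omega> + \<mu> i * e \<omega> * D \<omega>) + \<theta>) \<partial>N) =
    (\<integral>\<omega>. cos (c * G \<omega> + \<theta>) * cos (c * \<mu> i * D \<omega>) - (sin (c * G \<omega> + \<theta>) * e \<omega>) * sin (c * \<mu> i * D \<omega>) \<partial>N)"
    by (intro Bochner_Integration.integral_cong refl split)
  also have "\<dots> = (\<integral>\<omega>. cos (c * G \<omega> + \<theta>) * cos (c * \<mu> i * D \<omega>) \<partial>N) -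
    (\<integral>\<omega>. (sin (c * G \<omega> + \<theta>) * e \<omega>) * sin (c * \<mu> i * D \<omega>) \<partial>N)"
    by (intro Bochner_Integration.integral_diff p1(2) p2(2)) auto
  also have "\<dots> = (\<integral>\<omega>. cos (c * G \<omega> + \<theta>) \<partial>N) * (\<integral>\<omega>. cos (c * \<mu> i * D \<omega>) \<partial>N)"
    using p1(1) p2(1) increment_trig(2)[OF inc, of "c * \<mu> i"] by (simp add: D_def)
  also have "\<dots> = exp (- (c\<^sup>2 * v / 2)) * cos \<theta> * exp (- ((c * \<mu> i)\<^sup>2 * (t (Suc i) - t i) / 2))"
    unfolding IH D_def increment_trig(1)[OF inc] ..
  also have "\<dots> = exp (- (c\<^sup>2 * v / 2) + - ((c * \<mu> i)\<^sup>2 * (t (Suc i) - t i) / 2)) * cos \<theta>"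
    unfolding exp_add by simp
  also have "- (c\<^sup>2 * v / 2) + - ((c * \<mu> i)\<^sup>2 * (t (Suc i) - t i) / 2) =
    - (c\<^sup>2 * (\<Sum>j<Suc i. (\<mu> j)\<^sup>2 * (t (Suc j) - t j)) / 2)"
    by (simp add: v_def power_mult_distrib field_simps)
  finally show ?case using meas by (simp only: G_Suc)
qed

lemma gaussian_rv_signed_sum:
  fixes t :: "nat \<Rightarrow> real" and \<mu> :: "nat \<Rightarrow> real"
  assumes t: "0 \<le> t 0" "t n \<le> 1" "\<And>i. i < n \<Longrightarrow> t i < t (Suc i)"
    and e: "e \<in> borel_measurable (F (t 0))" "\<And>\<omega>. \<omega> \<in> space M \<Longrightarrow> e \<omega> = 1 \<or> e \<omega> = -1"
  shows "gaussian_rv N (\<lambda>\<omega>. e \<omega> * (\<Sum>j<n. \<mu> j * (W (t (Suc j)) \<omega> - W (t j) \<omega>)))"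
    (is "gaussian_rv N ?G")
proof -
  define v where "v = (\<Sum>j<n. (\<mu> j)\<^sup>2 * (t (Suc j) - t j))"
  note * = integral_trig_signed_sum[OF t e order_refl, of \<mu>, folded v_def]
  have G: "?G \<in> borel_measurable N"
    using * t(2) by (auto intro: measurable_F_N[of "t n"])
  have nn: "0 \<le> (\<mu> j)\<^sup>2 * (t (Suc j) - t j)" if "j < n" for j using t(3)[OF that] by simp
  have v: "0 \<le> v" unfolding v_def using nn by (intro sum_nonneg) auto
  show ?thesis
  proof (cases "v = 0")
    case True
    \<comment> \<open>Degenerate case: the grid is strictly increasing, so zero variance forces all
      coefficients to vanish and the law is the point mass at 0.\<close>
    then have "(\<mu> j)\<^sup>2 * (t (Suc j) - t j) = 0" if "j < n" for j
      using that nn sum_nonneg_eq_0_iff[of "{..<n}" "\<lambda>j. (\<mu> j)\<^sup>2 * (t (Suc j) - t j)"] by (auto simp: v_def)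
    then have "\<mu> j = 0" if "j < n" for j using that t(3)[OF that] by fastforce
    then have "?G = (\<lambda>\<omega>. 0)" by simp
    moreover have "distr N borel (\<lambda>\<omega>. 0::real) = return borel 0"
      by (intro measure_eqI) (auto simp: emeasure_distr N.emeasure_space_1 indicator_def vimage_def)
    ultimately show ?thesis
      unfolding gaussian_rv_def by (auto intro!: exI[of _ "0::real"])
  next
    case False
    then have sv: "0 < sqrt v" using v by simp
    have "distr N borel ?G = density lborel (normal_density 0 (sqrt v))"
    proof (rule N.distr_eq_centred_normal[OF G sv])
      show "(\<integral>\<omega>. cos (c * ?G \<omega>) \<partial>N) = exp (- (c\<^sup>2 * (sqrt v)\<^sup>2 / 2))" for c
        using *[of c 0] v by simp
      \<comment> \<open>The sine expectation is the cosine formula at phase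
        \<open>- (pi / 2)\<close>, where \<open>cos \<theta> = 0\<close>.\<close>
      have "sin x = cos (x + - (pi / 2))" for x :: real
        using cos_diff[of x "pi / 2"] by simp
      then show "(\<integral>\<omega>. sin (c * ?G \<omega>) \<partial>N) = 0" for c
        using *[of c "- (pi / 2)"] by simp
    qed
    then show ?thesis
      unfolding gaussian_rv_def using G sv by (intro conjI exI[of _ 0] exI[of _ "sqrt v"]) auto
  qed
qed

text \<open>All clamped times lie in \<open>{s..t}\<close>, so a grid starting at \<open>s\<close>
  suffices and \<open>e\<close> is known at its first point. A linear combination of values is then
  \<open>e\<close> times one linear combination of later increments.\<close>

lemma gaussian_martingale_sign_integral:
  assumes e: "admissible e s t"
  shows "gaussian_martingale N F (sign_integral c e s t)"
  unfolding gaussian_martingale_def gaussian_process_def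
proof (intro conjI allI impI martingale_sign_integral[OF e])
  note ad = admissibleD[OF e]
  fix T :: "real set" and d :: "real \<Rightarrow> real" assume "finite T \<and> T \<subseteq> {0..1}"
  then have T: "finite T" by simp
  define cl where "cl u = max s (min u t)" for u
  have "cl ` T \<subseteq> {s..t}" using ad(2) by (auto simp: cl_def)
  then obtain n \<tau> where \<tau>: "\<tau> 0 = s" "\<tau> n = t" "\<And>i. i < n \<Longrightarrow> \<tau> i < \<tau> (Suc i)" "cl ` T \<subseteq> \<tau> ` {..n::nat}"
    using time_grid[of "cl ` T" s t] T ad(2) by (metis finite_imageI less_imp_le)
  obtain \<mu> where \<mu>: "\<And>w :: real \<Rightarrow> real.
    (\<Sum>u\<in>T. d u * c * (w (cl u) - w (\<tau> 0))) = (\<Sum>j<n. \<mu> j * (w (\<tau> (Suc j)) - w (\<tau> j)))"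
    by (rule lincomb_increments[OF T \<tau>(4), where c="\<lambda>u. d u * c"]) (rule that)
  have "(\<Sum>u\<in>T. d u * sign_integral c e s t u \<omega>) =
    e \<omega> * (\<Sum>j<n. \<mu> j * (W (\<tau> (Suc j)) \<omega> - W (\<tau> j) \<omega>))" for \<omega>
    unfolding \<mu>[of "\<lambda>u. W u \<omega>", symmetric] sign_integral_clamp[OF ad(2)] \<tau>(1) sum_distrib_left cl_def
    by (simp add: mult_ac)
  moreover have "gaussian_rv N (\<lambda>\<omega>. e \<omega> * (\<Sum>j<n. \<mu> j * (W (\<tau> (Suc j)) \<omega> - W (\<tau> j) \<omega>)))"
    using ad \<tau> by (intro gaussian_rv_signed_sum) auto
  ultimately show "gaussian_rv N (\<lambda>\<omega>. \<Sum>u\<in>T. d u * sign_integral c e s t u \<omega>)" by simp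
qed

section \<open>Predictability and the stochastic integral property\<close>

definition sign_process :: "('a \<Rightarrow> real) \<Rightarrow> real \<Rightarrow> real \<Rightarrow> real \<Rightarrow> 'a \<Rightarrow> real" where
  "sign_process e s t u \<omega> = (if u \<in> {s<..t} then e \<omega> else 1)"

text \<open>The process is \<open>1 - 2 * indicator\<close> of the rectangle
  \<open>{s<..t} \<times> {e = -1}\<close>, which is a generator of the predictable
  sigma-algebra.\<close>

lemma predictable_sign_process:
  assumes e: "admissible e s t"
  shows "predictable N F (sign_process e s t)"
proof -
  note ad = admissibleD[OF e]
  define G where "G = {{0} \<times> A | A. A \<in> sets (F 0)} \<union>
        {{s<..t} \<times> A | s t A. 0 \<le> s \<and> s \<le> t \<and> t \<le> (1::real) \<and> A \<in> sets (F s)}"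
  define A where "A = {\<omega> \<in> space M. e \<omega> = -1}"
  have "A = e -` {-1} \<inter> space (F s)" by (auto simp: A_def space_F)
  then have A: "A \<in> sets (F s)" using measurable_sets[OF ad(4), of "{-1}"] by simp
  have "B \<subseteq> space M" if "B \<in> sets (F r)" for B r
    using sets.sets_into_space[OF that] by (simp add: space_F)
  then have G_Pow: "G \<subseteq> Pow ({0..1} \<times> space M)" unfolding G_def by fastforce
  have "{s<..t} \<times> A \<in> G"
    unfolding G_def using A ad(1-3) by (intro UnI2 CollectI exI[of _ s] exI[of _ t] exI[of _ A]) simp
  then have set: "{s<..t} \<times> A \<in> sets (predictable_sigma (space M) F)"
    unfolding predictable_sigma_def G_def[symmetric] using G_Pow by simp
  have "(\<lambda>x. 1 - 2 * indicator ({s<..t} \<times> A) x :: real) \<in> borel_measurable (predictable_sigma (space M) F)"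
    using set by simp
  moreover have "1 - 2 * indicator ({s<..t} \<times> A) x = (case x of (u, \<omega>) \<Rightarrow> sign_process e s t u \<omega>)"
    if "x \<in> space (predictable_sigma (space M) F)" for x
  proof -
    have "snd x \<in> space M"
      using that unfolding predictable_sigma_def by (auto simp: space_measure_of_conv)
    then show ?thesis
      using ad(6)[of "snd x"] by (cases x) (auto simp: sign_process_def A_def indicator_def)
  qed
  ultimately have "(\<lambda>x. case x of (u, \<omega>) \<Rightarrow> sign_process e s t u \<omega>) \<in> borel_measurable (predictable_sigma (space M) F)"
    by (subst measurable_cong[symmetric]) assumption+
  then show ?thesis by (simp add: predictable_def)
qed

lemma finite_measure_unit_lborel: "finite_measure unit_lborel"
  by (rule finite_measureI) (simp add: emeasure_restrict_space)

lemma sq_integrable_step: "sq_integrable unit_lborel (\<lambda>u. c * indicator {s<..t} u)"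
proof -
  have "(\<lambda>u. c * indicator {s<..t} u) \<in> borel_measurable unit_lborel"
    by (intro measurable_restrict_space1) auto
  then show ?thesis
    by (rule finite_measure.sq_integrable_bounded[OF finite_measure_unit_lborel, where K="\<bar>c\<bar>"])
       (auto simp: indicator_def)
qed

lemma is_ito_integral_sign_integral:
  assumes e: "admissible e s t"
  shows "is_ito_integral N F W (\<lambda>u \<omega>. sign_process e s t u \<omega> * (c * indicator {s<..t} u)) (sign_integral c e s t)"
proof -
  note ad = admissibleD[OF e]
  let ?P = "unit_lborel \<Otimes>\<^sub>M N"
  \<comment> \<open>One interval suffices: the integrand is itself elementary, so the approximating
    sequence is constant.\<close>
  define \<tau> :: "nat \<Rightarrow> real" where "\<tau> i = (if i = 0 then s else t)" for i
  define \<xi> :: "nat \<Rightarrow> 'a \<Rightarrow> real" where "\<xi> i \<omega> = c * e \<omega>" for i \<omega>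
  have process: "elementary_process 1 \<tau> \<xi> u \<omega> = c * e \<omega> * indicator {s<..t} u" for u \<omega>
    by (simp add: elementary_process_def \<tau>_def \<xi>_def)
  have integral: "elementary_integral W 1 \<tau> \<xi> u = sign_integral c e s t u" for u
    by (rule ext) (simp add: elementary_integral_def sign_integral_def \<tau>_def \<xi>_def)
  have eq: "sign_process e s t u \<omega> * (c * indicator {s<..t} u) = c * e \<omega> * indicator {s<..t} u" for u \<omega>
    by (simp add: sign_process_def indicator_def)
  have "predictable N F (\<lambda>u \<omega>. sign_process e s t u \<omega> * (c * indicator {s<..t} u))"
  proof -
    have "{s<..t} \<times> space M \<in> sets (predictable_sigma (space M) F)"
    proof -
      \<comment> \<open>With the constant sign -1 the process takes the value -1 exactly on the
        rectangle in question.\<close>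
      have "admissible (\<lambda>_. -1) s t" using ad(1-3) by (simp add: admissible_def)
      from predictable_sign_process[OF this, unfolded predictable_def]
      have "(\<lambda>(u, \<omega>). sign_process (\<lambda>_. -1) s t u \<omega>) \<in> borel_measurable (predictable_sigma (space M) F)" by simp
      from measurable_sets[OF this, of "{-1}"]
      have "(\<lambda>(u, \<omega>). sign_process (\<lambda>_. -1) s t u \<omega>) -` {-1} \<inter> space (predictable_sigma (space M) F)
        \<in> sets (predictable_sigma (space M) F)" by simp
      also have "(\<lambda>(u, \<omega>). sign_process (\<lambda>_. -1) s t u \<omega>) -` {-1} \<inter> space (predictable_sigma (space M) F) = {s<..t} \<times> space M"
        using ad(1-3) by (auto simp: sign_process_def predictable_sigma_def space_measure_of_conv split: if_splits)
      finally show ?thesis .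
    qed
    then have "(\<lambda>x. (case x of (u, \<omega>) \<Rightarrow> sign_process e s t u \<omega>) * (c * indicator ({s<..t} \<times> space M) x))
      \<in> borel_measurable (predictable_sigma (space M) F)"
      using predictable_sign_process[OF e] by (simp add: predictable_def)
    also have "?this \<longleftrightarrow> (\<lambda>(u, \<omega>). sign_process e s t u \<omega> * (c * indicator {s<..t} u)) \<in> borel_measurable (predictable_sigma (space M) F)"
      by (intro measurable_cong) (auto simp: predictable_sigma_def space_measure_of_conv indicator_def)
    finally show ?thesis by (simp add: predictable_def)
  qed
  moreover have "\<forall>u\<in>{0..1}. sign_integral c e s t u \<in> borel_measurable (F u)"
    using sign_integral_adapted[OF e] by blast
  moreover have "AE \<omega> in N. continuous_on {0..1} (\<lambda>u. sign_integral c e s t u \<omega>)"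
    using AE_completion[OF W_continuous]
  proof eventually_elim
    case (elim \<omega>)
    have "continuous_on {0..1} (\<lambda>u. W (min u r) \<omega>)" if "0 \<le> r" "r \<le> 1" for r
      using that by (intro continuous_on_compose2[OF elim]) (auto intro!: continuous_intros)
    then show ?case
      unfolding sign_integral_def using ad(1-3) by (intro continuous_intros) auto
  qed
  moreover have "elementary_integrand N F 1 \<tau> \<xi>"
  proof -
    have "\<bar>\<xi> i \<omega>\<bar> \<le> \<bar>c\<bar>" if "\<omega> \<in> space N" for i \<omega>
      using ad(7)[of \<omega>] that by (simp add: \<xi>_def abs_mult)
    moreover have "\<xi> i \<in> borel_measurable (F s)" for i
      unfolding \<xi>_def[abs_def] using ad(4) by measurable
    ultimately show ?thesis
      using ad(1-3) unfolding elementary_integrand_def by (auto simp: \<tau>_def)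
  qed
  moreover have "L2_tendsto ?P (\<lambda>k (u, \<omega>). elementary_process 1 \<tau> \<xi> u \<omega>)
    (\<lambda>(u, \<omega>). sign_process e s t u \<omega> * (c * indicator {s<..t} u))"
  proof -
    have fin: "finite_measure ?P"
      by (intro finite_measure_pair_measure finite_measure_unit_lborel N.finite_measure_axioms)
    have "indicator {s<..t} \<in> borel_measurable unit_lborel"
      by (intro measurable_restrict_space1) auto
    then have "(\<lambda>x. indicator {s<..t} (fst x) :: real) \<in> borel_measurable ?P"
      by (rule measurable_compose[OF measurable_fst])
    moreover have "(\<lambda>x. e (snd x)) \<in> borel_measurable ?P"
      by (rule measurable_compose[OF measurable_snd ad(5)])
    ultimately have "(\<lambda>x. c * e (snd x) * indicator {s<..t} (fst x)) \<in> borel_measurable ?P" by measurable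
    then have "sq_integrable ?P (\<lambda>x. c * e (snd x) * indicator {s<..t} (fst x))"
      using ad(7) by (intro finite_measure.sq_integrable_bounded[OF fin, where K="\<bar>c\<bar>"])
        (auto simp: abs_mult indicator_def space_pair_measure)
    then show ?thesis
      unfolding process eq case_prod_unfold
      by (intro L2_tendsto_const_AE) (auto simp: sq_integrable_def)
  qed
  moreover have "\<forall>u\<in>{0..1}. L2_tendsto N (\<lambda>k. elementary_integral W 1 \<tau> \<xi> u) (sign_integral c e s t u)"
    unfolding integral using sq_integrable_sign_integral[OF e]
    by (auto intro!: L2_tendsto_const_AE simp: sq_integrable_def)
  ultimately show ?thesis
    unfolding is_ito_integral_def
    by (intro conjI exI[of _ "\<lambda>_. 1"] exI[of _ "\<lambda>_. \<tau>"] exI[of _ "\<lambda>_. \<xi>"]) auto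
qed

end

section \<open>The decomposition\<close>

context brownian
begin

lemma sign_integral_1: "s < t \<Longrightarrow> t \<le> 1 \<Longrightarrow> sign_integral c e s t 1 = (\<lambda>\<omega>. c * e \<omega> * (W t \<omega> - W s \<omega>))"
  by (rule ext) (simp add: sign_integral_def min_def)

definition sign_integrals :: "('a \<Rightarrow> real) set" where
  "sign_integrals = {sign_integral c e s t 1 | c e s t. admissible e s t}"

text \<open>\<open>integral_subspace\<close> asks for the constants, to which the \<open>R n\<close>
  need not be asymptotically orthogonal. Subtracting the means \<open>r n\<close> repairs this and
  costs only a factor 2 in the norm bound; inner products with the centred functions
  \<open>X\<close> and \<open>d\<close> do not change.\<close>

lemma sign_integrals_total:
  assumes X: "X \<in> borel_measurable (F 1)" "sq_integrable N X" "(\<integral>\<omega>. X \<omega> \<partial>N) = 0"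
    and R: "\<And>n. sq_integrable N (R n)" and K: "\<And>n. L2_norm N (R n) \<le> K"
    and lim: "\<And>d. d \<in> sign_integrals \<Longrightarrow> (\<lambda>n. \<integral>\<omega>. R n \<omega> * d \<omega> \<partial>N) \<longlonglongrightarrow> 0"
  shows "(\<lambda>n. \<integral>\<omega>. R n \<omega> * X \<omega> \<partial>N) \<longlonglongrightarrow> 0"
proof -
  define r where "r n = (\<integral>\<omega>. R n \<omega> \<partial>N)" for n
  have sqR: "sq_integrable N (\<lambda>\<omega>. R n \<omega> - r n)" for n
    by (intro sq_integrable_diff R N.sq_integrable_const)
  have one: "L2_norm N (\<lambda>\<omega>. 1) = 1" using N.prob_space by (simp add: L2_norm_def)
  have r_bound: "\<bar>r n\<bar> \<le> K" for n
    using order_trans[OF L2_Cauchy_Schwarz[OF R[of n] N.sq_integrable_const[of 1]]] K[of n]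
    by (simp add: r_def one)
  have K': "L2_norm N (\<lambda>\<omega>. R n \<omega> - r n) \<le> 2 * K" for n
  proof -
    have "L2_norm N (\<lambda>\<omega>. R n \<omega> + (- r n) * 1) \<le> L2_norm N (R n) + L2_norm N (\<lambda>\<omega>. (- r n) * 1)"
      by (intro L2_norm_triangle R sq_integrable_cmult N.sq_integrable_const)
    also have "\<dots> \<le> K + K"
      unfolding L2_norm_cmult one using K[of n] r_bound[of n] by simp
    finally show ?thesis by simp
  qed
  have centre: "(\<integral>\<omega>. (R n \<omega> - r n) * T \<omega> \<partial>N) = (\<integral>\<omega>. R n \<omega> * T \<omega> \<partial>N) - r n * (\<integral>\<omega>. T \<omega> \<partial>N)"
    if "sq_integrable N T" for n T
    using sq_integrable_mult[OF R that] N.sq_integrable_integrable[OF that] by (simp add: left_diff_distrib)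
  define S where "S = {T. sq_integrable N T \<and> (\<lambda>n. \<integral>\<omega>. (R n \<omega> - r n) * T \<omega> \<partial>N) \<longlonglongrightarrow> 0}"
  have mem: "sign_integral 1 e s t 1 \<in> S" if e: "admissible e s t" for e s t
  proof -
    have "(\<integral>\<omega>. sign_integral 1 e s t 1 \<omega> \<partial>N) = 0"
      using integral_past_times_increment[of s t e 1] admissibleD[OF e]
      by (simp add: sign_integral_1)
    moreover have "sign_integral 1 e s t 1 \<in> sign_integrals"
      using e by (auto simp: sign_integrals_def)
    ultimately show ?thesis
      using lim sq_integrable_sign_integral[OF e] by (simp add: S_def centre)
  qed
  have closed: "closed_L2_subspace N S"
    unfolding S_def by (rule closed_L2_subspace_weakly_null[OF sqR K'])
  interpret L: L2_subspace N S by (unfold_locales) (rule closed)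
  interpret I: integral_subspace M W S
  proof unfold_locales
    show "(\<lambda>\<omega>. 1) \<in> S"
      using centre[OF N.sq_integrable_const[of 1]] N.sq_integrable_const[of 1] N.prob_space
      by (simp add: S_def r_def)
    fix s t :: real and A assume st: "0 \<le> s" "s < t" "t \<le> 1" and A: "A \<in> sets (F s)"
    \<comment> \<open>The sign with \<open>indicator A = (e + 1) / 2\<close>.\<close>
    define e :: "'a \<Rightarrow> real" where "e \<omega> = 2 * indicator A \<omega> - 1" for \<omega>
    have "e \<in> borel_measurable (F s)" unfolding e_def[abs_def] using A by simp
    then have "admissible e s t" "admissible (\<lambda>_. 1) s t"
      using st by (auto simp: admissible_def e_def indicator_def)
    then have "(\<lambda>\<omega>. 1 / 2 * sign_integral 1 e s t 1 \<omega> + 1 / 2 * sign_integral 1 (\<lambda>_. 1) s t 1 \<omega>) \<in> S"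
      by (intro L.lincomb mem)
    also have "(\<lambda>\<omega>. 1 / 2 * sign_integral 1 e s t 1 \<omega> + 1 / 2 * sign_integral 1 (\<lambda>_. 1) s t 1 \<omega>) =
      (\<lambda>\<omega>. indicator A \<omega> * (W t \<omega> - W s \<omega>))"
      using st by (simp add: sign_integral_1 e_def algebra_simps)
    finally show "(\<lambda>\<omega>. indicator A \<omega> * (W t \<omega> - W s \<omega>)) \<in> S" .
  qed
  have "X \<in> S" using I.F_measurable_mem[OF X(1,2)] .
  then show ?thesis by (simp add: S_def centre X)
qed

text \<open>The expansion is made at time 1 only, where \<open>X 1\<close> is centred because
  \<open>X 0\<close> vanishes. The error at time \<open>u\<close> is the conditional expectation of
  the error at time 1, so its norm is no larger.\<close>

lemma decomposition:
  assumes X: "L2_martingale N F X" and X0: "AE \<omega> in N. X 0 \<omega> = 0"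
  obtains c e s t where "\<And>n. admissible (e n) (s n) (t n)"
    and "\<And>u. u \<in> {0..1} \<Longrightarrow> L2_tendsto N (\<lambda>m \<omega>. \<Sum>n<m. sign_integral (c n) (e n) (s n) (t n) u \<omega>) (X u)"
    and "(\<lambda>n. (L2_norm N (sign_integral (c n) (e n) (s n) (t n) 1))\<^sup>2) sums (L2_norm N (X 1))\<^sup>2"
proof -
  have sqX: "sq_integrable N (X u)" and adapted: "X u \<in> borel_measurable (F u)"
    and intX: "integrable N (X u)" if "u \<in> {0..1}" for u
    using X that by (auto simp: L2_martingale_def martingale_def)
  have ce: "AE \<omega> in N. real_cond_exp N (F u) (X 1) \<omega> = X u \<omega>" if "u \<in> {0..1}" for u
    using X that by (auto simp: L2_martingale_def martingale_def)
  have EX: "(\<integral>\<omega>. X 1 \<omega> \<partial>N) = 0"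
  proof -
    interpret finite_measure_subalgebra N "F 0" by (rule finite_measure_subalgebra_F) simp
    have "(\<integral>\<omega>. X 1 \<omega> \<partial>N) = (\<integral>\<omega>. real_cond_exp N (F 0) (X 1) \<omega> \<partial>N)"
      using intX[of 1] by (simp add: real_cond_exp_int(2))
    also have "\<dots> = (\<integral>\<omega>. 0 \<partial>N)"
      using ce[of 0] X0 by (intro integral_cong_AE) auto
    finally show ?thesis by simp
  qed
  have "\<exists>Y. (\<forall>n::nat. Y n \<in> sign_integrals) \<and>
    (\<lambda>m. L2_norm N (\<lambda>\<omega>. (\<Sum>n<m. Y n \<omega>) - X 1 \<omega>)) \<longlonglongrightarrow> 0 \<and>
    (\<lambda>n. (L2_norm N (Y n))\<^sup>2) sums (L2_norm N (X 1))\<^sup>2"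
  proof (rule weak_greedy_expansion)
    show "sq_integrable N (X 1)" by (rule sqX) simp
    show "sq_integrable N d" if "d \<in> sign_integrals" for d
      using that sq_integrable_sign_integral by (auto simp: sign_integrals_def)
    show "(\<lambda>\<omega>. c * d \<omega>) \<in> sign_integrals" if d_mem: "d \<in> sign_integrals" for c d
    proof -
      obtain b e s t where d: "d = sign_integral b e s t 1" "admissible e s t"
        using d_mem unfolding sign_integrals_def by blast
      have "(\<lambda>\<omega>. c * d \<omega>) = sign_integral (c * b) e s t 1"
        by (rule ext) (simp add: d sign_integral_def)
      then show ?thesis using d(2) by (auto simp: sign_integrals_def)
    qed
    have "admissible (\<lambda>_. 1) 0 1" by (simp add: admissible_def)
    then show "sign_integrals \<noteq> {}" by (auto simp: sign_integrals_def)
    show "(\<lambda>n. \<integral>\<omega>. R n \<omega> * X 1 \<omega> \<partial>N) \<longlonglongrightarrow> 0"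
      if "\<And>n. sq_integrable N (R n)" "\<And>n. L2_norm N (R n) \<le> K"
        "\<And>d. d \<in> sign_integrals \<Longrightarrow> (\<lambda>n. \<integral>\<omega>. R n \<omega> * d \<omega> \<partial>N) \<longlonglongrightarrow> 0" for R K
      by (rule sign_integrals_total[OF adapted sqX EX that]) auto
  qed
  then obtain Y where YD: "\<And>n. Y n \<in> sign_integrals"
    and Y_lim: "(\<lambda>m. L2_norm N (\<lambda>\<omega>. (\<Sum>n<m. Y n \<omega>) - X 1 \<omega>)) \<longlonglongrightarrow> 0"
    and Y_sums: "(\<lambda>n. (L2_norm N (Y n))\<^sup>2) sums (L2_norm N (X 1))\<^sup>2" by blast
  have "\<forall>n. \<exists>c e s t. Y n = sign_integral c e s t 1 \<and> admissible e s t"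
    using YD unfolding sign_integrals_def by blast
  then obtain c e s t where Y: "\<And>n. Y n = sign_integral (c n) (e n) (s n) (t n) 1"
    and ad: "\<And>n. admissible (e n) (s n) (t n)" by metis
  define y where "y n = sign_integral (c n) (e n) (s n) (t n)" for n
  have sqy: "sq_integrable N (y n u)" for n u
    unfolding y_def by (rule sq_integrable_sign_integral[OF ad])
  have mart: "martingale N F (y n)" for n
    unfolding y_def by (rule martingale_sign_integral[OF ad])
  have "L2_tendsto N (\<lambda>m \<omega>. \<Sum>n<m. y n u \<omega>) (X u)" if u: "u \<in> {0..1}" for u
  proof -
    interpret finite_measure_subalgebra N "F u" using u by (intro finite_measure_subalgebra_F) simp
    have le: "L2_norm N (\<lambda>\<omega>. (\<Sum>n<m. y n u \<omega>) - X u \<omega>) \<le> L2_norm N (\<lambda>\<omega>. (\<Sum>n<m. y n 1 \<omega>) - X 1 \<omega>)" for m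
    proof (rule L2_norm_cond_exp_le)
      show "sq_integrable N (\<lambda>\<omega>. (\<Sum>n<m. y n 1 \<omega>) - X 1 \<omega>)"
        by (intro sq_integrable_diff sq_integrable_sum sqy sqX) auto
      show "sq_integrable N (\<lambda>\<omega>. (\<Sum>n<m. y n u \<omega>) - X u \<omega>)"
        by (intro sq_integrable_diff sq_integrable_sum sqy sqX u)
      have "y n u \<in> borel_measurable (F u)" for n
        using mart[of n] u by (auto simp: martingale_def)
      then show "(\<lambda>\<omega>. (\<Sum>n<m. y n u \<omega>) - X u \<omega>) \<in> borel_measurable (F u)"
        using adapted[OF u] by measurable
      have int: "integrable N (y n 1)" for n by (rule N.sq_integrable_integrable[OF sqy])
      have "AE \<omega> in N. \<forall>n. real_cond_exp N (F u) (y n 1) \<omega> = y n u \<omega>"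
        unfolding AE_all_countable using mart u by (auto simp: martingale_def)
      moreover have "AE \<omega> in N. real_cond_exp N (F u) (\<lambda>\<omega>. (\<Sum>n<m. y n 1 \<omega>) - X 1 \<omega>) \<omega> =
        real_cond_exp N (F u) (\<lambda>\<omega>. \<Sum>n<m. y n 1 \<omega>) \<omega> - real_cond_exp N (F u) (X 1) \<omega>"
        using int intX[of 1] by (intro real_cond_exp_diff) auto
      moreover have "AE \<omega> in N. real_cond_exp N (F u) (\<lambda>\<omega>. \<Sum>n<m. y n 1 \<omega>) \<omega> =
        (\<Sum>n<m. real_cond_exp N (F u) (y n 1) \<omega>)"
        by (rule real_cond_exp_sum[OF int])
      ultimately show "AE \<omega> in N. real_cond_exp N (F u) (\<lambda>\<omega>. (\<Sum>n<m. y n 1 \<omega>) - X 1 \<omega>) \<omega> =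
        (\<Sum>n<m. y n u \<omega>) - X u \<omega>"
        using ce[OF u] by eventually_elim simp
    qed
    have "(\<lambda>m. L2_norm N (\<lambda>\<omega>. (\<Sum>n<m. y n u \<omega>) - X u \<omega>)) \<longlonglongrightarrow> 0"
    proof (rule tendsto_sandwich[OF _ _ tendsto_const])
      show "(\<lambda>m. L2_norm N (\<lambda>\<omega>. (\<Sum>n<m. y n 1 \<omega>) - X 1 \<omega>)) \<longlonglongrightarrow> 0"
        using Y_lim by (simp add: Y y_def)
    qed (use le in \<open>auto simp: L2_norm_nonneg\<close>)
    then show ?thesis
      unfolding L2_tendsto_def by (intro conjI allI sq_integrable_sum sqy sqX u)
  qed
  then show thesis using ad Y_sums by (intro that[of e s t c]) (simp_all add: Y y_def)
qed

end

theorem theorem3p4: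
  fixes M :: "'a measure" and W X :: "real \<Rightarrow> 'a \<Rightarrow> real"
  assumes "prob_space M"
    and "brownian_motion M W"
    and "L2_martingale (completion M) (brownian_filtration M W) X"
    and "AE \<omega> in completion M. X 0 \<omega> = 0"
  shows "\<exists>(Y :: nat \<Rightarrow> real \<Rightarrow> 'a \<Rightarrow> real) (\<phi> :: nat \<Rightarrow> real \<Rightarrow> 'a \<Rightarrow> real) (f :: nat \<Rightarrow> real \<Rightarrow> real).
    (\<forall>n. gaussian_martingale (completion M) (brownian_filtration M W) (Y n) \<and>
         (\<forall>\<omega>\<in>space M. Y n 0 \<omega> = 0) \<and>
         predictable (completion M) (brownian_filtration M W) (\<phi> n) \<and>
         (\<forall>t\<in>{0..1}. \<forall>\<omega>\<in>space M. \<bar>\<phi> n t \<omega>\<bar> = 1) \<and>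
         sq_integrable unit_lborel (f n) \<and>
         is_ito_integral (completion M) (brownian_filtration M W) W
           (\<lambda>t \<omega>. \<phi> n t \<omega> * f n t) (Y n)) \<and>
    (\<forall>t\<in>{0..1}. L2_tendsto (completion M) (\<lambda>N \<omega>. \<Sum>n<N. Y n t \<omega>) (X t)) \<and>
    (\<lambda>n. (L2_norm (completion M) (Y n 1))\<^sup>2) sums (L2_norm (completion M) (X 1))\<^sup>2"
proof -
  interpret brownian M W
    using assms(1,2) by (simp add: brownian_def brownian_axioms_def)
  obtain c e s t where ad: "\<And>n. admissible (e n) (s n) (t n)"
    and lim: "\<And>u. u \<in> {0..1} \<Longrightarrow> L2_tendsto N (\<lambda>m \<omega>. \<Sum>n<m. sign_integral (c n) (e n) (s n) (t n) u \<omega>) (X u)"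
    and sums: "(\<lambda>n. (L2_norm N (sign_integral (c n) (e n) (s n) (t n) 1))\<^sup>2) sums (L2_norm N (X 1))\<^sup>2"
    by (rule decomposition[OF assms(3,4)]) (rule that)
  show ?thesis
  proof (rule exI[of _ "\<lambda>n. sign_integral (c n) (e n) (s n) (t n)"],
      rule exI[of _ "\<lambda>n. sign_process (e n) (s n) (t n)"],
      rule exI[of _ "\<lambda>n u. c n * indicator {s n<..t n} u"], intro conjI allI ballI)
    fix n
    show "sign_integral (c n) (e n) (s n) (t n) 0 \<omega> = 0" for \<omega>
      using admissibleD[OF ad[of n]] by (intro sign_integral_0)
    fix u \<omega> assume "u \<in> {0..1::real}" and \<omega>: "\<omega> \<in> space M"
    show "\<bar>sign_process (e n) (s n) (t n) u \<omega>\<bar> = 1"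
      using admissibleD(7)[OF ad \<omega>] by (simp add: sign_process_def)
  qed (use lim sums in \<open>simp_all add: ad gaussian_martingale_sign_integral predictable_sign_process
      sq_integrable_step is_ito_integral_sign_integral\<close>)
qed

end
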